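(* Let $d\ge1$ and let $\phi:\mathbb{R}^d\to\mathbb{R}$ be a function of class $\mathcal{C}^{2,\alpha}(\mathbb{R}^d)$ for some $0<\alpha<1$ which is $1$-periodic in each coordinate. For $b>1$ let $$f_{b,\phi}(x)=\sum_{n=0}^\infty b^{-n}\phi(b^nx),\qquad x\in\mathbb{R}^d.$$ Assume in addition that $\phi$ satisfies condition $\mathcal{H}$. Then: (1) $f_{b,\phi}\in\Lambda_*(\mathbb{R}^d)$ and $f_{b,\phi}$ is nowhere differentiable. (2) For any unit vector $e\in\mathbb{R}^d$, $$m_d\left\{x\in\mathbb{R}^d:\limsup_{t\to0}\frac{|f_{b,\phi}(x+te)-f_{b,\phi}(x)|}{|t|}<\infty\right\}=0.$$ In particular $m_d(\mathcal{D}(f_{b,\phi}))=0$. (3) $\mathrm{Dim}(\mathcal{D}(f_{b,\phi})\cap Q)=d$ for any cube $Q\subset\mathbb{R}^d$.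
   Context: $m_d$ is $d$-dimensional Lebesgue measure; $\mathrm{Dim}$ is Hausdorff dimension. For $0<\varepsilon<1$, $\mathcal{C}^{1,\varepsilon}(\mathbb{R}^d)$ is the class of bounded functions $f:\mathbb{R}^d\to\mathbb{R}$ for which there is a constant $C$ with $|f(x+h)+f(x-h)-2f(x)|\le C|h|^{1+\varepsilon}$ for all $x,h\in\mathbb{R}^d$ (equivalently, differentiable with first partial derivatives in the Hölder class of exponent $\varepsilon$); $\mathcal{C}^{2,\varepsilon}(\mathbb{R}^d)$ is the class of functions whose first partial derivatives are in $\mathcal{C}^{1,\varepsilon}(\mathbb{R}^d)$. $\phi$ is $1$-periodic in each coordinate if $\phi(x_1,\dots,x_i+1,\dots,x_d)=\phi(x_1,\dots,x_d)$ for all $x$ and all $i=1,\dots,d$. Condition $\mathcal{H}$: for each unit vector $e\in\mathbb{R}^d$, either the directional derivative $D_e\phi(0)\ne0$, or the one-variable function $t\mapsto\phi(te)$ is nonconstant and has a global extremum at $t=0$. Zygmund class: a bounded continuous $f:\mathbb{R}^d\to\mathbb{R}$ is in $\Lambda_*(\mathbb{R}^d)$ if $\sup_{x\in\mathbb{R}^d,\,h\in\mathbb{R}^d\setminus\{0\}}\frac{|f(x+h)+f(x-h)-2f(x)|}{|h|}<\infty$. $\mathcal{D}(f)=\{x\in\mathbb{R}^d:\limsup_{|h|\to0}\frac{|f(x+h)-f(x)|}{|h|}<\infty\}$. *)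

theory Defs
  imports "HOL-Analysis.Analysis"
begin

definition has_directional_derivative ::
  "('a::real_normed_vector \<Rightarrow> real) \<Rightarrow> real \<Rightarrow> 'a \<Rightarrow> 'a \<Rightarrow> bool" where
  "has_directional_derivative f D x e \<longleftrightarrow>
     ((\<lambda>t. f (x + t *\<^sub>R e)) has_real_derivative D) (at 0)"

definition C1_class :: "real \<Rightarrow> ('a::real_normed_vector \<Rightarrow> real) set" where
  "C1_class \<epsilon> = {f. bounded (range f) \<and>
     (\<exists>C. \<forall>x h. \<bar>f (x + h) + f (x - h) - 2 * f x\<bar> \<le> C * norm h powr (1 + \<epsilon>))}"

definition C2_class :: "real \<Rightarrow> (real ^ 'n \<Rightarrow> real) set" where
  "C2_class \<epsilon> = {f. \<forall>i. \<exists>g \<in> C1_class \<epsilon>.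
     \<forall>x. has_directional_derivative f (g x) x (axis i 1)}"

definition one_periodic :: "(real ^ 'n \<Rightarrow> real) \<Rightarrow> bool" where
  "one_periodic \<phi> \<longleftrightarrow> (\<forall>i x. \<phi> (x + axis i 1) = \<phi> x)"

definition condition_H :: "('a::real_normed_vector \<Rightarrow> real) \<Rightarrow> bool" where
  "condition_H \<phi> \<longleftrightarrow> (\<forall>e. norm e = 1 \<longrightarrow>
     (\<exists>D. has_directional_derivative \<phi> D 0 e \<and> D \<noteq> 0) \<or>
     (\<not> (\<lambda>t. \<phi> (t *\<^sub>R e)) constant_on UNIV \<and>
      ((\<forall>t. \<phi> (t *\<^sub>R e) \<le> \<phi> 0) \<or> (\<forall>t. \<phi> (t *\<^sub>R e) \<ge> \<phi> 0))))"

definition weierstrass_fun ::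
  "real \<Rightarrow> ('a::real_normed_vector \<Rightarrow> real) \<Rightarrow> 'a \<Rightarrow> real" where
  "weierstrass_fun b \<phi> x = (\<Sum>n. \<phi> (b ^ n *\<^sub>R x) / b ^ n)"

definition zygmund_class :: "('a::real_normed_vector \<Rightarrow> real) set" where
  "zygmund_class = {f. bounded (range f) \<and> continuous_on UNIV f \<and>
     bdd_above {\<bar>f (x + h) + f (x - h) - 2 * f x\<bar> / norm h | x h. h \<noteq> 0}}"

definition lip_points :: "('a::real_normed_vector \<Rightarrow> real) \<Rightarrow> 'a set" where
  "lip_points f =
     {x. Limsup (at 0) (\<lambda>h. ereal (\<bar>f (x + h) - f x\<bar> / norm h)) < \<infinity>}"

definition dir_lip_points :: "('a::real_normed_vector \<Rightarrow> real) \<Rightarrow> 'a \<Rightarrow> 'a set" where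
  "dir_lip_points f e =
     {x. Limsup (at 0) (\<lambda>t. ereal (\<bar>f (x + t *\<^sub>R e) - f x\<bar> / \<bar>t\<bar>)) < \<infinity>}"

(* The power diam(U)^s with the usual conventions that the empty set contributes 0 for
   every s, and every nonempty set contributes 1 for s = 0 (whereas 0 powr 0 = 0). *)
definition diam_power :: "real \<Rightarrow> 'a::metric_space set \<Rightarrow> ennreal" where
  "diam_power s U =
     (if U = {} then 0 else if s = 0 then 1 else ennreal (diameter U powr s))"

(* Boundedness of the covering sets is required explicitly because diameter is
   unspecified on unbounded sets. *)
definition hausdorff_measure :: "real \<Rightarrow> 'a::metric_space set \<Rightarrow> ennreal" where
  "hausdorff_measure s A =
     (SUP \<delta>\<in>{0<..}. Inf {(\<Sum>i. diam_power s (U i)) | U :: nat \<Rightarrow> 'a set.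
        A \<subseteq> (\<Union>i. U i) \<and> (\<forall>i. bounded (U i) \<and> diameter (U i) \<le> \<delta>)})"

definition hausdorff_dim :: "'a::metric_space set \<Rightarrow> ennreal" where
  "hausdorff_dim A = Inf {ennreal s | s. 0 \<le> s \<and> hausdorff_measure s A = 0}"

(* Nondegenerate cubes in arbitrary position and orientation; any part of the boundary
   may be included, so that open, closed and half-open cubes are all covered. *)
definition is_cube :: "(real ^ 'n) set \<Rightarrow> bool" where
  "is_cube Q \<longleftrightarrow> (\<exists>a (T :: real ^ 'n \<Rightarrow> real ^ 'n) r. orthogonal_transformation T \<and> r > 0 \<and>
     (\<lambda>y. a + T y) ` box 0 (vec r) \<subseteq> Q \<and> Q \<subseteq> (\<lambda>y. a + T y) ` cbox 0 (vec r))"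

end

theory Submission
  imports Defs
begin

text \<open>
  Let \<open>S N x\<close> be the sum of \<open>\<nabla>\<phi> (b ^ n x)\<close> over \<open>n < N\<close>. Zooming in at \<open>x\<close> by the factor \<open>b ^ N\<close>
  reproduces \<open>f\<close> near \<open>b ^ N x\<close> up to the linear map \<open>S N x\<close> and a uniformly smooth error, so \<open>f\<close> is in
  the Zygmund class and is Lipschitz at \<open>x\<close> as soon as \<open>S N x\<close> stays bounded in \<open>N\<close>.

  Condition H makes \<open>f\<close> non-differentiable at \<open>0\<close> along every line, and by almost periodicity
  \<open>f\<close> looks like this near some point of every ball, at every scale. Suitably averaged slopes
  in a direction \<open>u\<close> form an exact martingale over finer and finer scales; since they must oscillate, they can be
  lowered by a fixed amount in boundedly many scales, hence by any amount. This shows that the component of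
  \<open>S N\<close> in direction \<open>u\<close> can be driven down near every point, which excludes differentiability
  and makes the sets where this component is bounded porous, hence null.

  For the dimension, the martingale of dyadic slopes has bounded increments, so over \<open>n\<close> generations
  the gradient sum changes by at most \<open>\<epsilon> n\<close> on at least half of the subcubes. In each of
  those, lowering the sum in the direction of its own value brings it back to a bounded set within
  \<open>O(\<epsilon> n)\<close> further generations. The resulting tree of cubes has almost full branching, and its
  limit set consists of Lipschitz points.
\<close>

text \<open>For non-integer \<open>b\<close> the class of \<open>x\<close> modulo the lattice does
  not determine that of \<open>b *\<^sub>R x\<close>, so the behaviour of \<open>f\<close> at 0 can
  be copied only approximately, and only at points supplied by a pigeonhole argument. These points
  usually lie off the segment under study. Moreover a slope agrees with a gradient sum only up to a
  constant that may exceed the gain of one descent step, so a descent by gradient sums alone could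
  lose more than it gains. This dictates the averages: they contain the translates by all candidate
  almost periods, and their martingale identity has no error term. Gains therefore add up, and the
  comparison with gradient sums is paid only at the two ends of the descent. The descent controls a
  single component from one side, whereas Lipschitz points need the whole vector bounded. If a long
  vector is lowered along its own direction by a bounded change, the transversal part of the change
  enters the squared norm only as a bounded term, while the gain is multiplied by the length; so the
  norm itself drops.\<close>

section \<open>Regularity of the generating function\<close>

text \<open>The difference quotients at \<open>h\<close> and at \<open>2 *\<^sub>R h\<close> differ
  by a second difference over \<open>2 * norm h\<close>, hence by a multiple of
  \<open>norm h powr \<epsilon>\<close>. Doubling \<open>h\<close> until its norm is at least 1,
  where boundedness of \<open>g\<close> takes over, sums these errors to a geometric series.\<close>

lemma C1_class_lipschitz:
  fixes g :: "'a::real_normed_vector \<Rightarrow> real"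
  assumes "g \<in> C1_class \<epsilon>" and "0 < \<epsilon>"
  obtains L where "L \<ge> 0" and "\<And>x y. \<bar>g x - g y\<bar> \<le> L * norm (x - y)"
proof -
  obtain M where M: "\<And>x. \<bar>g x\<bar> \<le> M"
    using assms(1) by (auto simp: C1_class_def bounded_iff)
  obtain C0 where C0: "\<And>x h. \<bar>g (x + h) + g (x - h) - 2 * g x\<bar> \<le> C0 * norm h powr (1 + \<epsilon>)"
    using assms(1) by (auto simp: C1_class_def)
  define C where "C = max C0 0"
  have C: "\<bar>g (x + h) + g (x - h) - 2 * g x\<bar> \<le> C * norm h powr (1 + \<epsilon>)" for x h
    by (rule order_trans[OF C0]) (simp add: C_def mult_right_mono)
  have "C \<ge> 0" by (simp add: C_def)
  have "M \<ge> 0" using M[of 0] by linarith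
  \<comment> \<open>Gain per halving of the increment: \<open>q ^ n\<close> bounds
    \<open>norm h powr \<epsilon>\<close> once \<open>norm h\<close> is below
    \<open>(1/2) ^ n\<close>.\<close>
  define q where "q = (1/2::real) powr \<epsilon>"
  have q: "0 < q" "q < 1"
    using assms(2) powr_less_mono2[of \<epsilon> "1/2" 1] by (auto simp: q_def)
  have main: "\<bar>g (x + h) - g x\<bar> \<le> (2 * M + C / 2 * (\<Sum>k<n. q ^ k)) * norm h"
    if "norm h \<ge> (1/2) ^ n" for n x h
    using that
  proof (induction n arbitrary: x h)
    case 0
    have "\<bar>g (x + h) - g x\<bar> \<le> 2 * M" using M[of "x + h"] M[of x] by linarith
    also have "\<dots> \<le> 2 * M * norm h" using 0 \<open>M \<ge> 0\<close> mult_left_mono[of 1 "norm h" "2 * M"] by simp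
    finally show ?case by simp
  next
    case (Suc n)
    define a where "a = 2 * M + C / 2 * (\<Sum>k<n. q ^ k)"
    note IH = Suc.IH[folded a_def]
    have aS: "2 * M + C / 2 * (\<Sum>k<Suc n. q ^ k) = a + C / 2 * q ^ n"
      by (simp add: a_def algebra_simps)
    show ?case
    proof (cases "norm h \<ge> (1/2) ^ n")
      case True
      have "a * norm h \<le> (a + C / 2 * q ^ n) * norm h"
        using q \<open>C \<ge> 0\<close> by (intro mult_right_mono) auto
      with IH[OF True, of x] show ?thesis unfolding aS by linarith
    next
      case False
      have "norm (2 *\<^sub>R h) \<ge> (1/2) ^ n" using Suc.prems by simp
      from IH[OF this, of x] have 1: "\<bar>g (x + 2 *\<^sub>R h) - g x\<bar> \<le> a * (2 * norm h)" by simp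
      have "norm h powr (1 + \<epsilon>) = norm h * norm h powr \<epsilon>"
        by (simp add: powr_add)
      also have "\<dots> \<le> norm h * ((1/2) ^ n) powr \<epsilon>"
        using False assms(2) by (intro mult_left_mono powr_mono2) auto
      also have "((1/2::real) ^ n) powr \<epsilon> = q ^ n"
        unfolding q_def by (simp add: powr_powr mult.commute flip: powr_realpow)
      finally have 2: "C * norm h powr (1 + \<epsilon>) \<le> C * (norm h * q ^ n)"
        using \<open>C \<ge> 0\<close> by (rule mult_left_mono)
      have 3: "\<bar>g (x + 2 *\<^sub>R h) + g x - 2 * g (x + h)\<bar> \<le> C * norm h powr (1 + \<epsilon>)"
        using C[of "x + h" h] by (simp add: scaleR_2 add.assoc)
      have "2 * (g (x + h) - g x) = (g (x + 2 *\<^sub>R h) - g x) - (g (x + 2 *\<^sub>R h) + g x - 2 * g (x + h))"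
        by simp
      then have "2 * \<bar>g (x + h) - g x\<bar>
          \<le> \<bar>g (x + 2 *\<^sub>R h) - g x\<bar> + \<bar>g (x + 2 *\<^sub>R h) + g x - 2 * g (x + h)\<bar>"
        by linarith
      also have "\<dots> \<le> a * (2 * norm h) + C * (norm h * q ^ n)"
        by (rule add_mono[OF 1 order_trans[OF 3 2]])
      finally have "2 * \<bar>g (x + h) - g x\<bar> \<le> a * (2 * norm h) + C * (norm h * q ^ n)" .
      then show ?thesis unfolding aS by (simp add: algebra_simps)
    qed
  qed
  show thesis
  proof
    show "0 \<le> 2 * M + C / 2 * (1 / (1 - q))" using \<open>M \<ge> 0\<close> \<open>C \<ge> 0\<close> q by simp
    fix x y
    show "\<bar>g x - g y\<bar> \<le> (2 * M + C / 2 * (1 / (1 - q))) * norm (x - y)"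
    proof (cases "x = y")
      case False
      then obtain n where "(1/2) ^ n < norm (x - y)"
        using real_arch_pow_inv[of "norm (x - y)" "1/2"] by auto
      then have "\<bar>g (y + (x - y)) - g y\<bar> \<le> (2 * M + C / 2 * (\<Sum>k<n. q ^ k)) * norm (x - y)"
        by (intro main) simp
      also have "\<dots> \<le> (2 * M + C / 2 * (1 / (1 - q))) * norm (x - y)"
      proof (intro mult_right_mono add_left_mono mult_left_mono)
        have "(\<Sum>k<n. q ^ k) \<le> suminf (\<lambda>k. q ^ k)"
          using q by (intro sum_le_suminf summable_geometric) auto
        then show "(\<Sum>k<n. q ^ k) \<le> 1 / (1 - q)" using q by (simp add: suminf_geometric)
      qed (use \<open>C \<ge> 0\<close> in auto)
      finally show ?thesis by simp
    qed auto
  qed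
qed

lemma norm_le_card_times:
  fixes x :: "real ^ 'n" and w :: real
  assumes "\<And>i. \<bar>x $ i\<bar> \<le> w" shows "norm x \<le> CARD('n) * w"
  using sum_mono[of UNIV "\<lambda>i. \<bar>x $ i\<bar>" "\<lambda>_. w"] norm_le_l1_cart[of x] assms by simp

text \<open>Only partial derivatives are given, so the path from \<open>x\<close> to
  \<open>x + h\<close> follows one coordinate at a time. Each coordinate costs \<open>L\<close> for
  the expansion along the axis and another \<open>L\<close> for moving the partial derivative back
  from the intermediate corner to \<open>x\<close>.\<close>

lemma first_order_remainder:
  fixes \<phi> :: "real ^ 'n \<Rightarrow> real" and g :: "'n \<Rightarrow> real ^ 'n \<Rightarrow> real" and L :: real
  assumes deriv: "\<And>i x. has_directional_derivative \<phi> (g i x) x (axis i 1)"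
    and lip: "\<And>i x y. \<bar>g i x - g i y\<bar> \<le> L * norm (x - y)" and "L \<ge> 0"
  shows "\<bar>\<phi> (x + h) - \<phi> x - (\<chi> i. g i x) \<bullet> h\<bar> \<le> CARD('n) * (2 * L) * (norm h)\<^sup>2"
proof -
  have coord: "\<bar>\<phi> (z + t *\<^sub>R axis i 1) - \<phi> z - t * g i z\<bar> \<le> L * t\<^sup>2" for z i and t :: real
  proof -
    let ?e = "axis i (1::real) :: real ^ 'n"
    let ?p = "\<lambda>s. \<phi> (z + s *\<^sub>R ?e) - s * g i z"
    have D: "((\<lambda>s. \<phi> (z + s *\<^sub>R ?e)) has_real_derivative g i (z + s *\<^sub>R ?e)) (at s)" for s
    proof -
      have "((\<lambda>r. \<phi> (z + s *\<^sub>R ?e + r *\<^sub>R ?e)) has_real_derivative g i (z + s *\<^sub>R ?e)) (at 0)"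
        using deriv unfolding has_directional_derivative_def by blast
      then have "((\<lambda>r. \<phi> (z + (s + r) *\<^sub>R ?e)) has_real_derivative g i (z + s *\<^sub>R ?e)) (at 0)"
        by (simp add: algebra_simps)
      then show ?thesis
        using DERIV_shift[of "\<lambda>r. \<phi> (z + r *\<^sub>R ?e)" "g i (z + s *\<^sub>R ?e)" 0 s]
        by (simp add: add.commute)
    qed
    have "norm (?p t - ?p 0) \<le> (L * \<bar>t\<bar>) * norm (t - 0)"
    proof (rule field_differentiable_bound[where S = "closed_segment 0 t"])
      show "(?p has_field_derivative g i (z + s *\<^sub>R ?e) - g i z) (at s within closed_segment 0 t)" for s
        by (rule has_field_derivative_at_within) (auto intro!: derivative_eq_intros D)
      fix s :: real assume "s \<in> closed_segment 0 t"
      then have "\<bar>s\<bar> \<le> \<bar>t\<bar>" by (auto simp: closed_segment_eq_real_ivl split: if_splits)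
      then have "L * norm (s *\<^sub>R ?e) \<le> L * \<bar>t\<bar>"
        using \<open>L \<ge> 0\<close> by (intro mult_left_mono) auto
      with lip[of i "z + s *\<^sub>R ?e" z] show "norm (g i (z + s *\<^sub>R ?e) - g i z) \<le> L * \<bar>t\<bar>" by simp
    qed auto
    then show ?thesis by (simp add: power2_eq_square mult.assoc algebra_simps)
  qed
  define v where "v S = (\<Sum>i\<in>S. (h $ i) *\<^sub>R axis i (1::real))" for S :: "'n set"
  have vi: "v S $ j = (if j \<in> S then h $ j else 0)" for S j
    unfolding v_def by (simp add: axis_def if_distrib cong: if_cong)
  have "\<bar>\<phi> (x + v S) - \<phi> x - (\<Sum>i\<in>S. h $ i * g i x)\<bar> \<le> card S * (2 * L) * (norm h)\<^sup>2" for S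
  proof (induction S rule: finite_induct[OF finite])
    case 1
    then show ?case by (simp add: v_def)
  next
    case (2 i S)
    have hi: "\<bar>h $ i\<bar> \<le> norm h" by (rule component_le_norm_cart)
    have "norm (v S) \<le> norm h" by (rule norm_le_componentwise_cart) (auto simp: vi)
    then have "L * norm (x + v S - x) \<le> L * norm h" using \<open>L \<ge> 0\<close> by (simp add: mult_left_mono)
    with lip[of i "x + v S" x] have "\<bar>g i (x + v S) - g i x\<bar> \<le> L * norm h" by linarith
    then have "\<bar>h $ i\<bar> * \<bar>g i (x + v S) - g i x\<bar> \<le> norm h * (L * norm h)"
      using hi by (intro mult_mono) auto
    then have a: "\<bar>h $ i * g i (x + v S) - h $ i * g i x\<bar> \<le> L * (norm h)\<^sup>2"
      by (simp add: power2_eq_square abs_mult[symmetric] algebra_simps)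
    have "L * (h $ i)\<^sup>2 \<le> L * (norm h)\<^sup>2"
      using hi \<open>L \<ge> 0\<close> by (intro mult_left_mono) (auto simp: abs_le_square_iff[symmetric])
    with coord[of "x + v S" "h $ i" i]
    have b: "\<bar>\<phi> (x + v S + (h $ i) *\<^sub>R axis i 1) - \<phi> (x + v S) - h $ i * g i (x + v S)\<bar> \<le> L * (norm h)\<^sup>2"
      by linarith
    have c: "x + v (insert i S) = x + v S + (h $ i) *\<^sub>R axis i 1"
      using 2 by (simp add: v_def algebra_simps)
    have d: "real (card (insert i S)) * (2 * L) * (norm h)\<^sup>2 =
        real (card S) * (2 * L) * (norm h)\<^sup>2 + 2 * (L * (norm h)\<^sup>2)"
      using 2 by (simp add: algebra_simps)
    show ?case
      unfolding c d using 2 a b by (simp add: sum.insert)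
  qed
  from this[of UNIV] have "\<bar>\<phi> (x + v UNIV) - \<phi> x - (\<Sum>i\<in>UNIV. h $ i * g i x)\<bar> \<le> CARD('n) * (2 * L) * (norm h)\<^sup>2" .
  moreover have "v UNIV = h" by (simp add: vec_eq_iff vi)
  moreover have "(\<Sum>i\<in>UNIV. h $ i * g i x) = (\<chi> i. g i x) \<bullet> h"
    by (simp add: inner_vec_def mult.commute)
  ultimately show ?thesis by simp
qed

lemma one_periodic_int:
  fixes \<phi> :: "real ^ 'n \<Rightarrow> real"
  assumes "one_periodic \<phi>"
  shows "\<phi> (x + (\<chi> i. of_int (k i))) = \<phi> x"
proof -
  have nat: "\<phi> (x + real n *\<^sub>R axis i 1) = \<phi> x" for x n i
  proof (induction n)
    case (Suc n)
    have "\<phi> (x + real (Suc n) *\<^sub>R axis i 1) = \<phi> (x + real n *\<^sub>R axis i 1 + axis i 1)"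
      by (simp add: algebra_simps)
    then show ?case using Suc assms by (simp add: one_periodic_def)
  qed simp
  have one: "\<phi> (x + of_int m *\<^sub>R axis i 1) = \<phi> x" for x m i
  proof (cases "m \<ge> 0")
    case True
    then show ?thesis using nat[of x "nat m" i] by simp
  next
    case False
    then show ?thesis
      using nat[of "x + of_int m *\<^sub>R axis i 1" "nat (- m)" i] by (simp add: algebra_simps)
  qed
  have "\<phi> (x + (\<Sum>i\<in>S. of_int (k i) *\<^sub>R axis i 1)) = \<phi> x" for S
  proof (induction S rule: finite_induct[OF finite])
    case (2 i S)
    then show ?case
      using one[of "x + (\<Sum>i\<in>S. of_int (k i) *\<^sub>R axis i 1)" "k i" i] by (simp add: algebra_simps)
  qed simp
  moreover have "(\<Sum>i\<in>UNIV. of_int (k i) *\<^sub>R axis i 1) = ((\<chi> i. of_int (k i)) :: real ^ 'n)"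
    by (simp add: vec_eq_iff axis_def if_distrib cong: if_cong)
  ultimately show ?thesis by metis
qed

text \<open>\<open>C2_class\<close> controls derivatives only; the bound on \<phi> itself comes from
  periodicity, by passing to fractional parts and expanding at 0.\<close>

lemma C2_periodic_bounds:
  fixes \<phi> :: "real ^ 'n \<Rightarrow> real"
  assumes "0 < \<alpha>" and "\<phi> \<in> C2_class \<alpha>" and per: "one_periodic \<phi>"
  obtains G :: "real ^ 'n \<Rightarrow> real ^ 'n" and K where
    "\<And>x. \<bar>\<phi> x\<bar> \<le> K" "\<And>x. norm (G x) \<le> K" "\<And>x y. norm (G x - G y) \<le> K * norm (x - y)"
    "\<And>x h. \<bar>\<phi> (x + h) - \<phi> x - G x \<bullet> h\<bar> \<le> K * (norm h)\<^sup>2"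
proof -
  obtain g where g: "\<And>i. g i \<in> C1_class \<alpha>"
    and gd: "\<And>i x. has_directional_derivative \<phi> (g i x) x (axis i 1)"
    using assms(2) unfolding C2_class_def by simp metis
  have "\<exists>B. \<forall>x. \<bar>g i x\<bar> \<le> B" for i
    using g[of i] by (auto simp: C1_class_def bounded_iff)
  then obtain Bi where Bi: "\<And>i x. \<bar>g i x\<bar> \<le> Bi i" by metis
  have "\<exists>L. L \<ge> 0 \<and> (\<forall>x y. \<bar>g i x - g i y\<bar> \<le> L * norm (x - y))" for i
    using C1_class_lipschitz[OF g[of i] \<open>0 < \<alpha>\<close>] by metis
  then obtain Li where Li: "\<And>i. Li i \<ge> 0" "\<And>i x y. \<bar>g i x - g i y\<bar> \<le> Li i * norm (x - y)" by metis
  define L where "L = (\<Sum>i\<in>UNIV. Li i)"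
  define B where "B = (\<Sum>i\<in>UNIV. Bi i)"
  have "L \<ge> 0" unfolding L_def by (intro sum_nonneg Li)
  have LiL: "Li i \<le> L" for i unfolding L_def by (rule member_le_sum) (auto simp: Li)
  have L: "\<bar>g i x - g i y\<bar> \<le> L * norm (x - y)" for i x y
    by (rule order_trans[OF Li(2)]) (simp add: LiL mult_right_mono)
  define G where "G x = (\<chi> i. g i x)" for x
  have Gb: "norm (G x) \<le> B" for x
    unfolding B_def by (rule order_trans[OF norm_le_l1_cart]) (auto simp: G_def intro!: sum_mono Bi)
  have Gl: "norm (G x - G y) \<le> L * norm (x - y)" for x y
    unfolding L_def sum_distrib_right
    by (rule order_trans[OF norm_le_l1_cart]) (auto simp: G_def intro!: sum_mono Li)
  define T where "T = CARD('n) * (2 * L)"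
  have tay: "\<bar>\<phi> (x + h) - \<phi> x - G x \<bullet> h\<bar> \<le> T * (norm h)\<^sup>2" for x h
    unfolding G_def T_def by (rule first_order_remainder[OF gd L \<open>L \<ge> 0\<close>])
  have "T \<ge> 0" using \<open>L \<ge> 0\<close> by (simp add: T_def)
  have "B \<ge> 0" using Gb[of 0] norm_ge_zero order_trans by blast
  define P where "P = \<bar>\<phi> 0\<bar> + B * CARD('n) + T * (CARD('n))\<^sup>2"
  have pb: "\<bar>\<phi> x\<bar> \<le> P" for x
  proof -
    define z where "z = (\<chi> i. frac (x $ i))"
    have "\<phi> x = \<phi> (z + (\<chi> i. of_int \<lfloor>x $ i\<rfloor>))"
      by (rule arg_cong[where f = \<phi>]) (simp add: z_def vec_eq_iff frac_def)
    then have "\<phi> x = \<phi> z" using one_periodic_int[OF per] by simp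
    have nz: "norm z \<le> CARD('n)"
      using norm_le_card_times[of z 1] by (simp add: z_def less_imp_le frac_lt_1)
    have "\<bar>G 0 \<bullet> z\<bar> \<le> B * CARD('n)"
      by (rule order_trans[OF Cauchy_Schwarz_ineq2]) (intro mult_mono Gb nz \<open>B \<ge> 0\<close> norm_ge_zero)
    moreover have "T * (norm z)\<^sup>2 \<le> T * (CARD('n))\<^sup>2"
      using nz \<open>T \<ge> 0\<close> by (intro mult_left_mono power_mono) auto
    ultimately show ?thesis
      using tay[of 0 z] \<open>\<phi> x = \<phi> z\<close> by (simp add: P_def)
  qed
  have "P \<ge> 0" using pb[of 0] by linarith
  define K where "K = P + B + L + T"
  show thesis
  proof
    show "\<bar>\<phi> x\<bar> \<le> K" for x
      using pb[of x] \<open>B \<ge> 0\<close> \<open>L \<ge> 0\<close> \<open>T \<ge> 0\<close> by (simp add: K_def)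
    show "norm (G x) \<le> K" for x
      using Gb[of x] \<open>P \<ge> 0\<close> \<open>L \<ge> 0\<close> \<open>T \<ge> 0\<close> by (simp add: K_def)
    show "norm (G x - G y) \<le> K * norm (x - y)" for x y
      by (rule order_trans[OF Gl], rule mult_right_mono)
        (use \<open>P \<ge> 0\<close> \<open>B \<ge> 0\<close> \<open>T \<ge> 0\<close> in \<open>auto simp: K_def\<close>)
    show "\<bar>\<phi> (x + h) - \<phi> x - G x \<bullet> h\<bar> \<le> K * (norm h)\<^sup>2" for x h
      by (rule order_trans[OF tay], rule mult_right_mono)
        (use \<open>P \<ge> 0\<close> \<open>B \<ge> 0\<close> \<open>L \<ge> 0\<close> in \<open>auto simp: K_def\<close>)
  qed
qed

section \<open>Gradient sums and self-similarity\<close>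

locale weierstrass_series =
  fixes \<phi> :: "real ^ 'n \<Rightarrow> real" and G :: "real ^ 'n \<Rightarrow> real ^ 'n" and K b :: real
  assumes phi_bound: "\<And>x. \<bar>\<phi> x\<bar> \<le> K"
    and grad_bound: "\<And>x. norm (G x) \<le> K"
    and grad_lipschitz: "\<And>x y. norm (G x - G y) \<le> K * norm (x - y)"
    and remainder: "\<And>x h. \<bar>\<phi> (x + h) - \<phi> x - G x \<bullet> h\<bar> \<le> K * (norm h)\<^sup>2"
    and periodic: "one_periodic \<phi>"
    and cond_H: "condition_H \<phi>"
    and b_gt_1: "b > 1"
begin

definition f :: "real ^ 'n \<Rightarrow> real" where "f = weierstrass_fun b \<phi>"
definition S :: "nat \<Rightarrow> real ^ 'n \<Rightarrow> real ^ 'n" where "S N x = (\<Sum>n<N. G (b ^ n *\<^sub>R x))"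
text \<open>The sum of \<open>K / b ^ n\<close> over all \<open>n\<close>, hence a bound for
  \<open>f\<close>.\<close>

definition F :: real where "F = K * b / (b - 1)"
text \<open>The same series without its first term. It bounds \<open>K\<close> times the sum of
  \<open>b ^ n / b ^ N\<close> over \<open>n < N\<close>, the total effect of the coarser scales
  seen at level \<open>N\<close>.\<close>

definition K' :: real where "K' = K / (b - 1)"

lemma b_pos: "b > 0" and b_pow_pos: "b ^ n > 0" and b_nonzero: "b \<noteq> 0"
  using b_gt_1 by auto

lemma K_nonneg: "K \<ge> 0"
  using phi_bound[of 0] by linarith

lemma F_nonneg: "F \<ge> 0" and K'_nonneg: "K' \<ge> 0"
  using K_nonneg b_gt_1 by (auto simp: F_def K'_def)

lemma majorant_sums: "(\<lambda>n. K / b ^ n) sums F"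
proof -
  have "(\<lambda>n. K * (1 / b) ^ n) sums (K * (1 / (1 - 1 / b)))"
    using b_gt_1 by (intro sums_mult geometric_sums) auto
  moreover have "K * (1 / (1 - 1 / b)) = F"
    using b_gt_1 by (simp add: F_def field_simps)
  ultimately show ?thesis by (simp add: power_inverse divide_inverse)
qed

lemma term_bound: "norm (\<phi> (b ^ n *\<^sub>R x) / b ^ n) \<le> K / b ^ n"
  using phi_bound b_pos by (simp add: divide_right_mono)

lemma f_summable: "summable (\<lambda>n. \<phi> (b ^ n *\<^sub>R x) / b ^ n)"
  by (rule summable_comparison_test'[of "\<lambda>n. K / b ^ n"])
    (use term_bound majorant_sums in \<open>auto simp: sums_iff\<close>)

lemma f_bound: "\<bar>f x\<bar> \<le> F"
proof -
  have "norm (f x) \<le> (\<Sum>n. K / b ^ n)"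
    unfolding f_def weierstrass_fun_def
    by (rule norm_suminf_le) (use term_bound majorant_sums in \<open>auto simp: sums_iff\<close>)
  then show ?thesis using majorant_sums by (simp add: sums_iff)
qed

lemma f_step: "f x = \<phi> x + f (b *\<^sub>R x) / b"
proof -
  have "f (b *\<^sub>R x) / b = (\<Sum>n. \<phi> (b ^ n *\<^sub>R b *\<^sub>R x) / b ^ n / b)"
    unfolding f_def weierstrass_fun_def by (rule suminf_divide[symmetric, OF f_summable])
  also have "\<dots> = (\<Sum>n. \<phi> (b ^ Suc n *\<^sub>R x) / b ^ Suc n)"
    by (simp add: mult.commute)
  also have "\<dots> = f x - \<phi> x"
    unfolding f_def weierstrass_fun_def by (subst suminf_split_head[OF f_summable]) simp
  finally show ?thesis by simp
qed

lemma f_split: "f x = (\<Sum>n<N. \<phi> (b ^ n *\<^sub>R x) / b ^ n) + f (b ^ N *\<^sub>R x) / b ^ N"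
proof (induction N)
  case (Suc N)
  then show ?case using f_step[of "b ^ N *\<^sub>R x"] by (simp add: add_divide_distrib)
qed simp

lemma power_sum_le: "(\<Sum>n<N. b ^ n) \<le> b ^ N / (b - 1)"
  using b_gt_1 by (simp add: geometric_sum divide_right_mono)

text \<open>The Lipschitz constants \<open>K * b ^ n\<close> grow geometrically, so the last terms
  dominate: at distances of order \<open>1 / b ^ N\<close> the sum varies by a bounded amount,
  uniformly in \<open>N\<close>.\<close>

lemma S_lipschitz: "norm (S N x - S N y) \<le> K' * (b ^ N * norm (x - y))"
proof -
  have "norm (S N x - S N y) \<le> (\<Sum>n<N. K * (b ^ n * norm (x - y)))"
    unfolding S_def sum_subtractf[symmetric]
  proof (rule sum_norm_le)
    fix n
    have "norm (b ^ n *\<^sub>R x - b ^ n *\<^sub>R y) = b ^ n * norm (x - y)"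
      using b_pow_pos[of n] by (simp flip: scaleR_diff_right)
    then show "norm (G (b ^ n *\<^sub>R x) - G (b ^ n *\<^sub>R y)) \<le> K * (b ^ n * norm (x - y))"
      using grad_lipschitz by metis
  qed
  also have "\<dots> = K * norm (x - y) * (\<Sum>n<N. b ^ n)"
    by (simp add: sum_distrib_left mult_ac)
  also have "\<dots> \<le> K * norm (x - y) * (b ^ N / (b - 1))"
    using K_nonneg by (intro mult_left_mono power_sum_le) auto
  finally show ?thesis by (simp add: K'_def field_simps)
qed

lemma S_diff: "norm (S (N + m) x - S N x) \<le> K * m"
proof -
  have "S (N + m) x - S N x = (\<Sum>n\<in>{N..<N+m}. G (b ^ n *\<^sub>R x))"
    unfolding S_def using sum_diff_nat_ivl[of 0 N "N + m" "\<lambda>n. G (b ^ n *\<^sub>R x)"]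
    by (simp add: atLeast0LessThan)
  also have "norm \<dots> \<le> (\<Sum>n\<in>{N..<N+m}. K)"
    by (rule sum_norm_le) (rule grad_bound)
  finally show ?thesis by (simp add: mult.commute)
qed

text \<open>The terms with \<open>n \<ge> N\<close> reproduce the increment of \<open>f\<close> at
  \<open>b ^ N *\<^sub>R x\<close> exactly. A term with \<open>n < N\<close> sees an increment
  shrunk by \<open>b ^ n / b ^ N\<close>, so its linearisation error after rescaling is
  \<open>K * (norm h)\<^sup>2\<close> times that ratio, and these errors sum to a bound free of
  \<open>N\<close>.\<close>

lemma zoom:
  "\<bar>b ^ N * (f (x + h /\<^sub>R b ^ N) - f x) - S N x \<bullet> h - (f (b ^ N *\<^sub>R x + h) - f (b ^ N *\<^sub>R x))\<bar>
     \<le> K' * (norm h)\<^sup>2"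
proof -
  define R where "R n = b ^ N / b ^ n * (\<phi> (b ^ n *\<^sub>R x + (b ^ n / b ^ N) *\<^sub>R h) - \<phi> (b ^ n *\<^sub>R x))
    - G (b ^ n *\<^sub>R x) \<bullet> h" for n
  have arg: "b ^ n *\<^sub>R (x + h /\<^sub>R b ^ N) = b ^ n *\<^sub>R x + (b ^ n / b ^ N) *\<^sub>R h" for n
    by (simp add: scaleR_add_right divide_inverse)
  have argN: "b ^ N *\<^sub>R (x + h /\<^sub>R b ^ N) = b ^ N *\<^sub>R x + h"
    using b_pow_pos[of N] b_gt_1 by (simp add: arg)
  have "b ^ N * (f (x + h /\<^sub>R b ^ N) - f x) - (f (b ^ N *\<^sub>R x + h) - f (b ^ N *\<^sub>R x)) =
     (\<Sum>n<N. b ^ N / b ^ n * (\<phi> (b ^ n *\<^sub>R x + (b ^ n / b ^ N) *\<^sub>R h) - \<phi> (b ^ n *\<^sub>R x)))"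
    (is "?l = ?r")
  proof -
    have "?l = b ^ N * ((\<Sum>n<N. \<phi> (b ^ n *\<^sub>R x + (b ^ n / b ^ N) *\<^sub>R h) / b ^ n)
        - (\<Sum>n<N. \<phi> (b ^ n *\<^sub>R x) / b ^ n))"
      unfolding f_split[of "x + h /\<^sub>R b ^ N" N] f_split[of x N] argN
      unfolding arg using b_gt_1 by (simp add: algebra_simps)
    also have "\<dots> = ?r"
      unfolding sum_subtractf[symmetric] sum_distrib_left
      by (intro sum.cong) (auto simp: algebra_simps diff_divide_distrib)
    finally show ?thesis .
  qed
  moreover have "S N x \<bullet> h = (\<Sum>n<N. G (b ^ n *\<^sub>R x) \<bullet> h)"
    by (simp add: S_def inner_sum_left)
  ultimately have eq: "b ^ N * (f (x + h /\<^sub>R b ^ N) - f x) - S N x \<bullet> h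
      - (f (b ^ N *\<^sub>R x + h) - f (b ^ N *\<^sub>R x)) = (\<Sum>n<N. R n)"
    by (simp add: R_def sum_subtractf)
  have "\<bar>R n\<bar> \<le> K * (norm h)\<^sup>2 / b ^ N * b ^ n" for n
  proof -
    let ?c = "b ^ n / b ^ N"
    have c: "?c > 0" using b_pos by simp
    have "\<bar>\<phi> (b ^ n *\<^sub>R x + ?c *\<^sub>R h) - \<phi> (b ^ n *\<^sub>R x) - G (b ^ n *\<^sub>R x) \<bullet> (?c *\<^sub>R h)\<bar>
        \<le> K * (norm (?c *\<^sub>R h))\<^sup>2" by (rule remainder)
    also have "(norm (?c *\<^sub>R h))\<^sup>2 = ?c\<^sup>2 * (norm h)\<^sup>2"
      using c by (simp only: norm_scaleR power_mult_distrib power2_abs)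
    finally have 1: "\<bar>\<phi> (b ^ n *\<^sub>R x + ?c *\<^sub>R h) - \<phi> (b ^ n *\<^sub>R x) - ?c * (G (b ^ n *\<^sub>R x) \<bullet> h)\<bar>
        \<le> K * (?c\<^sup>2 * (norm h)\<^sup>2)" by simp
    have "R n = (\<phi> (b ^ n *\<^sub>R x + ?c *\<^sub>R h) - \<phi> (b ^ n *\<^sub>R x) - ?c * (G (b ^ n *\<^sub>R x) \<bullet> h)) / ?c"
      unfolding R_def using b_nonzero by (simp add: field_simps)
    also have "\<bar>\<dots>\<bar> \<le> K * (?c\<^sup>2 * (norm h)\<^sup>2) / ?c"
      unfolding abs_div_pos[OF c, symmetric] using 1 c by (intro divide_right_mono) auto
    also have "\<dots> = K * (norm h)\<^sup>2 * ?c"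
      using c by (simp add: power2_eq_square field_simps)
    finally show ?thesis by simp
  qed
  then have "\<bar>\<Sum>n<N. R n\<bar> \<le> (\<Sum>n<N. K * (norm h)\<^sup>2 / b ^ N * b ^ n)"
    by (intro order_trans[OF sum_abs] sum_mono)
  also have "\<dots> = K * (norm h)\<^sup>2 / b ^ N * (\<Sum>n<N. b ^ n)" by (simp add: sum_distrib_left)
  also have "\<dots> \<le> K * (norm h)\<^sup>2 / b ^ N * (b ^ N / (b - 1))"
    using K_nonneg b_pos by (intro mult_left_mono power_sum_le) auto
  also have "\<dots> = K' * (norm h)\<^sup>2" by (simp add: K'_def b_nonzero)
  finally show ?thesis unfolding eq .
qed

lemma phi_lipschitz: "\<bar>\<phi> x - \<phi> y\<bar> \<le> 2 * K * norm (x - y)"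
proof (cases "norm (x - y) \<le> 1")
  case True
  have "\<bar>\<phi> (y + (x - y)) - \<phi> y - G y \<bullet> (x - y)\<bar> \<le> K * (norm (x - y))\<^sup>2" by (rule remainder)
  moreover have "\<bar>G y \<bullet> (x - y)\<bar> \<le> K * norm (x - y)"
    by (rule order_trans[OF Cauchy_Schwarz_ineq2]) (simp add: grad_bound mult_right_mono)
  moreover have "K * (norm (x - y))\<^sup>2 \<le> K * norm (x - y)"
    using True K_nonneg by (intro mult_left_mono) (auto simp: power2_eq_square mult_left_le)
  ultimately show ?thesis by simp
next
  case False
  then have "2 * K * 1 \<le> 2 * K * norm (x - y)" using K_nonneg by (intro mult_left_mono) auto
  then show ?thesis using phi_bound[of x] phi_bound[of y] by linarith
qed

lemma tail_small:
  assumes "\<epsilon> > 0" obtains L where "2 * F / b ^ L \<le> \<epsilon>"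
proof -
  obtain L where "2 * F / \<epsilon> < b ^ L" using real_arch_pow[OF b_gt_1] by blast
  then have "2 * F / b ^ L \<le> \<epsilon>" using assms b_pow_pos[of L] by (simp add: field_simps)
  then show ?thesis by (rule that)
qed

text \<open>The factor \<open>b ^ n\<close> in the hypothesis cancels the weight of the term, so
  each of the first \<open>L\<close> terms costs \<open>c\<close>; the tail is bounded trivially.
  Both uniform continuity and almost periodicity come from this.\<close>

lemma f_diff_le:
  assumes "\<And>n. n < L \<Longrightarrow> \<bar>\<phi> (b ^ n *\<^sub>R x) - \<phi> (b ^ n *\<^sub>R y)\<bar> \<le> b ^ n * c"
  shows "\<bar>f x - f y\<bar> \<le> L * c + 2 * F / b ^ L"
proof -
  have "\<bar>\<phi> (b ^ n *\<^sub>R x) / b ^ n - \<phi> (b ^ n *\<^sub>R y) / b ^ n\<bar> \<le> c" if "n < L" for n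
    using assms[OF that] b_pow_pos[of n] by (simp add: field_simps flip: diff_divide_distrib)
  then have "\<bar>(\<Sum>n<L. \<phi> (b ^ n *\<^sub>R x) / b ^ n) - (\<Sum>n<L. \<phi> (b ^ n *\<^sub>R y) / b ^ n)\<bar> \<le> (\<Sum>n<L. c)"
    unfolding sum_subtractf[symmetric] by (intro order_trans[OF sum_abs] sum_mono) simp
  moreover have "\<bar>f (b ^ L *\<^sub>R x) / b ^ L - f (b ^ L *\<^sub>R y) / b ^ L\<bar> \<le> 2 * F / b ^ L"
    using f_bound[of "b ^ L *\<^sub>R x"] f_bound[of "b ^ L *\<^sub>R y"] b_pow_pos[of L]
    by (simp add: b_nonzero field_simps flip: diff_divide_distrib)
  ultimately show ?thesis
    unfolding f_split[of x L] f_split[of y L] sum_constant card_lessThan by linarith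
qed

lemma f_uniformly_continuous:
  assumes "\<epsilon> > 0"
  obtains \<delta> where "\<delta> > 0" "\<And>x y. norm (x - y) \<le> \<delta> \<Longrightarrow> \<bar>f x - f y\<bar> \<le> \<epsilon>"
proof -
  obtain L where L: "2 * F / b ^ L \<le> \<epsilon> / 2" using tail_small[of "\<epsilon> / 2"] assms by auto
  define C where "C = L * (2 * K)"
  have "C \<ge> 0" using K_nonneg by (simp add: C_def)
  have est: "\<bar>f x - f y\<bar> \<le> C * norm (x - y) + \<epsilon> / 2" for x y
  proof -
    have "\<bar>\<phi> (b ^ n *\<^sub>R x) - \<phi> (b ^ n *\<^sub>R y)\<bar> \<le> b ^ n * (2 * K * norm (x - y))" for n
    proof -
      have "norm (b ^ n *\<^sub>R x - b ^ n *\<^sub>R y) = b ^ n * norm (x - y)"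
        using b_pow_pos[of n] by (simp flip: scaleR_diff_right)
      then show ?thesis using phi_lipschitz[of "b ^ n *\<^sub>R x" "b ^ n *\<^sub>R y"] by (simp add: mult_ac)
    qed
    from f_diff_le[of L, OF this] show ?thesis using L by (simp add: C_def mult.assoc)
  qed
  define \<delta> where "\<delta> = \<epsilon> / 2 / (C + 1)"
  have "C + 1 \<noteq> 0" using \<open>C \<ge> 0\<close> by simp
  have "\<delta> > 0" using assms \<open>C \<ge> 0\<close> by (simp add: \<delta>_def)
  moreover have "\<bar>f x - f y\<bar> \<le> \<epsilon>" if "norm (x - y) \<le> \<delta>" for x y
  proof -
    have "C * norm (x - y) \<le> (C + 1) * \<delta>"
      using that \<open>C \<ge> 0\<close> by (intro mult_mono) auto
    also have "\<dots> = \<epsilon> / 2" using nonzero_mult_div_cancel_left[OF \<open>C + 1 \<noteq> 0\<close>, of "\<epsilon> / 2"] by (simp only: \<delta>_def times_divide_eq_right)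
    finally show ?thesis using est[of x y] by simp
  qed
  ultimately show ?thesis by (rule that)
qed

lemma f_continuous: "continuous_on UNIV f"
  unfolding continuous_on_iff dist_norm real_norm_def
proof (intro ballI allI impI)
  fix x :: "real ^ 'n" and e :: real assume "e > 0"
  then obtain d where "d > 0" and d: "\<And>x y. norm (x - y) \<le> d \<Longrightarrow> \<bar>f x - f y\<bar> \<le> e / 2"
    using f_uniformly_continuous[of "e / 2"] by auto
  show "\<exists>d>0. \<forall>x'\<in>UNIV. norm (x' - x) < d \<longrightarrow> \<bar>f x' - f x\<bar> < e"
  proof (intro exI conjI ballI impI)
    fix x' assume "norm (x' - x) < d"
    then have "\<bar>f x' - f x\<bar> \<le> e / 2" by (intro d) simp
    then show "\<bar>f x' - f x\<bar> < e" using \<open>e > 0\<close> by linarith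
  qed (rule \<open>d > 0\<close>)
qed

text \<open>The scale \<open>r\<close> corresponds to the level \<open>N\<close> with \<open>r \<le> b powr (-N) < b r\<close>.\<close>

definition lev :: "real \<Rightarrow> nat" where "lev r = nat \<lfloor>log b (1 / r)\<rfloor>"
definition A :: "real ^ 'n \<Rightarrow> real \<Rightarrow> real ^ 'n" where "A x r = S (lev r) x"

lemma lev_bounds:
  assumes "0 < r" "r \<le> 1"
  shows "b ^ lev r * r \<le> 1" and "1 < b ^ Suc (lev r) * r"
proof -
  have l: "log b (1 / r) \<ge> 0" using assms b_gt_1 by simp
  then have a: "real (lev r) \<le> log b (1 / r)" and c: "log b (1 / r) < real (Suc (lev r))"
    unfolding lev_def by linarith+
  have "b powr real (lev r) \<le> 1 / r"
    using a assms b_gt_1 by (simp add: le_log_iff)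
  then show "b ^ lev r * r \<le> 1" using b_pos assms by (simp add: powr_realpow field_simps)
  have "1 / r < b powr real (Suc (lev r))"
    using c assms b_gt_1 by (simp add: log_less_iff del: of_nat_Suc)
  then show "1 < b ^ Suc (lev r) * r"
    using b_pos assms by (simp add: powr_realpow field_simps del: of_nat_Suc)
qed

lemma lev_inverse_le:
  assumes "0 < r" "r \<le> 1" shows "1 / b ^ lev r \<le> b * r"
  using lev_bounds[OF assms] b_pow_pos[of "lev r"] by (simp add: field_simps)

text \<open>By \<open>zoom\<close> at level \<open>lev r\<close>: the rescaled increment has norm at
  most \<open>c\<close>, the copy of \<open>f\<close> oscillates by at most \<open>2 * F\<close>,
  and scaling back costs at most \<open>b * r\<close>. Thus \<open>A x r\<close> acts as a gradient
  of \<open>f\<close> at scale \<open>r\<close>, with an error of the order of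
  \<open>r\<close>.\<close>

lemma A_approx:
  assumes r: "0 < r" "r \<le> 1" and h: "norm h \<le> c * r"
  shows "\<bar>f (x + h) - f x - A x r \<bullet> h\<bar> \<le> b * (K' * c\<^sup>2 + 2 * F) * r"
proof -
  define N where "N = lev r"
  define h' where "h' = b ^ N *\<^sub>R h"
  have bN: "b ^ N > 0" by (rule b_pow_pos)
  have hh: "h' /\<^sub>R b ^ N = h" by (simp add: h'_def b_nonzero)
  have "norm h' \<le> b ^ N * (c * r)" using h bN by (simp add: h'_def)
  also have "\<dots> = c * (b ^ N * r)" by simp
  also have "\<dots> \<le> c"
  proof (rule mult_left_le)
    have "0 \<le> c * r" by (rule order_trans[OF norm_ge_zero h])
    then show "0 \<le> c" using r by (simp add: zero_le_mult_iff)
  qed (use lev_bounds(1)[OF r] in \<open>simp add: N_def\<close>)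
  finally have "(norm h')\<^sup>2 \<le> c\<^sup>2" by (simp add: power_mono)
  then have "K' * (norm h')\<^sup>2 \<le> K' * c\<^sup>2" by (rule mult_left_mono) (rule K'_nonneg)
  then have "\<bar>b ^ N * (f (x + h) - f x) - S N x \<bullet> h'\<bar> \<le> K' * c\<^sup>2 + 2 * F"
    using zoom[of N x h'] f_bound[of "b ^ N *\<^sub>R x + h'"] f_bound[of "b ^ N *\<^sub>R x"]
    unfolding hh by linarith
  moreover have "b ^ N * (f (x + h) - f x) - S N x \<bullet> h' = b ^ N * (f (x + h) - f x - A x r \<bullet> h)"
    by (simp add: h'_def A_def N_def algebra_simps)
  ultimately have "b ^ N * \<bar>f (x + h) - f x - A x r \<bullet> h\<bar> \<le> K' * c\<^sup>2 + 2 * F"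
    using bN by (simp add: abs_mult)
  then have "\<bar>f (x + h) - f x - A x r \<bullet> h\<bar> \<le> (K' * c\<^sup>2 + 2 * F) * (1 / b ^ N)"
    using bN by (simp add: field_simps)
  also have "\<dots> \<le> (K' * c\<^sup>2 + 2 * F) * (b * r)"
    unfolding N_def using K'_nonneg F_nonneg
    by (intro mult_left_mono lev_inverse_le r) auto
  finally show ?thesis by (simp add: mult_ac)
qed

text \<open>Comparable scales differ by boundedly many levels, each adding at most \<open>K\<close>;
  at equal level \<open>S_lipschitz\<close> handles the change of point. This is what allows
  corners, centres and scales to be exchanged at bounded cost later on.\<close>

lemma A_stable:
  assumes "c \<ge> 1"
  obtains C where "C \<ge> 0"
    "\<And>x y r r'. \<lbrakk>0 < r'; r' \<le> r; r \<le> 1; r \<le> c * r'; norm (x - y) \<le> c * r\<rbrakk>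
       \<Longrightarrow> norm (A x r - A y r') \<le> C"
proof -
  obtain m where m: "c * b < b ^ m" using real_arch_pow[OF b_gt_1] by blast
  show thesis
  proof
    show "0 \<le> K' * c + K * m" using K'_nonneg K_nonneg assms by simp
    fix x y :: "real ^ 'n" and r r' :: real
    assume r: "0 < r'" "r' \<le> r" "r \<le> 1" "r \<le> c * r'" and xy: "norm (x - y) \<le> c * r"
    have "r > 0" "r' \<le> 1" using r by auto
    have lb: "b ^ lev r * r \<le> 1" "1 < b ^ Suc (lev r) * r"
      using lev_bounds \<open>r > 0\<close> r by blast+
    have lb': "b ^ lev r' * r' \<le> 1" "1 < b ^ Suc (lev r') * r'"
      using lev_bounds \<open>r' \<le> 1\<close> r by blast+
    have "b ^ lev r * r' \<le> b ^ lev r * r" using r b_pow_pos[of "lev r"] by simp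
    also have "\<dots> < b ^ Suc (lev r') * r'" using lb(1) lb'(2) by linarith
    finally have "b ^ lev r < b ^ Suc (lev r')" using r by simp
    then have "lev r \<le> lev r'" using power_less_imp_less_exp[OF b_gt_1] by fastforce
    then obtain k where k: "lev r' = lev r + k" using le_Suc_ex by blast
    have "b ^ Suc (lev r) * r \<le> b ^ Suc (lev r) * (c * r')"
      using r(4) b_pow_pos[of "Suc (lev r)"] by (intro mult_left_mono) auto
    then have "b ^ lev r' * r' < b ^ Suc (lev r) * (c * r')"
      using lb(2) lb'(1) by linarith
    then have "b ^ lev r * b ^ k < b ^ lev r * (c * b)"
      using r(1) by (simp add: k power_add mult_ac)
    then have "b ^ k < c * b" using b_pow_pos[of "lev r"] by simp
    then have "b ^ k < b ^ m" using m by linarith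
    then have "k < m" using power_less_imp_less_exp[OF b_gt_1] by blast
    have "norm (S (lev r) x - S (lev r) y) \<le> K' * (b ^ lev r * norm (x - y))" by (rule S_lipschitz)
    also have "\<dots> \<le> K' * (b ^ lev r * (c * r))"
      using K'_nonneg b_pow_pos[of "lev r"] xy by (intro mult_left_mono) auto
    also have "\<dots> = K' * (c * (b ^ lev r * r))" by simp
    also have "\<dots> \<le> K' * (c * 1)"
      using K'_nonneg lb(1) assms by (intro mult_left_mono) auto
    finally have 1: "norm (S (lev r) x - S (lev r) y) \<le> K' * c" by simp
    have "norm (S (lev r') y - S (lev r) y) \<le> K * k" unfolding k by (rule S_diff)
    also have "\<dots> \<le> K * m" using K_nonneg \<open>k < m\<close> by (intro mult_left_mono) auto
    finally have 2: "norm (S (lev r) y - S (lev r') y) \<le> K * m" by (simp add: norm_minus_commute)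
    have "norm (A x r - A y r') \<le> norm (S (lev r) x - S (lev r) y) + norm (S (lev r) y - S (lev r') y)"
      unfolding A_def using norm_triangle_ineq[of "S (lev r) x - S (lev r) y" "S (lev r) y - S (lev r') y"] by simp
    then show "norm (A x r - A y r') \<le> K' * c + K * m" using 1 2 by linarith
  qed
qed

section \<open>Non-differentiability at the origin and almost periodicity\<close>

lemma derivative_along_sequence:
  fixes g :: "real \<Rightarrow> real"
  assumes "(g has_real_derivative D) (at 0)" "X \<longlonglongrightarrow> 0" "\<And>n. X n \<noteq> 0"
  shows "(\<lambda>n. (g (X n) - g 0) / X n) \<longlonglongrightarrow> D"
proof -
  have "((\<lambda>h. (g h - g 0) / h) \<longlongrightarrow> D) (at 0)"
    using assms(1) by (simp add: DERIV_def)
  moreover have "filterlim X (at 0) sequentially"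
    using assms by (simp add: filterlim_at)
  ultimately show ?thesis by (rule filterlim_compose)
qed

lemma inverse_powers_tendsto: "(\<lambda>n. c / b ^ n) \<longlonglongrightarrow> 0"
proof -
  have "(\<lambda>n. c * inverse (b ^ n)) \<longlonglongrightarrow> c * 0"
    by (intro tendsto_mult tendsto_const LIMSEQ_inverse_realpow_zero b_gt_1)
  then show ?thesis by (simp add: divide_inverse)
qed

text \<open>By \<open>f_step\<close>, consecutive difference quotients of \<open>f\<close> at
  \<open>1 / b ^ n\<close> differ by a difference quotient of \<phi>, which tends to
  \<open>d\<close>; if the quotients of \<open>f\<close> converge, these differences tend to
  0.\<close>

lemma no_derivative_at_zero_of_gradient:
  assumes D: "((\<lambda>t. f (t *\<^sub>R e)) has_real_derivative D) (at 0)"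
    and d: "has_directional_derivative \<phi> d 0 e"
  shows "d = 0"
proof -
  define X where "X n = 1 / b ^ n" for n
  have X0: "X \<longlonglongrightarrow> 0" unfolding X_def by (rule inverse_powers_tendsto)
  have Xn: "X n \<noteq> 0" for n using b_nonzero by (simp add: X_def)
  define s where "s n = (f (X n *\<^sub>R e) - f (0 *\<^sub>R e)) / X n" for n
  have s: "s \<longlonglongrightarrow> D"
    unfolding s_def by (rule derivative_along_sequence[OF D X0 Xn])
  have d': "((\<lambda>t. \<phi> (t *\<^sub>R e)) has_real_derivative d) (at 0)"
    using d by (simp add: has_directional_derivative_def)
  have t: "(\<lambda>n. (\<phi> (X n *\<^sub>R e) - \<phi> (0 *\<^sub>R e)) / X n) \<longlonglongrightarrow> d"
    by (rule derivative_along_sequence[OF d' X0 Xn])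
  have "s (Suc n) - s n = (\<phi> (X (Suc n) *\<^sub>R e) - \<phi> (0 *\<^sub>R e)) / X (Suc n)" for n
  proof -
    have "b *\<^sub>R X (Suc n) *\<^sub>R e = X n *\<^sub>R e" using b_nonzero by (simp add: X_def)
    then have "f (X (Suc n) *\<^sub>R e) = \<phi> (X (Suc n) *\<^sub>R e) + f (X n *\<^sub>R e) / b"
      using f_step[of "X (Suc n) *\<^sub>R e"] by (simp only:)
    moreover have "f 0 = \<phi> 0 + f 0 / b" using f_step[of 0] by simp
    ultimately have "f (X (Suc n) *\<^sub>R e) - f 0 = \<phi> (X (Suc n) *\<^sub>R e) - \<phi> 0 + (f (X n *\<^sub>R e) - f 0) / b"
      by (simp add: diff_divide_distrib)
    moreover have "s n = (f (X n *\<^sub>R e) - f 0) * b ^ n"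
      "s (Suc n) = (f (X (Suc n) *\<^sub>R e) - f 0) * (b * b ^ n)"
      by (simp_all add: s_def X_def)
    ultimately show ?thesis
      using b_nonzero by (simp add: X_def distrib_right)
  qed
  then have "(\<lambda>n. s (Suc n) - s n) \<longlonglongrightarrow> d" using LIMSEQ_Suc[OF t] by simp
  moreover have "(\<lambda>n. s (Suc n) - s n) \<longlonglongrightarrow> D - D"
    by (intro tendsto_diff LIMSEQ_Suc s)
  ultimately show ?thesis using LIMSEQ_unique by force
qed

text \<open>\<open>sg\<close> is the sign that turns the extremum into a minimum. All terms of the
  series for \<open>sg * (f (t *\<^sub>R e) - f 0)\<close> are then nonnegative, so a derivative at
  0 must vanish. But at \<open>t0 / b ^ n\<close> the \<open>n\<close>-th term alone contributes
  \<open>c / b ^ n\<close>, which keeps the quotients there away from 0.\<close>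

lemma no_derivative_at_zero_of_extremum:
  assumes D: "((\<lambda>t. f (t *\<^sub>R e)) has_real_derivative D) (at 0)"
    and pos: "\<And>t. sg * (\<phi> (t *\<^sub>R e) - \<phi> 0) \<ge> 0"
  shows "sg * (\<phi> (t0 *\<^sub>R e) - \<phi> 0) = 0"
proof (rule ccontr)
  assume neq: "sg * (\<phi> (t0 *\<^sub>R e) - \<phi> 0) \<noteq> 0"
  define c where "c = sg * (\<phi> (t0 *\<^sub>R e) - \<phi> 0)"
  have "c > 0" using neq pos[of t0] unfolding c_def by linarith
  have "t0 \<noteq> 0" using neq by auto
  have fpos: "sg * (f (t *\<^sub>R e) - f 0) \<ge> 0" for t
  proof -
    have "0 \<le> (\<Sum>n. sg * (\<phi> (b ^ n *\<^sub>R t *\<^sub>R e) / b ^ n - \<phi> (b ^ n *\<^sub>R 0) / b ^ n))"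
    proof (rule suminf_nonneg)
      show "summable (\<lambda>n. sg * (\<phi> (b ^ n *\<^sub>R t *\<^sub>R e) / b ^ n - \<phi> (b ^ n *\<^sub>R 0) / b ^ n))"
        by (intro summable_mult summable_diff f_summable)
      fix n
      have "0 \<le> sg * (\<phi> ((b ^ n * t) *\<^sub>R e) - \<phi> 0) / b ^ n"
        using pos b_pos by simp
      then show "0 \<le> sg * (\<phi> (b ^ n *\<^sub>R t *\<^sub>R e) / b ^ n - \<phi> (b ^ n *\<^sub>R 0) / b ^ n)"
        by (simp add: diff_divide_distrib right_diff_distrib)
    qed
    also have "\<dots> = sg * (f (t *\<^sub>R e) - f 0)"
      unfolding f_def weierstrass_fun_def
      by (subst suminf_diff[OF f_summable f_summable])
        (rule suminf_mult, intro summable_diff f_summable)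
    finally show ?thesis .
  qed
  have fc: "sg * (f ((t0 / b ^ n) *\<^sub>R e) - f 0) \<ge> c / b ^ n" for n
  proof (induction n)
    case 0
    have "f (t0 *\<^sub>R e) = \<phi> (t0 *\<^sub>R e) + f ((b * t0) *\<^sub>R e) / b" "f 0 = \<phi> 0 + f 0 / b"
      using f_step[of "t0 *\<^sub>R e"] f_step[of 0] by simp_all
    then have "f (t0 *\<^sub>R e) - f 0 = (\<phi> (t0 *\<^sub>R e) - \<phi> 0) + (f ((b * t0) *\<^sub>R e) - f 0) / b"
      unfolding diff_divide_distrib by linarith
    then have "sg * (f (t0 *\<^sub>R e) - f 0) = c + sg * (f ((b * t0) *\<^sub>R e) - f 0) / b"
      by (simp only: c_def distrib_left times_divide_eq_right)
    then show ?case using fpos[of "b * t0"] b_pos by simp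
  next
    case (Suc n)
    have "b *\<^sub>R (t0 / b ^ Suc n) *\<^sub>R e = (t0 / b ^ n) *\<^sub>R e" using b_nonzero by simp
    then have "f ((t0 / b ^ Suc n) *\<^sub>R e) = \<phi> ((t0 / b ^ Suc n) *\<^sub>R e) + f ((t0 / b ^ n) *\<^sub>R e) / b"
      using f_step[of "(t0 / b ^ Suc n) *\<^sub>R e"] by (simp only:)
    moreover have "f 0 = \<phi> 0 + f 0 / b" using f_step[of 0] by simp
    ultimately have "f ((t0 / b ^ Suc n) *\<^sub>R e) - f 0 =
       (\<phi> ((t0 / b ^ Suc n) *\<^sub>R e) - \<phi> 0) + (f ((t0 / b ^ n) *\<^sub>R e) - f 0) / b"
      unfolding diff_divide_distrib by linarith
    then have "sg * (f ((t0 / b ^ Suc n) *\<^sub>R e) - f 0) =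
       sg * (\<phi> ((t0 / b ^ Suc n) *\<^sub>R e) - \<phi> 0) + sg * (f ((t0 / b ^ n) *\<^sub>R e) - f 0) / b"
      by (simp only: distrib_left times_divide_eq_right)
    also have "\<dots> \<ge> 0 + (c / b ^ n) / b"
      using pos Suc b_pos by (intro add_mono divide_right_mono) auto
    finally show ?case by (simp add: mult.commute)
  qed
  let ?g = "\<lambda>t. sg * (f (t *\<^sub>R e) - f 0)"
  have g: "(?g has_real_derivative sg * D) (at 0)"
    using DERIV_cmult[OF DERIV_diff[OF D DERIV_const[of "f 0"]]] by simp
  have D0: "sg * D = 0"
    by (rule DERIV_local_min[OF g zero_less_one]) (use fpos in simp)
  have "(\<lambda>n. t0 * ((?g (t0 / b ^ n) - ?g 0) / (t0 / b ^ n))) \<longlonglongrightarrow> t0 * (sg * D)"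
    using \<open>t0 \<noteq> 0\<close> b_nonzero
    by (intro tendsto_mult tendsto_const derivative_along_sequence[OF g] inverse_powers_tendsto) auto
  then have "c \<le> t0 * (sg * D)"
  proof (rule LIMSEQ_le_const, intro exI allI impI)
    fix n :: nat
    have "c / b ^ n * b ^ n \<le> ?g (t0 / b ^ n) * b ^ n"
      using b_pow_pos[of n] by (intro mult_right_mono fc) auto
    moreover have "t0 * (y / (t0 / b ^ n)) = y * b ^ n" for y using \<open>t0 \<noteq> 0\<close> by simp
    ultimately show "c \<le> t0 * ((?g (t0 / b ^ n) - ?g 0) / (t0 / b ^ n))"
      using b_nonzero \<open>t0 \<noteq> 0\<close> by simp
  qed
  then show False using \<open>c > 0\<close> unfolding D0 by simp
qed

lemma no_derivative_at_zero:
  assumes "norm e = 1"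
  shows "\<not> ((\<lambda>t. f (t *\<^sub>R e)) has_real_derivative D) (at 0)"
proof
  assume D: "((\<lambda>t. f (t *\<^sub>R e)) has_real_derivative D) (at 0)"
  have ncon: "\<exists>t. \<phi> (t *\<^sub>R e) \<noteq> \<phi> 0" if "\<not> (\<lambda>t. \<phi> (t *\<^sub>R e)) constant_on UNIV"
    using that unfolding constant_on_def by auto
  from cond_H assms consider
    d where "has_directional_derivative \<phi> d 0 e" "d \<noteq> 0"
    | t0 where "\<phi> (t0 *\<^sub>R e) \<noteq> \<phi> 0" "\<forall>t. \<phi> (t *\<^sub>R e) \<le> \<phi> 0"
    | t0 where "\<phi> (t0 *\<^sub>R e) \<noteq> \<phi> 0" "\<forall>t. \<phi> (t *\<^sub>R e) \<ge> \<phi> 0"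
    using ncon unfolding condition_H_def by blast
  then show False
  proof cases
    case 1
    then show ?thesis using no_derivative_at_zero_of_gradient[OF D] by blast
  next
    case 2
    then show ?thesis using no_derivative_at_zero_of_extremum[OF D, of "-1" t0] by simp
  next
    case 3
    then show ?thesis using no_derivative_at_zero_of_extremum[OF D, of 1 t0] by simp
  qed
qed

section \<open>Uniform oscillation of the difference quotients at the origin\<close>

definition quot :: "real ^ 'n \<Rightarrow> real \<Rightarrow> real" where "quot u t = (f (t *\<^sub>R u) - f 0) / t"

text \<open>If the difference quotients at \<open>0\<close> never differed by more than this linear modulus, they
  would be Cauchy.\<close>

lemma quot_oscillates:
  assumes u: "norm u = 1"
  obtains t1 t2 where "t1 \<noteq> 0" "\<bar>t1\<bar> < 1" "t2 \<noteq> 0" "\<bar>t2\<bar> < 1"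
    "\<bar>quot u t1 - quot u t2\<bar> > K' * (\<bar>t1\<bar> + \<bar>t2\<bar>)"
proof (rule ccontr)
  note osc = that
  assume neg: "\<not> thesis"
  have le: "\<bar>quot u t1 - quot u t2\<bar> \<le> K' * (\<bar>t1\<bar> + \<bar>t2\<bar>)"
    if "t1 \<noteq> 0" "\<bar>t1\<bar> < 1" "t2 \<noteq> 0" "\<bar>t2\<bar> < 1" for t1 t2
  proof (rule ccontr)
    assume "\<not> \<bar>quot u t1 - quot u t2\<bar> \<le> K' * (\<bar>t1\<bar> + \<bar>t2\<bar>)"
    then have thesis by (intro osc[of t1 t2] that) simp
    with neg show False ..
  qed
  \<comment> \<open>The shift by two keeps every \<open>X n\<close> strictly below 1, as
    \<open>le\<close> demands.\<close>
  define X where "X n = inverse (real (Suc (Suc n)))" for n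
  have X0: "X \<longlonglongrightarrow> 0"
    unfolding X_def using LIMSEQ_Suc[OF LIMSEQ_inverse_real_of_nat] .
  have Xn: "X n > 0" "X n < 1" for n
    by (auto simp: X_def field_simps)
  have "Cauchy (\<lambda>n. quot u (X n))"
  proof (rule metric_CauchyI)
    fix e :: real assume "e > 0"
    have "(\<lambda>n. 2 * K' * X n) \<longlonglongrightarrow> 2 * K' * 0" by (intro tendsto_mult tendsto_const X0)
    then have "\<forall>\<^sub>F n in sequentially. 2 * K' * X n < e"
      using order_tendstoD(2) \<open>e > 0\<close> by fastforce
    then obtain M where M: "2 * K' * X M < e" by (auto simp: eventually_sequentially)
    have mono: "X n \<le> X M" if "n \<ge> M" for n
      using that by (simp add: X_def)
    have "\<bar>quot u (X m) - quot u (X n)\<bar> < e" if "m \<ge> M" "n \<ge> M" for m n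
    proof -
      have "\<bar>quot u (X m) - quot u (X n)\<bar> \<le> K' * (\<bar>X m\<bar> + \<bar>X n\<bar>)"
        using Xn[of m] Xn[of n] by (intro le) auto
      also have "\<dots> \<le> K' * (2 * X M)"
        using mono[OF that(1)] mono[OF that(2)] Xn[of m] Xn[of n] K'_nonneg
        by (intro mult_left_mono) auto
      finally show ?thesis using M by simp
    qed
    then show "\<exists>M. \<forall>m\<ge>M. \<forall>n\<ge>M. dist (quot u (X m)) (quot u (X n)) < e"
      unfolding dist_real_def by blast
  qed
  then obtain D where D: "(\<lambda>n. quot u (X n)) \<longlonglongrightarrow> D"
    using Cauchy_convergent_iff convergent_def by blast
  have near: "\<bar>quot u t - D\<bar> \<le> K' * \<bar>t\<bar>" if "t \<noteq> 0" "\<bar>t\<bar> < 1" for t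
  proof (rule LIMSEQ_le)
    show "(\<lambda>n. \<bar>quot u t - quot u (X n)\<bar>) \<longlonglongrightarrow> \<bar>quot u t - D\<bar>"
      by (intro tendsto_intros D)
    have "(\<lambda>n. K' * (\<bar>t\<bar> + \<bar>X n\<bar>)) \<longlonglongrightarrow> K' * (\<bar>t\<bar> + \<bar>0\<bar>)" by (intro tendsto_intros X0)
    then show "(\<lambda>n. K' * (\<bar>t\<bar> + \<bar>X n\<bar>)) \<longlonglongrightarrow> K' * \<bar>t\<bar>" by simp
    show "\<exists>N. \<forall>n\<ge>N. \<bar>quot u t - quot u (X n)\<bar> \<le> K' * (\<bar>t\<bar> + \<bar>X n\<bar>)"
    proof (intro exI allI impI)
      fix n :: nat
      show "\<bar>quot u t - quot u (X n)\<bar> \<le> K' * (\<bar>t\<bar> + \<bar>X n\<bar>)"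
        using Xn[of n] by (intro le that) auto
    qed
  qed
  have "((\<lambda>t. quot u t - D) \<longlongrightarrow> 0) (at 0)"
  proof (rule Lim_null_comparison)
    show "\<forall>\<^sub>F t in at 0. norm (quot u t - D) \<le> K' * \<bar>t\<bar>"
      unfolding eventually_at using near by (intro exI[of _ 1]) auto
    have "((\<lambda>t. K' * \<bar>t\<bar>) \<longlongrightarrow> K' * \<bar>0\<bar>) (at 0)" by (intro tendsto_intros)
    then show "((\<lambda>t. K' * \<bar>t\<bar>) \<longlongrightarrow> 0) (at 0)" by simp
  qed
  then have "((\<lambda>t. f (t *\<^sub>R u)) has_real_derivative D) (at 0)"
    unfolding DERIV_def quot_def using LIM_zero_cancel by fastforce
  then show False using no_derivative_at_zero[OF u] by blast
qed

text \<open>Compactness of the unit sphere makes the oscillation uniform in the direction. The term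
  \<open>K' * (\<bar>s1\<bar> + \<bar>s2\<bar>)\<close> is the zoom error incurred when both
  quotients are transferred from 0 to another point, so a gap of \<kappa> survives it. The freedom
  of \<kappa> around \<open>t1\<close> and \<open>t2\<close> leaves room to round them to multiples
  of a grid length.\<close>

lemma quot_oscillates_uniformly:
  obtains \<kappa> where "\<kappa> > 0"
    "\<And>u. norm u = 1 \<Longrightarrow> \<exists>t1 t2. \<forall>s1 s2. \<bar>s1 - t1\<bar> \<le> \<kappa> \<longrightarrow> \<bar>s2 - t2\<bar> \<le> \<kappa> \<longrightarrow>
       \<kappa> \<le> \<bar>s1\<bar> \<and> \<bar>s1\<bar> \<le> 1 \<and> \<kappa> \<le> \<bar>s2\<bar> \<and> \<bar>s2\<bar> \<le> 1 \<and>
       \<bar>quot u s1 - quot u s2\<bar> \<ge> \<kappa> + K' * (\<bar>s1\<bar> + \<bar>s2\<bar>)"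
proof -
  define good where "good \<kappa> u s1 s2 \<longleftrightarrow> \<kappa> \<le> \<bar>s1\<bar> \<and> \<bar>s1\<bar> \<le> 1 \<and> \<kappa> \<le> \<bar>s2\<bar> \<and> \<bar>s2\<bar> \<le> 1 \<and>
       \<bar>quot u s1 - quot u s2\<bar> \<ge> \<kappa> + K' * (\<bar>s1\<bar> + \<bar>s2\<bar>)" for \<kappa> u s1 s2
  define X where "X n = inverse (real (Suc n))" for n
  have X0: "X \<longlonglongrightarrow> 0" unfolding X_def by (rule LIMSEQ_inverse_real_of_nat)
  have "\<exists>\<kappa>>0. \<forall>u. norm u = 1 \<longrightarrow>
      (\<exists>t1 t2. \<forall>s1 s2. \<bar>s1 - t1\<bar> \<le> \<kappa> \<longrightarrow> \<bar>s2 - t2\<bar> \<le> \<kappa> \<longrightarrow> good \<kappa> u s1 s2)"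
  proof (rule ccontr)
    assume neg: "\<not> ?thesis"
    have "\<exists>u. norm u = 1 \<and>
      (\<forall>t1 t2. \<exists>s1 s2. \<bar>s1 - t1\<bar> \<le> X n \<and> \<bar>s2 - t2\<bar> \<le> X n \<and> \<not> good (X n) u s1 s2)" for n
    proof -
      have "X n > 0" by (simp add: X_def)
      with neg show ?thesis by meson
    qed
    then obtain U where U1: "\<And>n. norm (U n) = 1" and
      U: "\<And>n t1 t2. \<exists>s1 s2. \<bar>s1 - t1\<bar> \<le> X n \<and> \<bar>s2 - t2\<bar> \<le> X n \<and> \<not> good (X n) (U n) s1 s2"
      by metis
    have "compact (sphere (0 :: real ^ 'n) 1)" by simp
    moreover have "\<forall>n. U n \<in> sphere 0 1" using U1 by simp
    ultimately obtain u r where u: "u \<in> sphere 0 1" and r: "strict_mono r" and lim: "(U \<circ> r) \<longlonglongrightarrow> u"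
      unfolding compact_def by blast
    obtain t1 t2 where t: "t1 \<noteq> 0" "\<bar>t1\<bar> < 1" "t2 \<noteq> 0" "\<bar>t2\<bar> < 1"
      "\<bar>quot u t1 - quot u t2\<bar> > K' * (\<bar>t1\<bar> + \<bar>t2\<bar>)"
      using quot_oscillates[of u] u by auto
    \<comment> \<open>The failure in direction \<open>U (r n)\<close> is evaluated at the fixed pair
      \<open>t1\<close>, \<open>t2\<close> that works for the limit direction
      \<open>u\<close>.\<close>
    obtain s1 s2 where s: "\<And>n. \<bar>s1 n - t1\<bar> \<le> X (r n)" "\<And>n. \<bar>s2 n - t2\<bar> \<le> X (r n)"
      "\<And>n. \<not> good (X (r n)) (U (r n)) (s1 n) (s2 n)"
    proof -
      have "\<exists>s1 s2. \<bar>s1 - t1\<bar> \<le> X (r n) \<and> \<bar>s2 - t2\<bar> \<le> X (r n) \<and> \<not> good (X (r n)) (U (r n)) s1 s2" for n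
        by (rule U)
      then show ?thesis using that by metis
    qed
    have Xr: "(\<lambda>n. X (r n)) \<longlonglongrightarrow> 0" using LIMSEQ_subseq_LIMSEQ[OF X0 r] by (simp add: o_def)
    have s1: "s1 \<longlonglongrightarrow> t1"
      by (rule LIM_zero_cancel, rule tendsto_0_le[OF Xr, of _ 1])
        (use s(1) in \<open>auto simp: X_def\<close>)
    have s2: "s2 \<longlonglongrightarrow> t2"
      by (rule LIM_zero_cancel, rule tendsto_0_le[OF Xr, of _ 1])
        (use s(2) in \<open>auto simp: X_def\<close>)
    have fc: "isCont f y" for y using f_continuous continuous_on_eq_continuous_at by blast
    have q: "(\<lambda>n. quot (U (r n)) (z n)) \<longlonglongrightarrow> quot u t" if "z \<longlonglongrightarrow> t" "t \<noteq> 0" for z t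
      unfolding quot_def using that lim
      by (intro tendsto_intros isCont_tendsto_compose[OF fc]) (auto simp: o_def)
    have "\<forall>\<^sub>F n in sequentially. 0 < \<bar>s1 n\<bar> - X (r n)"
      by (rule order_tendstoD(1)[OF tendsto_diff[OF tendsto_rabs[OF s1] Xr]]) (use t in simp)
    moreover have "\<forall>\<^sub>F n in sequentially. 0 < \<bar>s2 n\<bar> - X (r n)"
      by (rule order_tendstoD(1)[OF tendsto_diff[OF tendsto_rabs[OF s2] Xr]]) (use t in simp)
    moreover have "\<forall>\<^sub>F n in sequentially. \<bar>s1 n\<bar> < 1"
      by (rule order_tendstoD(2)[where y = "\<bar>t1\<bar>"]) (use t in \<open>auto intro!: tendsto_intros s1\<close>)
    moreover have "\<forall>\<^sub>F n in sequentially. \<bar>s2 n\<bar> < 1"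
      by (rule order_tendstoD(2)[where y = "\<bar>t2\<bar>"]) (use t in \<open>auto intro!: tendsto_intros s2\<close>)
    moreover have "\<forall>\<^sub>F n in sequentially. 0 < \<bar>quot (U (r n)) (s1 n) - quot (U (r n)) (s2 n)\<bar>
        - (X (r n) + K' * (\<bar>s1 n\<bar> + \<bar>s2 n\<bar>))"
    proof (rule order_tendstoD(1))
      show "(\<lambda>n. \<bar>quot (U (r n)) (s1 n) - quot (U (r n)) (s2 n)\<bar> - (X (r n) + K' * (\<bar>s1 n\<bar> + \<bar>s2 n\<bar>)))
        \<longlonglongrightarrow> \<bar>quot u t1 - quot u t2\<bar> - (0 + K' * (\<bar>t1\<bar> + \<bar>t2\<bar>))"
        by (intro tendsto_intros q s1 s2 Xr t)
    qed (use t in simp)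
    ultimately have "\<forall>\<^sub>F n in sequentially. good (X (r n)) (U (r n)) (s1 n) (s2 n)"
      unfolding good_def by eventually_elim auto
    then show False using s(3) by (auto simp: eventually_sequentially)
  qed
  then show thesis using that unfolding good_def by metis
qed

section \<open>Almost periods\<close>

lemma phi_almost_period:
  fixes \<eta> :: real
  assumes "\<And>i. \<bar>y $ i - of_int (k i)\<bar> \<le> \<eta>"
  shows "\<bar>\<phi> (y + z) - \<phi> z\<bar> \<le> 2 * K * (CARD('n) * \<eta>)"
proof -
  define v where "v = ((\<chi> i. of_int (k i)) :: real ^ 'n)"
  have "\<phi> (y + z) = \<phi> (y - v + z)"
    using one_periodic_int[OF periodic, of "y - v + z" k] by (simp add: v_def)
  then have "\<bar>\<phi> (y + z) - \<phi> z\<bar> \<le> 2 * K * norm (y - v)"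
    using phi_lipschitz[of "y - v + z" z] by simp
  also have "norm (y - v) \<le> CARD('n) * \<eta>"
    by (rule norm_le_card_times) (use assms in \<open>simp add: v_def\<close>)
  finally show ?thesis using K_nonneg by (simp add: mult_left_mono)
qed

text \<open>Pigeonhole principle for the fractional parts of the coordinates of \<open>b ^ j y\<close>; for non-integer \<open>b\<close>
  this Bohr almost periodicity replaces the self-similarity of \<open>f\<close> modulo the lattice.\<close>

lemma f_almost_periodic:
  assumes "\<epsilon> > 0"
  obtains W :: "(real ^ 'n) set" where "finite W" "\<And>y. \<exists>w\<in>W. \<forall>h. \<bar>f (y + w + h) - f h\<bar> \<le> \<epsilon>"
proof -
  obtain L where L: "2 * F / b ^ L \<le> \<epsilon> / 2" using tail_small[of "\<epsilon> / 2"] assms by auto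
  define C where "C = L * (2 * K * CARD('n))"
  have "C \<ge> 0" using K_nonneg by (simp add: C_def)
  obtain M :: nat where M: "M > 0" "C * (1 / M) \<le> \<epsilon> / 2"
  proof -
    obtain M :: nat where "2 * C / \<epsilon> < M" using reals_Archimedean2 by blast
    moreover from this have "M > 0" using \<open>C \<ge> 0\<close> assms
      by (cases M) (auto simp: field_simps)
    ultimately show ?thesis using assms by (intro that[of M]) (auto simp: field_simps)
  qed
  \<comment> \<open>The colour of \<open>y\<close> records, for every level \<open>n < L\<close> and
    every coordinate, which of the \<open>M\<close> equal parts of the unit interval contains the
    fractional part; it is 0 elsewhere so that only finitely many colours occur.\<close>
  define col :: "real ^ 'n \<Rightarrow> nat \<times> 'n \<Rightarrow> nat" where
    "col y = (\<lambda>p. if p \<in> {..<L} \<times> UNIV then nat \<lfloor>M * frac (b ^ fst p * y $ snd p)\<rfloor> else 0)" for y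
  have "range col \<subseteq> {g. \<forall>p. (p \<in> {..<L} \<times> UNIV \<longrightarrow> g p \<in> {..M}) \<and> (p \<notin> {..<L} \<times> UNIV \<longrightarrow> g p = 0)}"
  proof -
    have "nat \<lfloor>M * frac t\<rfloor> \<le> M" for t :: real
    proof -
      have "real M * frac t \<le> real M * 1" using frac_lt_1[of t] by (intro mult_left_mono) auto
      then show ?thesis by (simp add: floor_le_iff nat_le_iff)
    qed
    then show ?thesis by (auto simp: col_def)
  qed
  moreover have "finite {g. \<forall>p. (p \<in> {..<L} \<times> (UNIV :: 'n set) \<longrightarrow> g p \<in> {..M}) \<and>
      (p \<notin> {..<L} \<times> UNIV \<longrightarrow> g p = 0)}"
    by (rule finite_set_of_finite_funs) auto
  ultimately have fin: "finite (range col)" by (rule finite_subset)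
  define rep where "rep c = (SOME y. col y = c)" for c
  have rep: "col (rep (col y)) = col y" for y
    unfolding rep_def by (rule someI) simp
  \<comment> \<open>Subtracting the representative of its own colour turns any \<open>y\<close> into
    an almost period, so one finite set of corrections serves all points and scales.\<close>
  define W where "W = (\<lambda>c. - rep c) ` range col"
  have "finite W" unfolding W_def using fin by simp
  moreover have "\<exists>w\<in>W. \<forall>h. \<bar>f (y + w + h) - f h\<bar> \<le> \<epsilon>" for y
  proof (intro bexI allI)
    show "- rep (col y) \<in> W" by (auto simp: W_def)
    fix h
    define d where "d = y + - rep (col y)"
    have "\<bar>\<phi> (b ^ n *\<^sub>R (d + h)) - \<phi> (b ^ n *\<^sub>R h)\<bar> \<le> b ^ n * (2 * K * (CARD('n) * (1 / M)))"
      if "n < L" for n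
    proof -
      have "\<bar>\<phi> (b ^ n *\<^sub>R d + b ^ n *\<^sub>R h) - \<phi> (b ^ n *\<^sub>R h)\<bar> \<le> 2 * K * (CARD('n) * (1 / M))"
      proof (rule phi_almost_period)
        fix i
        let ?p = "b ^ n * y $ i" and ?q = "b ^ n * rep (col y) $ i"
        have "col y (n, i) = col (rep (col y)) (n, i)" by (simp add: rep)
        then have "nat \<lfloor>M * frac ?p\<rfloor> = nat \<lfloor>M * frac ?q\<rfloor>"
          using that by (simp add: col_def)
        moreover have "\<lfloor>M * frac ?p\<rfloor> \<ge> 0" "\<lfloor>M * frac ?q\<rfloor> \<ge> 0" by auto
        ultimately have "\<lfloor>M * frac ?p\<rfloor> = \<lfloor>M * frac ?q\<rfloor>" by linarith
        then have "\<bar>M * frac ?p - M * frac ?q\<bar> \<le> 1" by linarith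
        then have "M * \<bar>frac ?p - frac ?q\<bar> \<le> 1" by (simp add: abs_mult flip: right_diff_distrib)
        then have "\<bar>frac ?p - frac ?q\<bar> \<le> 1 / M" using M by (simp add: field_simps)
        then show "\<bar>(b ^ n *\<^sub>R d) $ i - of_int (\<lfloor>?p\<rfloor> - \<lfloor>?q\<rfloor>)\<bar> \<le> 1 / M"
          by (simp add: d_def frac_def algebra_simps)
      qed
      also have "\<dots> = 1 * (2 * K * (CARD('n) * (1 / M)))" by simp
      also have "\<dots> \<le> b ^ n * (2 * K * (CARD('n) * (1 / M)))"
        using K_nonneg b_gt_1 by (intro mult_right_mono) (auto simp: one_le_power)
      finally show ?thesis by (simp only: scaleR_add_right)
    qed
    from f_diff_le[of L, OF this]
    have "\<bar>f (d + h) - f h\<bar> \<le> C * (1 / M) + 2 * F / b ^ L" by (simp add: C_def mult.assoc)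
    then show "\<bar>f (y + - rep (col y) + h) - f h\<bar> \<le> \<epsilon>"
      using M(2) L unfolding d_def[symmetric] by linarith
  qed
  ultimately show thesis by (rule that)
qed

end

section \<open>Averaged slopes\<close>

lemma near_arithmetic_progression:
  fixes x :: "nat \<Rightarrow> real"
  assumes "\<And>k. k < n \<Longrightarrow> \<bar>x (Suc k) - x k - d\<bar> \<le> e" and "i \<le> n" "j \<le> n"
  shows "\<bar>x j - x i - (real j - real i) * d\<bar> \<le> \<bar>real j - real i\<bar> * e"
proof -
  have up: "\<bar>x j - x i - (real j - real i) * d\<bar> \<le> (real j - real i) * e"
    if "i \<le> j" "j \<le> n" for i j
    using that
  proof (induction j rule: dec_induct)
    case (step m)
    have "\<bar>x (Suc m) - x m - d\<bar> \<le> e" using assms(1) step by simp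
    moreover have "\<bar>x m - x i - (real m - real i) * d\<bar> \<le> (real m - real i) * e"
      using step by simp
    ultimately have "\<bar>x (Suc m) - x i - ((real m - real i) * d + d)\<bar> \<le> (real m - real i) * e + e"
      by linarith
    then show ?case by (simp add: algebra_simps)
  qed simp
  show ?thesis
  proof (cases "i \<le> j")
    case True
    then show ?thesis using up[of i j] assms by simp
  next
    case False
    then have "\<bar>x i - x j - (real i - real j) * d\<bar> \<le> (real i - real j) * e"
      using up[of j i] assms by simp
    moreover have "x j - x i - (real j - real i) * d = - (x i - x j - (real i - real j) * d)"
      by (simp add: algebra_simps)
    ultimately show ?thesis using False by simp
  qed
qed

text \<open>An excess of one entry over the mean has to be balanced by the deficits of the others,
  each at most \<open>c\<close>.\<close>

lemma upper_bound_from_mean: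
  fixes x :: "'a \<Rightarrow> real" and m c :: real
  assumes "finite I" "i \<in> I" and mean: "sum x I = card I * m"
    and low: "\<And>j. j \<in> I \<Longrightarrow> x j \<ge> m - c" and "c \<ge> 0"
  shows "x i \<le> m + card I * c"
proof -
  have "sum x I = x i + sum x (I - {i})" using assms by (simp add: sum.remove)
  moreover have "sum x (I - {i}) \<ge> (\<Sum>j\<in>I - {i}. m - c)"
    by (rule sum_mono) (use low in auto)
  moreover have "(\<Sum>j\<in>I - {i}. m - c) = (real (card I) - 1) * (m - c)"
  proof -
    have "card I \<ge> 1" using assms(1,2) by (auto simp: Suc_le_eq card_gt_0_iff)
    then show ?thesis using assms(1,2) by (simp add: of_nat_diff)
  qed
  ultimately have "x i \<le> card I * m - (real (card I) - 1) * (m - c)" using mean by linarith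
  then show ?thesis using \<open>c \<ge> 0\<close> by (simp add: algebra_simps)
qed

context weierstrass_series
begin

text \<open>The level at which almost periods are used on a segment of length \<open>l\<close>. Its
  scale is at most \<open>l / 2\<close>, so quotients of rescaled length at most 1 taken from the
  midpoint stay inside the segment, yet it is comparable to \<open>l\<close>.\<close>

definition zlev :: "real \<Rightarrow> nat" where "zlev l = Suc (lev (l / 2))"

lemma zlev_bounds:
  assumes "0 < l" "l \<le> 1"
  shows "1 / b ^ zlev l \<le> l / 2" and "l \<le> 2 * b * (1 / b ^ zlev l)"
proof -
  have "0 < l / 2" "l / 2 \<le> 1" using assms by auto
  note * = lev_bounds[OF this]
  show "1 / b ^ zlev l \<le> l / 2"
    using *(2) b_pow_pos[of "zlev l"] by (simp add: zlev_def field_simps)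
  show "l \<le> 2 * b * (1 / b ^ zlev l)"
    using *(1) b_pow_pos[of "lev (l / 2)"] b_pos by (simp add: zlev_def field_simps)
qed

text \<open>An iterated average over translates. At scale \<open>l\<close> the translation vectors are the elements of
  \<open>W\<close> scaled by \<open>b powr (- zlev l)\<close>, so that \<open>W\<close> can consist of almost periods of \<open>f\<close>.\<close>

primrec avg :: "(real ^ 'n) set \<Rightarrow> nat \<Rightarrow> nat \<Rightarrow> (real ^ 'n \<Rightarrow> real) \<Rightarrow> real ^ 'n \<Rightarrow> real \<Rightarrow> real" where
  "avg W B 0 g p l = g p"
| "avg W B (Suc n) g p l = (\<Sum>w\<in>W. avg W B n g (p + w /\<^sub>R b ^ zlev l) (l / B)) / card W"

lemma avg_shift: "avg W B n (\<lambda>x. g (x + v)) p l = avg W B n g (p + v) l"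
  by (induction n arbitrary: p l) (simp_all add: add_ac)

lemma avg_sum: "avg W B n (\<lambda>x. \<Sum>k\<in>I. g k x) p l = (\<Sum>k\<in>I. avg W B n (g k) p l)"
proof (induction n arbitrary: p l)
  case (Suc n)
  have "(\<Sum>w\<in>W. \<Sum>k\<in>I. avg W B n (g k) (p + w /\<^sub>R b ^ zlev l) (l / B)) =
    (\<Sum>k\<in>I. \<Sum>w\<in>W. avg W B n (g k) (p + w /\<^sub>R b ^ zlev l) (l / B))" by (rule sum.swap)
  then show ?case by (simp add: Suc sum_divide_distrib)
qed simp

lemma avg_cmult: "avg W B n (\<lambda>x. c * g x) p l = c * avg W B n g p l"
  by (induction n arbitrary: p l) (simp_all add: sum_distrib_left)

lemma avg_diff: "avg W B n (\<lambda>x. g x - h x) p l = avg W B n g p l - avg W B n h p l"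
  by (induction n arbitrary: p l) (simp_all add: sum_subtractf diff_divide_distrib)

text \<open>Scales shrink at least by half and a translation at scale \<open>l\<close> has length at
  most \<open>R * l / 2\<close>, so all points at which \<open>g\<close> is evaluated lie within
  \<open>R * l\<close> of \<open>p\<close>, for every number of generations.\<close>

lemma avg_close:
  assumes W: "finite W" "W \<noteq> {}" "\<And>w. w \<in> W \<Longrightarrow> norm w \<le> R" and B: "B \<ge> 2"
    and "0 < l" "l \<le> 1" and g: "\<And>x. norm (x - p) \<le> R * l \<Longrightarrow> \<bar>g x - a\<bar> \<le> c"
  shows "\<bar>avg W B n g p l - a\<bar> \<le> c"
  using assms(5-)
proof (induction n arbitrary: p l)
  case 0
  obtain w where "w \<in> W" using W by blast
  then have "R \<ge> 0" using W(3) norm_ge_zero[of w] order_trans by blast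
  then have "R * l \<ge> 0" using 0 by simp
  then show ?case using 0 by simp
next
  case (Suc n)
  obtain w0 where "w0 \<in> W" using W by blast
  then have "R \<ge> 0" using W(3) norm_ge_zero[of w0] order_trans by blast
  have lB: "0 < l / B" "l / B \<le> l / 2" "l / B \<le> 1"
    using Suc.prems B by (auto simp: field_simps)
  have "\<bar>avg W B n g (p + w /\<^sub>R b ^ zlev l) (l / B) - a\<bar> \<le> c" if w: "w \<in> W" for w
  proof (rule Suc.IH)
    fix x assume x: "norm (x - (p + w /\<^sub>R b ^ zlev l)) \<le> R * (l / B)"
    have "norm (w /\<^sub>R b ^ zlev l) = norm w * (1 / b ^ zlev l)"
      using b_pow_pos[of "zlev l"] by (simp add: divide_inverse)
    also have "\<dots> \<le> R * (l / 2)"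
      using W(3)[OF w] zlev_bounds(1)[OF Suc.prems(1,2)] \<open>R \<ge> 0\<close> b_pos by (intro mult_mono) auto
    finally have 1: "norm (w /\<^sub>R b ^ zlev l) \<le> R * (l / 2)" .
    have RL: "R * l = R * (l / 2) + R * (l / 2)" by simp
    have 2: "R * (l / B) \<le> R * (l / 2)" using \<open>R \<ge> 0\<close> lB by (intro mult_left_mono) auto
    have "norm (x - p) \<le> norm (x - (p + w /\<^sub>R b ^ zlev l)) + norm (w /\<^sub>R b ^ zlev l)"
      using norm_triangle_ineq[of "x - (p + w /\<^sub>R b ^ zlev l)" "w /\<^sub>R b ^ zlev l"]
      by (simp add: algebra_simps)
    then have "norm (x - p) \<le> R * l" using x 1 2 RL by linarith
    then show "\<bar>g x - a\<bar> \<le> c" by (rule Suc.prems(3))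
  qed (use lB in auto)
  then have "(\<Sum>w\<in>W. \<bar>avg W B n g (p + w /\<^sub>R b ^ zlev l) (l / B) - a\<bar>) \<le> card W * c"
    using sum_bounded_above[of W _ c] by simp
  then have "\<bar>\<Sum>w\<in>W. avg W B n g (p + w /\<^sub>R b ^ zlev l) (l / B) - a\<bar> \<le> card W * c"
    by (rule order_trans[OF sum_abs])
  moreover have "avg W B (Suc n) g p l - a = (\<Sum>w\<in>W. avg W B n g (p + w /\<^sub>R b ^ zlev l) (l / B) - a) / card W"
    using W by (simp add: sum_subtractf diff_divide_distrib)
  ultimately show ?case
    using W by (simp add: abs_divide pos_divide_le_eq card_gt_0_iff mult.commute)
qed

text \<open>The quotient is always taken over length \<open>l\<close>; only the translations descend
  to the scales \<open>l / B\<close>, \<open>l / B\<^sup>2\<close> and so on.\<close>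

definition slope_avg where
  "slope_avg W B u n p l = avg W B n (\<lambda>x. (f (x + l *\<^sub>R u) - f x) / l) p l"

text \<open>The averaged slopes form an exact martingale: subdividing the segment telescopes.\<close>

lemma slope_avg_Suc:
  fixes l :: real
  assumes B: "B \<noteq> 0" and l: "l \<noteq> 0" and W: "finite W" "W \<noteq> {}"
  shows "(\<Sum>(k :: nat, w)\<in>{..<B} \<times> W. slope_avg W B u n (p + (k * l / B) *\<^sub>R u + w /\<^sub>R b ^ zlev l) (l / B))
     = card ({..<B} \<times> W) * slope_avg W B u (Suc n) p l"
proof -
  have tel: "(\<Sum>k<B. (f (x + (k * l / B) *\<^sub>R u + (l / B) *\<^sub>R u) - f (x + (k * l / B) *\<^sub>R u)) / (l / B))
      = B * ((f (x + l *\<^sub>R u) - f x) / l)" for x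
  proof -
    have "(\<Sum>k<B. (f (x + (k * l / B) *\<^sub>R u + (l / B) *\<^sub>R u) - f (x + (k * l / B) *\<^sub>R u)) / (l / B))
      = (\<Sum>k<B. f (x + (Suc k * l / B) *\<^sub>R u) - f (x + (k * l / B) *\<^sub>R u)) / (l / B)"
      unfolding sum_divide_distrib
      by (intro sum.cong refl arg_cong2[where f = "(/)"] arg_cong2[where f = "(-)"] arg_cong[where f = f])
        (simp add: algebra_simps add_divide_distrib)
    also have "\<dots> = (f (x + l *\<^sub>R u) - f x) / (l / B)"
      using B by (subst sum_lessThan_telescope) simp
    finally show ?thesis by simp
  qed
  have "(\<Sum>(k :: nat, w)\<in>{..<B} \<times> W. slope_avg W B u n (p + (k * l / B) *\<^sub>R u + w /\<^sub>R b ^ zlev l) (l / B))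
    = (\<Sum>w\<in>W. \<Sum>k<B. slope_avg W B u n (p + w /\<^sub>R b ^ zlev l + (k * l / B) *\<^sub>R u) (l / B))"
    by (subst sum.swap) (simp add: sum.cartesian_product add_ac)
  also have "\<dots> = (\<Sum>w\<in>W. B * avg W B n (\<lambda>x. (f (x + l *\<^sub>R u) - f x) / l) (p + w /\<^sub>R b ^ zlev l) (l / B))"
    unfolding slope_avg_def avg_shift[symmetric] avg_sum[symmetric] tel avg_cmult ..
  also have "\<dots> = card ({..<B} \<times> W) * slope_avg W B u (Suc n) p l"
    using W by (simp add: slope_avg_def card_cartesian_product flip: sum_distrib_left)
  finally show ?thesis .
qed

text \<open>\<open>zoom\<close> accounts for \<open>K' * \<bar>s\<bar>\<close>, and replacing
  \<open>f\<close> near \<open>b ^ N *\<^sub>R P\<close> by \<open>f\<close> near 0 costs \<epsilon>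
  at each of the two endpoints. The term \<open>S N P \<bullet> u\<close> is the same for all
  \<open>s\<close> and cancels between two quotients.\<close>

lemma quot_transfer:
  assumes AP: "\<And>h. \<bar>f (b ^ N *\<^sub>R P + h) - f h\<bar> \<le> \<epsilon>" and u: "norm u = 1" and "s \<noteq> 0"
  shows "\<bar>(f (P + (s / b ^ N) *\<^sub>R u) - f P) / (s / b ^ N) - S N P \<bullet> u - quot u s\<bar>
     \<le> K' * \<bar>s\<bar> + 2 * \<epsilon> / \<bar>s\<bar>"
proof -
  let ?D = "b ^ N * (f (P + (s / b ^ N) *\<^sub>R u) - f P)"
  have h: "(s *\<^sub>R u) /\<^sub>R b ^ N = (s / b ^ N) *\<^sub>R u" by (simp add: divide_inverse mult.commute)
  have "\<bar>?D - S N P \<bullet> (s *\<^sub>R u) - (f (b ^ N *\<^sub>R P + s *\<^sub>R u) - f (b ^ N *\<^sub>R P))\<bar> \<le> K' * s\<^sup>2"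
    using zoom[of N P "s *\<^sub>R u"] u unfolding h by simp
  moreover have "\<bar>f (b ^ N *\<^sub>R P) - f 0\<bar> \<le> \<epsilon>" using AP[of 0] by simp
  ultimately have "\<bar>?D - s * (S N P \<bullet> u) - (f (s *\<^sub>R u) - f 0)\<bar> \<le> K' * s\<^sup>2 + 2 * \<epsilon>"
    using AP[of "s *\<^sub>R u"] by simp
  then have "\<bar>?D - s * (S N P \<bullet> u) - (f (s *\<^sub>R u) - f 0)\<bar> / \<bar>s\<bar> \<le> (K' * s\<^sup>2 + 2 * \<epsilon>) / \<bar>s\<bar>"
    by (rule divide_right_mono) simp
  also have "(K' * s\<^sup>2 + 2 * \<epsilon>) / \<bar>s\<bar> = K' * \<bar>s\<bar> + 2 * \<epsilon> / \<bar>s\<bar>"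
  proof -
    have "K' * s\<^sup>2 / \<bar>s\<bar> = K' * \<bar>s\<bar>"
      using \<open>s \<noteq> 0\<close> by (cases "s > 0") (auto simp: power2_eq_square)
    then show ?thesis by (simp only: add_divide_distrib)
  qed
  also have "\<bar>?D - s * (S N P \<bullet> u) - (f (s *\<^sub>R u) - f 0)\<bar> / \<bar>s\<bar> =
    \<bar>(f (P + (s / b ^ N) *\<^sub>R u) - f P) / (s / b ^ N) - S N P \<bullet> u - quot u s\<bar>"
    unfolding abs_divide[symmetric] quot_def using \<open>s \<noteq> 0\<close>
    by (simp add: diff_divide_distrib mult.commute)
  finally show ?thesis .
qed

text \<open>A translation by \<open>h /\<^sub>R b ^ N\<close> changes the values at the two
  endpoints by \<open>S N\<close> applied to \<open>h\<close>, up to small errors; these linear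
  parts nearly cancel since \<open>S N\<close> varies little between the endpoints. It is used for
  the translations of the deeper generations.\<close>

lemma slope_translate:
  assumes u: "norm u = 1" and s: "\<kappa> \<le> \<bar>s\<bar>" "\<kappa> > 0"
    and h: "norm h \<le> \<delta>" "\<delta> \<le> 1" and \<omega>: "\<And>x y. norm (x - y) \<le> \<delta> \<Longrightarrow> \<bar>f x - f y\<bar> \<le> \<omega>"
  shows "\<bar>(f (P + h /\<^sub>R b ^ N + (s / b ^ N) *\<^sub>R u) - f (P + h /\<^sub>R b ^ N)) / (s / b ^ N)
     - (f (P + (s / b ^ N) *\<^sub>R u) - f P) / (s / b ^ N)\<bar> \<le> K' * (1 + 2 / \<kappa>) * \<delta> + 2 * \<omega> / \<kappa>"
proof -
  let ?t = "(s / b ^ N) *\<^sub>R u"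
  have tri: "\<bar>x - y\<bar> \<le> e + 2 * e'" if "\<bar>p - q\<bar> \<le> e" "\<bar>y - q\<bar> \<le> e'" "\<bar>x - p\<bar> \<le> e'"
    for x y p q e e' :: real using that by linarith
  have "s \<noteq> 0" using s by auto
  have hd: "\<bar>f (y + h) - f y\<bar> \<le> \<omega>" for y using h \<omega>[of "y + h" y] by simp
  have "\<omega> \<ge> 0" using hd[of 0] by linarith
  have "\<delta> \<ge> 0" using h norm_ge_zero[of h] by linarith
  have "(norm h)\<^sup>2 \<le> \<delta> * 1"
    unfolding power2_eq_square using h \<open>\<delta> \<ge> 0\<close> by (intro mult_mono) auto
  then have h2: "K' * (norm h)\<^sup>2 \<le> K' * \<delta>" using K'_nonneg by (simp add: mult_left_mono)
  have "norm (S N (P + ?t) - S N P) \<le> K' * (b ^ N * norm (P + ?t - P))" by (rule S_lipschitz)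
  also have "b ^ N * norm (P + ?t - P) = \<bar>s\<bar>" using u b_pos by simp
  finally have "\<bar>(S N (P + ?t) - S N P) \<bullet> h\<bar> \<le> K' * \<bar>s\<bar> * \<delta>"
    using h K'_nonneg by (intro order_trans[OF Cauchy_Schwarz_ineq2] mult_mono) auto
  then have "\<bar>S N (P + ?t) \<bullet> h - S N P \<bullet> h\<bar> \<le> K' * \<bar>s\<bar> * \<delta>" by (simp add: inner_diff_left)
  moreover have "\<bar>b ^ N * (f (P + h /\<^sub>R b ^ N) - f P) - S N P \<bullet> h\<bar> \<le> K' * \<delta> + \<omega>"
    using zoom[of N P h] h2 hd[of "b ^ N *\<^sub>R P"] by linarith
  moreover have "\<bar>b ^ N * (f (P + ?t + h /\<^sub>R b ^ N) - f (P + ?t)) - S N (P + ?t) \<bullet> h\<bar> \<le> K' * \<delta> + \<omega>"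
    using zoom[of N "P + ?t" h] h2 hd[of "b ^ N *\<^sub>R (P + ?t)"] by linarith
  ultimately have "\<bar>b ^ N * (f (P + ?t + h /\<^sub>R b ^ N) - f (P + ?t)) - b ^ N * (f (P + h /\<^sub>R b ^ N) - f P)\<bar>
     \<le> K' * \<bar>s\<bar> * \<delta> + 2 * (K' * \<delta> + \<omega>)" by (rule tri)
  then have "\<bar>b ^ N * (f (P + ?t + h /\<^sub>R b ^ N) - f (P + ?t)) - b ^ N * (f (P + h /\<^sub>R b ^ N) - f P)\<bar> / \<bar>s\<bar>
     \<le> (K' * \<bar>s\<bar> * \<delta> + 2 * (K' * \<delta> + \<omega>)) / \<bar>s\<bar>" by (rule divide_right_mono) simp
  also have "\<dots> = K' * \<delta> + 2 * (K' * \<delta> + \<omega>) / \<bar>s\<bar>"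
    using \<open>s \<noteq> 0\<close> by (simp add: add_divide_distrib)
  also have "\<dots> \<le> K' * \<delta> + 2 * (K' * \<delta> + \<omega>) / \<kappa>"
    using s K'_nonneg \<open>\<delta> \<ge> 0\<close> \<open>\<omega> \<ge> 0\<close> by (intro add_left_mono divide_left_mono) auto
  also have "\<dots> = K' * (1 + 2 / \<kappa>) * \<delta> + 2 * \<omega> / \<kappa>"
    by (simp add: algebra_simps add_divide_distrib)
  also have "\<bar>b ^ N * (f (P + ?t + h /\<^sub>R b ^ N) - f (P + ?t)) - b ^ N * (f (P + h /\<^sub>R b ^ N) - f P)\<bar> / \<bar>s\<bar> =
    \<bar>(f (P + h /\<^sub>R b ^ N + ?t) - f (P + h /\<^sub>R b ^ N)) / (s / b ^ N) - (f (P + ?t) - f P) / (s / b ^ N)\<bar>"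
    unfolding abs_divide[symmetric] using \<open>s \<noteq> 0\<close>
    by (intro arg_cong[where f = abs]) (simp add: add_ac field_simps)
  finally show ?thesis .
qed


text \<open>If all subsegments had nearly the same averaged slope, \<open>f\<close> would be nearly affine in direction
  \<open>u\<close> near an almost period, where it looks like \<open>f\<close> at the origin. So the averaged slopes oscillate
  and, their mean being fixed, one of them drops by a definite amount.\<close>

lemma slope_avg_decreases:
  obtains W :: "(real ^ 'n) set" and B :: nat and R c :: real where
    "finite W" "W \<noteq> {}" "\<And>w. w \<in> W \<Longrightarrow> norm w \<le> R" "R \<ge> 0" "B \<ge> 2" "c > 0"
    "\<And>u n p l. \<lbrakk>norm u = 1; 0 < l; l \<le> 1\<rbrakk> \<Longrightarrow> \<exists>k<B. \<exists>w\<in>W.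
       slope_avg W B u n (p + (real k * l / B) *\<^sub>R u + w /\<^sub>R b ^ zlev l) (l / B)
         \<le> slope_avg W B u (Suc n) p l - c"
proof -
  obtain \<kappa> where \<kappa>: "\<kappa> > 0" and osc:
    "\<And>u. norm u = 1 \<Longrightarrow> \<exists>t1 t2. \<forall>s1 s2. \<bar>s1 - t1\<bar> \<le> \<kappa> \<longrightarrow> \<bar>s2 - t2\<bar> \<le> \<kappa> \<longrightarrow>
       \<kappa> \<le> \<bar>s1\<bar> \<and> \<bar>s1\<bar> \<le> 1 \<and> \<kappa> \<le> \<bar>s2\<bar> \<and> \<bar>s2\<bar> \<le> 1 \<and>
       \<bar>quot u s1 - quot u s2\<bar> \<ge> \<kappa> + K' * (\<bar>s1\<bar> + \<bar>s2\<bar>)"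
    using quot_oscillates_uniformly by metis
  \<comment> \<open>Makes the error \<open>2 * \<epsilon> / \<bar>s\<bar>\<close> of
    \<open>quot_transfer\<close> at most \<open>\<kappa> / 4\<close> when
    \<open>\<bar>s\<bar> \<ge> \<kappa>\<close>.\<close>
  define \<epsilon> where "\<epsilon> = \<kappa>\<^sup>2 / 8"
  have "\<epsilon> > 0" using \<kappa> by (simp add: \<epsilon>_def)
  then obtain W0 :: "(real ^ 'n) set" where "finite W0"
    and W0: "\<And>y. \<exists>w\<in>W0. \<forall>h. \<bar>f (y + w + h) - f h\<bar> \<le> \<epsilon>"
    using f_almost_periodic by metis
  have W0ne: "W0 \<noteq> {}" using W0[of 0] by auto
  define R where "R = (\<Sum>w\<in>W0. norm w)"
  have R: "norm w \<le> R" if "w \<in> W0" for w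
    unfolding R_def using that \<open>finite W0\<close> by (intro member_le_sum) auto
  have "R \<ge> 0" unfolding R_def by (rule sum_nonneg) simp
  \<comment> \<open>Together with \<open>Q\<delta>\<close>, the two errors of
    \<open>slope_translate\<close> are \<open>\<kappa> / 32\<close> each, hence
    \<open>\<kappa> / 8\<close> in total for a difference of two slopes.\<close>
  define \<omega> where "\<omega> = \<kappa>\<^sup>2 / 64"
  have "\<omega> > 0" using \<kappa> by (simp add: \<omega>_def)
  then obtain \<delta>0 where "\<delta>0 > 0" and \<omega>: "\<And>x y. norm (x - y) \<le> \<delta>0 \<Longrightarrow> \<bar>f x - f y\<bar> \<le> \<omega>"
    using f_uniformly_continuous by metis
  define Q where "Q = K' * (1 + 2 / \<kappa>)"
  have "Q \<ge> 0" using K'_nonneg \<kappa> by (simp add: Q_def)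
  define \<delta> where "\<delta> = min (min \<delta>0 1) (\<kappa> / 32 / (Q + 1))"
  have \<delta>: "\<delta> > 0" "\<delta> \<le> \<delta>0" "\<delta> \<le> 1"
    using \<open>\<delta>0 > 0\<close> \<kappa> \<open>Q \<ge> 0\<close> by (auto simp: \<delta>_def)
  have Q\<delta>: "Q * \<delta> \<le> \<kappa> / 32"
  proof -
    have "Q * \<delta> \<le> (Q + 1) * (\<kappa> / 32 / (Q + 1))"
      using \<open>Q \<ge> 0\<close> \<delta> by (intro mult_mono) (auto simp: \<delta>_def)
    also have "\<dots> = \<kappa> / 32"
      using \<open>Q \<ge> 0\<close> nonzero_mult_div_cancel_left[of "Q + 1" "\<kappa> / 32"] by (simp only: times_divide_eq_right)
    finally show ?thesis .
  qed
  \<comment> \<open>\<open>B\<close> will be \<open>2 * i0\<close>: even, so that the midpoint of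
    the segment is a subdivision point. The other two demands make a piece of length
    \<open>l / B\<close> at most \<kappa>, and the deeper translations at most \<delta>, in units of
    \<open>1 / b ^ N\<close>.\<close>
  obtain i0 :: nat where i0: "i0 \<ge> 1" "2 * b / \<kappa> \<le> 2 * i0" "2 * b * R / \<delta> \<le> 2 * i0"
  proof -
    obtain i0 :: nat where "i0 \<ge> 1 + \<bar>2 * b / \<kappa>\<bar> + \<bar>2 * b * R / \<delta>\<bar>"
      using real_arch_simple by blast
    then show ?thesis by (intro that[of i0]) linarith+
  qed
  define B where "B = 2 * i0"
  have B: "B \<ge> 2" "2 * b \<le> \<kappa> * B" "2 * b * R \<le> \<delta> * B"
    using i0 \<kappa> \<delta> by (auto simp: B_def field_simps)
  define M where "M = card ({..<B} \<times> W0)"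
  have "M > 0" using B \<open>finite W0\<close> W0ne by (simp add: M_def card_gt_0_iff)
  \<comment> \<open>If none of the \<open>M\<close> slopes falls by \<open>c\<close>, then
    \<open>upper_bound_from_mean\<close> puts all of them within \<open>M * c\<close>, that is
    \<open>\<kappa> / 8\<close>, of their mean.\<close>
  define c where "c = \<kappa> / 8 / M"
  have "c > 0" using \<kappa> \<open>M > 0\<close> by (simp add: c_def)
  show thesis
  proof (rule that[OF \<open>finite W0\<close> W0ne R \<open>R \<ge> 0\<close> B(1) \<open>c > 0\<close>])
    fix u :: "real ^ 'n" and n and p :: "real ^ 'n" and l :: real
    assume u: "norm u = 1" and l: "0 < l" "l \<le> 1"
    define X where "X = slope_avg W0 B u (Suc n) p l"
    define ch where "ch = (\<lambda>(k::nat, w). slope_avg W0 B u n (p + (real k * l / B) *\<^sub>R u + w /\<^sub>R b ^ zlev l) (l / B))"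
    define N where "N = zlev l"
    define \<rho> where "\<rho> = 1 / b ^ N"
    have "\<rho> > 0" using b_pos by (simp add: \<rho>_def)
    have \<rho>: "\<rho> \<le> l / 2" "l \<le> 2 * b * \<rho>" unfolding \<rho>_def N_def using zlev_bounds[OF l] by auto
    show "\<exists>k<B. \<exists>w\<in>W0. slope_avg W0 B u n (p + (real k * l / B) *\<^sub>R u + w /\<^sub>R b ^ zlev l) (l / B)
         \<le> slope_avg W0 B u (Suc n) p l - c"
    proof (rule ccontr)
      assume neg: "\<not> ?thesis"
      have low: "ch j \<ge> X - c" if "j \<in> {..<B} \<times> W0" for j
        using neg that unfolding ch_def X_def by (cases j) (auto simp: not_le intro: less_imp_le)
      have mean: "sum ch ({..<B} \<times> W0) = M * X"
        unfolding ch_def M_def X_def using slope_avg_Suc[of B l W0 u n p] B l \<open>finite W0\<close> W0ne by simp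
      have close: "\<bar>ch j - X\<bar> \<le> \<kappa> / 8" if "j \<in> {..<B} \<times> W0" for j
      proof -
        have "ch j \<le> X + M * c"
          unfolding M_def
          by (rule upper_bound_from_mean[OF _ that]) (use low mean \<open>c > 0\<close> \<open>finite W0\<close> in \<open>auto simp: M_def\<close>)
        moreover have "M * c = \<kappa> / 8" using \<open>M > 0\<close> by (simp add: c_def)
        moreover have "c \<le> \<kappa> / 8" using \<open>M > 0\<close> \<kappa> by (simp add: c_def field_simps)
        ultimately show ?thesis using low[OF that] by linarith
      qed
      \<comment> \<open>The correction \<open>w\<close> that moves the midpoint to an almost period
        is one of the averaged translations, so the pieces of the segment through \<open>P\<close>
        occur among the children with index \<open>(k, w)\<close>.\<close>
      obtain w where w: "w \<in> W0" and
        AP0: "\<And>h. \<bar>f (b ^ N *\<^sub>R (p + (l / 2) *\<^sub>R u) + w + h) - f h\<bar> \<le> \<epsilon>" using W0 by blast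
      define P where "P = p + (l / 2) *\<^sub>R u + w /\<^sub>R b ^ N"
      have AP: "\<bar>f (b ^ N *\<^sub>R P + h) - f h\<bar> \<le> \<epsilon>" for h
        using AP0[of h] b_nonzero by (simp add: P_def scaleR_add_right)
      obtain t1 t2 where t: "\<And>s1 s2. \<lbrakk>\<bar>s1 - t1\<bar> \<le> \<kappa>; \<bar>s2 - t2\<bar> \<le> \<kappa>\<rbrakk> \<Longrightarrow>
         \<kappa> \<le> \<bar>s1\<bar> \<and> \<bar>s1\<bar> \<le> 1 \<and> \<kappa> \<le> \<bar>s2\<bar> \<and> \<bar>s2\<bar> \<le> 1 \<and>
         \<bar>quot u s1 - quot u s2\<bar> \<ge> \<kappa> + K' * (\<bar>s1\<bar> + \<bar>s2\<bar>)"
        using osc[OF u] by blast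
      \<comment> \<open>Length of one piece, measured in units of \<open>1 / b ^ N\<close>;
        \<open>t1\<close> and \<open>t2\<close> are rounded to multiples of it.\<close>
      define unit where "unit = l / (B * \<rho>)"
      have "unit > 0" using l B \<open>\<rho> > 0\<close> by (simp add: unit_def)
      have "unit \<le> \<kappa>"
      proof -
        have "l \<le> 2 * b * \<rho>" by (rule \<rho>)
        also have "\<dots> \<le> \<kappa> * B * \<rho>" using B \<open>\<rho> > 0\<close> by (intro mult_right_mono) auto
        finally show ?thesis using B \<open>\<rho> > 0\<close> by (simp add: unit_def field_simps)
      qed
      define m1 where "m1 = \<lfloor>t1 / unit\<rfloor>"
      define m2 where "m2 = \<lfloor>t2 / unit\<rfloor>"
      have grid: "\<bar>\<lfloor>t / unit\<rfloor> * unit - t\<bar> \<le> \<kappa>" for t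
      proof -
        have "\<bar>\<lfloor>t / unit\<rfloor> - t / unit\<bar> \<le> 1" by linarith
        then have "\<bar>\<lfloor>t / unit\<rfloor> - t / unit\<bar> * unit \<le> 1 * unit"
          using \<open>unit > 0\<close> by (intro mult_right_mono) auto
        also have "\<bar>\<lfloor>t / unit\<rfloor> - t / unit\<bar> * unit = \<bar>(\<lfloor>t / unit\<rfloor> - t / unit) * unit\<bar>"
          using \<open>unit > 0\<close> by (simp add: abs_mult)
        also have "(\<lfloor>t / unit\<rfloor> - t / unit) * unit = \<lfloor>t / unit\<rfloor> * unit - t"
          using \<open>unit > 0\<close> by (simp add: left_diff_distrib)
        finally show ?thesis using \<open>unit \<le> \<kappa>\<close> by linarith
      qed
      define s1 where "s1 = m1 * unit"
      define s2 where "s2 = m2 * unit"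
      have s: "\<kappa> \<le> \<bar>s1\<bar>" "\<bar>s1\<bar> \<le> 1" "\<kappa> \<le> \<bar>s2\<bar>" "\<bar>s2\<bar> \<le> 1"
        and sq: "\<bar>quot u s1 - quot u s2\<bar> \<ge> \<kappa> + K' * (\<bar>s1\<bar> + \<bar>s2\<bar>)"
        using t[of s1 s2] grid[of t1] grid[of t2] unfolding s1_def s2_def m1_def m2_def by auto
      define \<beta> where "\<beta> x s = (f (x + (s / b ^ N) *\<^sub>R u) - f x) / (s / b ^ N)" for x s
      define br where "br x = \<beta> x s1 - \<beta> x s2" for x
      have \<epsilon>\<kappa>: "2 * \<epsilon> / \<bar>s\<bar> \<le> \<kappa> / 4" if "\<kappa> \<le> \<bar>s\<bar>" for s
      proof -
        have "2 * \<epsilon> / \<bar>s\<bar> \<le> 2 * \<epsilon> / \<kappa>"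
          using that \<kappa> \<open>\<epsilon> > 0\<close> by (intro divide_left_mono) auto
        then show ?thesis using \<kappa> by (simp add: \<epsilon>_def power2_eq_square)
      qed
      have brP: "\<bar>br P\<bar> \<ge> \<kappa> / 2"
      proof -
        have "\<bar>\<beta> P s1 - S N P \<bullet> u - quot u s1\<bar> \<le> K' * \<bar>s1\<bar> + \<kappa> / 4"
          using quot_transfer[OF AP u, of s1] \<epsilon>\<kappa>[OF s(1)] s \<kappa> unfolding \<beta>_def by fastforce
        moreover have "\<bar>\<beta> P s2 - S N P \<bullet> u - quot u s2\<bar> \<le> K' * \<bar>s2\<bar> + \<kappa> / 4"
          using quot_transfer[OF AP u, of s2] \<epsilon>\<kappa>[OF s(3)] s \<kappa> unfolding \<beta>_def by fastforce
        ultimately show ?thesis using sq unfolding br_def distrib_left by linarith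
      qed
      have br_near: "\<bar>br x - br P\<bar> \<le> \<kappa> / 8" if x: "norm (x - P) \<le> R * (l / B)" for x
      proof -
        define h where "h = b ^ N *\<^sub>R (x - P)"
        have xh: "x = P + h /\<^sub>R b ^ N" using b_nonzero by (simp add: h_def)
        have "norm h = norm (x - P) / \<rho>" using b_pos by (simp add: h_def \<rho>_def)
        also have "\<dots> \<le> R * (2 * b * \<rho> / B) / \<rho>"
          using x \<rho> \<open>\<rho> > 0\<close> \<open>R \<ge> 0\<close> B
          by (intro divide_right_mono order_trans[OF x] mult_left_mono) auto
        also have "\<dots> = (2 * b * R) / B" using \<open>\<rho> > 0\<close> by simp
        also have "\<dots> \<le> \<delta>" using B by (simp add: divide_le_eq)
        finally have h: "norm h \<le> \<delta>" .
        have 1: "2 * \<omega> / \<kappa> = \<kappa> / 32" using \<kappa> by (simp add: \<omega>_def power2_eq_square)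
        have st: "\<bar>\<beta> x s - \<beta> P s\<bar> \<le> \<kappa> / 16" if "\<kappa> \<le> \<bar>s\<bar>" for s
        proof -
          have "\<bar>\<beta> x s - \<beta> P s\<bar> \<le> Q * \<delta> + 2 * \<omega> / \<kappa>"
            unfolding \<beta>_def xh Q_def
            using slope_translate[OF u that \<kappa> h \<delta>(3), of \<omega>] \<omega> \<delta>(2) by (meson order_trans)
          then show ?thesis using Q\<delta> 1 by linarith
        qed
        show ?thesis using st[OF s(1)] st[OF s(3)] unfolding br_def by linarith
      qed
      define v where "v k = ((real k - real i0) * (l / B)) *\<^sub>R u" for k :: nat
      \<comment> \<open>Averaged values of \<open>f\<close> at the subdivision points of the segment
        through \<open>P\<close>, where index \<open>i0\<close> is \<open>P\<close> itself. Nearly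
        equal slopes make them nearly an arithmetic progression, so longer quotients from
        \<open>P\<close> also average to about \<open>X\<close>.\<close>
      define \<Phi> where "\<Phi> k = avg W0 B n (\<lambda>x. f (x + v k)) P (l / B)" for k
      have v_Suc: "v (Suc k) = v k + (l / B) *\<^sub>R u" for k
        by (simp add: v_def algebra_simps add_divide_distrib)
      have step: "\<bar>\<Phi> (Suc k) - \<Phi> k - (l / B) * X\<bar> \<le> (l / B) * (\<kappa> / 8)" if "k < B" for k
      proof -
        have "real k * l / B = l / 2 + (real k - real i0) * (l / B)"
          using i0 by (simp add: B_def field_simps)
        then have pt: "p + (real k * l / B) *\<^sub>R u + w /\<^sub>R b ^ zlev l = P + v k"
          by (simp add: P_def N_def v_def scaleR_add_left add_ac)
        have "\<Phi> (Suc k) - \<Phi> k = avg W0 B n (\<lambda>x. (l / B) *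
           ((f (x + v k + (l / B) *\<^sub>R u) - f (x + v k)) / (l / B))) P (l / B)"
          unfolding \<Phi>_def avg_diff[symmetric] v_Suc using l B by (simp add: add.assoc)
        also have "\<dots> = (l / B) * ch (k, w)"
          unfolding ch_def prod.case pt unfolding slope_avg_def avg_shift[symmetric] avg_cmult ..
        finally have "\<Phi> (Suc k) - \<Phi> k - (l / B) * X = (l / B) * (ch (k, w) - X)"
          by (simp only: right_diff_distrib)
        then have "\<bar>\<Phi> (Suc k) - \<Phi> k - (l / B) * X\<bar> = (l / B) * \<bar>ch (k, w) - X\<bar>"
          using l B by (simp add: abs_mult)
        also have "\<dots> \<le> (l / B) * (\<kappa> / 8)"
          using l B close[of "(k, w)"] that w by (intro mult_left_mono) auto
        finally show ?thesis .
      qed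
      have avg\<beta>: "\<bar>avg W0 B n (\<lambda>x. \<beta> x (m * unit)) P (l / B) - X\<bar> \<le> \<kappa> / 8"
        if m: "\<kappa> \<le> \<bar>m * unit\<bar>" "\<bar>m * unit\<bar> \<le> 1" for m :: int
      proof -
        \<comment> \<open>A step of rescaled length at most 1 from the midpoint covers at most half
          the segment, hence at most \<open>i0\<close> pieces, and the index \<open>i0 + m\<close>
          stays between 0 and \<open>B\<close>.\<close>
        have "\<bar>real_of_int m\<bar> * l \<le> B * \<rho>"
          using m(2) \<open>unit > 0\<close> l B \<open>\<rho> > 0\<close> by (simp add: unit_def abs_mult field_simps)
        also have "\<dots> \<le> B * (l / 2)" using \<rho> by (intro mult_left_mono) auto
        also have "\<dots> = i0 * l" by (simp add: B_def)
        finally have "\<bar>real_of_int m\<bar> \<le> i0" using l by simp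
        then have mi: "\<bar>m\<bar> \<le> int i0" by linarith
        define j where "j = nat (int i0 + m)"
        have j: "j \<le> B" "real j - real i0 = m" using mi by (auto simp: j_def B_def)
        have "m \<noteq> 0" using m \<kappa> by auto
        have "\<bar>\<Phi> j - \<Phi> i0 - (real j - real i0) * ((l / B) * X)\<bar> \<le> \<bar>real j - real i0\<bar> * ((l / B) * (\<kappa> / 8))"
          by (rule near_arithmetic_progression[where x = \<Phi> and n = B, OF step]) (use j in \<open>auto simp: B_def\<close>)
        then have "\<bar>\<Phi> j - \<Phi> i0 - m * (l / B) * X\<bar> \<le> \<bar>m * (l / B)\<bar> * (\<kappa> / 8)"
          unfolding j(2) using l B by (simp add: abs_mult mult.assoc)
        moreover have mu: "m * unit / b ^ N = m * (l / B)"
          using \<open>\<rho> > 0\<close> b_pos by (simp add: unit_def \<rho>_def)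
        have "\<Phi> j - \<Phi> i0 = m * (l / B) * avg W0 B n (\<lambda>x. \<beta> x (m * unit)) P (l / B)"
          unfolding \<Phi>_def v_def avg_diff[symmetric] avg_cmult[symmetric] \<beta>_def mu j(2)
          using \<open>m \<noteq> 0\<close> l B by simp
        ultimately have "\<bar>m * (l / B) * (avg W0 B n (\<lambda>x. \<beta> x (m * unit)) P (l / B) - X)\<bar>
            \<le> \<bar>m * (l / B)\<bar> * (\<kappa> / 8)" by (simp add: right_diff_distrib)
        then show ?thesis using \<open>m \<noteq> 0\<close> l B by (simp only: abs_mult) (simp add: field_simps)
      qed
      \<comment> \<open>The contradiction: two averages within \<open>\<kappa> / 8\<close> of
        \<open>X\<close> give an averaged \<open>br\<close> of size at most
        \<open>\<kappa> / 4\<close>, yet it is within \<open>\<kappa> / 8\<close> of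
        \<open>br P\<close>, whose size is at least \<open>\<kappa> / 2\<close>.\<close>
      have "\<bar>avg W0 B n br P (l / B) - br P\<bar> \<le> \<kappa> / 8"
      proof (rule avg_close[OF \<open>finite W0\<close> W0ne R B(1)])
        show "0 < l / B" "l / B \<le> 1" using l B by (auto simp: divide_le_eq)
      qed (use br_near in auto)
      moreover have "avg W0 B n br P (l / B) =
         avg W0 B n (\<lambda>x. \<beta> x s1) P (l / B) - avg W0 B n (\<lambda>x. \<beta> x s2) P (l / B)"
        unfolding br_def avg_diff ..
      moreover have "\<bar>avg W0 B n (\<lambda>x. \<beta> x s1) P (l / B) - X\<bar> \<le> \<kappa> / 8"
        "\<bar>avg W0 B n (\<lambda>x. \<beta> x s2) P (l / B) - X\<bar> \<le> \<kappa> / 8"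
        using avg\<beta>[OF s(1,2)[unfolded s1_def]] avg\<beta>[OF s(3,4)[unfolded s2_def]]
        unfolding s1_def s2_def by simp_all
      ultimately show False using brP \<kappa> by linarith
    qed
  qed
qed

lemma slope_approx:
  assumes "norm u = 1" "0 < l" "l \<le> 1"
  shows "\<bar>(f (x + l *\<^sub>R u) - f x) / l - u \<bullet> A x l\<bar> \<le> b * (K' + 2 * F)"
proof -
  have "\<bar>f (x + l *\<^sub>R u) - f x - A x l \<bullet> (l *\<^sub>R u)\<bar> \<le> b * (K' + 2 * F) * l"
    using A_approx[of l "l *\<^sub>R u" 1 x] assms by simp
  moreover have "(f (x + l *\<^sub>R u) - f x) / l - u \<bullet> A x l = (f (x + l *\<^sub>R u) - f x - A x l \<bullet> (l *\<^sub>R u)) / l"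
    using assms by (simp add: diff_divide_distrib inner_commute)
  ultimately show ?thesis using assms by (simp add: abs_divide divide_le_eq)
qed

text \<open>Iteration of \<open>slope_avg_decreases\<close>; the averaged slopes agree with the gradient sums up to a constant
  that does not depend on the number of iterations.\<close>

proposition gradient_sum_drop:
  obtains \<kappa> where "0 < \<kappa>" "\<kappa> \<le> 1"
    "\<And>u x r. \<lbrakk>norm u = 1; 0 < r; r \<le> 1\<rbrakk> \<Longrightarrow> \<exists>y. norm (y - x) \<le> r \<and> u \<bullet> A y (\<kappa> * r) \<le> u \<bullet> A x r - H"
proof -
  obtain W :: "(real ^ 'n) set" and B :: nat and R c :: real where
    W: "finite W" "W \<noteq> {}" "\<And>w. w \<in> W \<Longrightarrow> norm w \<le> R" and "R \<ge> 0" and B: "B \<ge> 2" and "c > 0" and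
    step: "\<And>u n p l. \<lbrakk>norm u = 1; 0 < l; l \<le> 1\<rbrakk> \<Longrightarrow> \<exists>k<B. \<exists>w\<in>W.
       slope_avg W B u n (p + (real k * l / B) *\<^sub>R u + w /\<^sub>R b ^ zlev l) (l / B)
         \<le> slope_avg W B u (Suc n) p l - c"
    by (rule slope_avg_decreases) blast
  have chain: "\<exists>q. norm (q - p) \<le> 2 * (1 + R) * l \<and>
      slope_avg W B u 0 q (l / B ^ n) \<le> slope_avg W B u n p l - n * c"
    if u: "norm u = 1" and "0 < l" "l \<le> 1" for u n p l
    using that(2,3)
  proof (induction n arbitrary: p l)
    case 0
    then show ?case using \<open>R \<ge> 0\<close> by (intro exI[of _ p]) simp
  next
    case (Suc n)
    obtain k w where k: "k < B" and w: "w \<in> W" and le: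
      "slope_avg W B u n (p + (real k * l / B) *\<^sub>R u + w /\<^sub>R b ^ zlev l) (l / B)
         \<le> slope_avg W B u (Suc n) p l - c"
      using step[OF u Suc.prems] by blast
    define p' where "p' = p + (real k * l / B) *\<^sub>R u + w /\<^sub>R b ^ zlev l"
    have lB: "0 < l / B" "l / B \<le> l / 2" "l / B \<le> 1"
      using Suc.prems B by (auto simp: field_simps)
    obtain q where q: "norm (q - p') \<le> 2 * (1 + R) * (l / B)"
      "slope_avg W B u 0 q (l / B / B ^ n) \<le> slope_avg W B u n p' (l / B) - n * c"
      using Suc.IH[OF lB(1,3)] by blast
    have "norm (p' - p) \<le> norm ((real k * l / B) *\<^sub>R u) + norm (w /\<^sub>R b ^ zlev l)"
      unfolding p'_def using norm_triangle_ineq[of "(real k * l / B) *\<^sub>R u" "w /\<^sub>R b ^ zlev l"]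
      by (simp add: add.assoc)
    also have "norm ((real k * l / B) *\<^sub>R u) \<le> l"
      using u k Suc.prems by (simp add: divide_le_eq)
    also have "norm (w /\<^sub>R b ^ zlev l) = norm w * (1 / b ^ zlev l)"
      using b_pow_pos[of "zlev l"] by (simp add: divide_inverse)
    also have "\<dots> \<le> R * (l / 2)"
      using W(3)[OF w] zlev_bounds(1)[OF Suc.prems] \<open>R \<ge> 0\<close> b_pos by (intro mult_mono) auto
    finally have p': "norm (p' - p) \<le> l + R * (l / 2)" by simp
    have "norm (q - p) \<le> norm (q - p') + norm (p' - p)"
      using norm_triangle_ineq[of "q - p'" "p' - p"] by simp
    also have "\<dots> \<le> 2 * (1 + R) * (l / 2) + (l + R * (l / 2))"
    proof -
      have "2 * (1 + R) * (l / B) \<le> 2 * (1 + R) * (l / 2)"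
        using lB(2) \<open>R \<ge> 0\<close> by (intro mult_left_mono) auto
      then show ?thesis using q(1) p' by linarith
    qed
    also have "\<dots> \<le> 2 * (1 + R) * l"
    proof -
      have "R * l \<ge> 0" using \<open>R \<ge> 0\<close> Suc.prems by simp
      then show ?thesis by (simp add: algebra_simps)
    qed
    finally have "norm (q - p) \<le> 2 * (1 + R) * l" .
    moreover have "slope_avg W B u 0 q (l / B ^ Suc n) \<le> slope_avg W B u (Suc n) p l - Suc n * c"
      using q(2) le unfolding p'_def by (simp add: algebra_simps)
    ultimately show ?case by blast
  qed
  define C0 where "C0 = b * (K' + 2 * F)"
  \<comment> \<open>The total displacement of a descent per unit of initial length; starting from
    length \<open>r / \<Lambda>\<close> keeps the final point within \<open>r\<close> of
    \<open>x\<close>.\<close>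
  define \<Lambda> where "\<Lambda> = 2 * (1 + R)"
  have "\<Lambda> \<ge> 1" using \<open>R \<ge> 0\<close> by (simp add: \<Lambda>_def)
  obtain C1 where C1: "\<And>x y r r'. \<lbrakk>0 < r'; r' \<le> r; r \<le> 1; r \<le> \<Lambda> * r'; norm (x - y) \<le> \<Lambda> * r\<rbrakk>
       \<Longrightarrow> norm (A x r - A y r') \<le> C1"
    using A_stable[OF \<open>\<Lambda> \<ge> 1\<close>] by metis
  \<comment> \<open>The gains must cover \<open>H\<close>, the cost \<open>C0 + C1\<close> of
    replacing the averaged slope at the start by \<open>A x r\<close>, and \<open>C0\<close> at the
    end. Since these costs do not involve \<open>n\<close>, such an \<open>n\<close> exists.\<close>
  obtain n :: nat where n: "n * c \<ge> H + 2 * C0 + C1"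
  proof -
    obtain n :: nat where "(H + 2 * C0 + C1) / c \<le> n" using real_arch_simple by blast
    then show ?thesis using \<open>c > 0\<close> by (intro that[of n]) (simp add: divide_le_eq)
  qed
  define \<kappa> where "\<kappa> = 1 / (\<Lambda> * B ^ n)"
  show thesis
  proof
    show "0 < \<kappa>" using \<open>\<Lambda> \<ge> 1\<close> B by (simp add: \<kappa>_def)
    have "1 \<le> \<Lambda> * real B ^ n"
      using \<open>\<Lambda> \<ge> 1\<close> B mult_mono[of 1 \<Lambda> 1 "real B ^ n"] by simp
    then show "\<kappa> \<le> 1" by (simp add: \<kappa>_def)
    fix u x :: "real ^ 'n" and r :: real
    assume u: "norm u = 1" and r: "0 < r" "r \<le> 1"
    define l where "l = r / \<Lambda>"
    have l: "0 < l" "l \<le> r" "l \<le> 1" "r = \<Lambda> * l"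
      using r \<open>\<Lambda> \<ge> 1\<close> mult_left_mono[of 1 \<Lambda> r] by (auto simp: l_def divide_le_eq)
    have kr: "\<kappa> * r = l / B ^ n" by (simp add: \<kappa>_def l_def)
    obtain q where q: "norm (q - x) \<le> 2 * (1 + R) * l"
      "slope_avg W B u 0 q (l / B ^ n) \<le> slope_avg W B u n x l - n * c"
      using chain[OF u l(1,3)] by blast
    have "\<bar>slope_avg W B u n x l - u \<bullet> A x r\<bar> \<le> C0 + C1"
      unfolding slope_avg_def
    proof (rule avg_close[OF W B l(1,3)])
      fix y assume y: "norm (y - x) \<le> R * l"
      have "R * l \<le> \<Lambda> * r"
        using l \<open>R \<ge> 0\<close> r by (intro mult_mono) (auto simp: \<Lambda>_def)
      then have "norm (x - y) \<le> \<Lambda> * r" using y norm_minus_commute[of x y] by linarith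
      then have "norm (A x r - A y l) \<le> C1"
        using l(4) by (intro C1[OF l(1,2) r(2)]) auto
      then have "\<bar>u \<bullet> A x r - u \<bullet> A y l\<bar> \<le> C1"
        using Cauchy_Schwarz_ineq2[of u "A x r - A y l"] u by (simp add: inner_diff_right)
      then show "\<bar>(f (y + l *\<^sub>R u) - f y) / l - u \<bullet> A x r\<bar> \<le> C0 + C1"
        using slope_approx[OF u l(1,3), of y] unfolding C0_def by linarith
    qed
    moreover have "\<bar>slope_avg W B u 0 q (l / B ^ n) - u \<bullet> A q (l / B ^ n)\<bar> \<le> C0"
    proof -
      have "l / B ^ n \<le> l / 1" using B l by (intro divide_left_mono) auto
      then have "l / B ^ n \<le> 1" using l by linarith
      moreover have "0 < l / B ^ n" using l B by simp
      ultimately show ?thesis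
        unfolding slope_avg_def avg.simps C0_def by (intro slope_approx u)
    qed
    ultimately have "u \<bullet> A q (\<kappa> * r) \<le> u \<bullet> A x r - H"
      using q(2) n unfolding kr by linarith
    moreover have "norm (q - x) \<le> r" using q(1) l by (simp add: \<Lambda>_def)
    ultimately show "\<exists>y. norm (y - x) \<le> r \<and> u \<bullet> A y (\<kappa> * r) \<le> u \<bullet> A x r - H" by blast
  qed
qed

end

section \<open>Zygmund class, differentiability and null sets\<close>

lemma Limsup_less_infinity_iff:
  fixes g :: "'a \<Rightarrow> real"
  shows "Limsup F (\<lambda>x. ereal (g x)) < \<infinity> \<longleftrightarrow> (\<exists>c. \<forall>\<^sub>F x in F. g x \<le> c)"
proof
  assume "Limsup F (\<lambda>x. ereal (g x)) < \<infinity>"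
  then obtain c where "Limsup F (\<lambda>x. ereal (g x)) < ereal c" using ereal_dense2 by blast
  then have "\<forall>\<^sub>F x in F. ereal (g x) < ereal c" by (rule Limsup_lessD)
  then show "\<exists>c. \<forall>\<^sub>F x in F. g x \<le> c"
    by (intro exI[of _ c]) (auto elim: eventually_mono)
next
  assume "\<exists>c. \<forall>\<^sub>F x in F. g x \<le> c"
  then obtain c where "\<forall>\<^sub>F x in F. ereal (g x) \<le> ereal c" by auto
  then have "Limsup F (\<lambda>x. ereal (g x)) \<le> ereal c" by (rule Limsup_bounded)
  then show "Limsup F (\<lambda>x. ereal (g x)) < \<infinity>" by auto
qed

lemma lip_points_iff:
  "x \<in> lip_points g \<longleftrightarrow> (\<exists>c. \<forall>\<^sub>F h in at 0. \<bar>g (x + h) - g x\<bar> / norm h \<le> c)"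
  unfolding lip_points_def mem_Collect_eq Limsup_less_infinity_iff ..

lemma dir_lip_points_iff:
  "x \<in> dir_lip_points g e \<longleftrightarrow> (\<exists>c. \<forall>\<^sub>F t in at 0. \<bar>g (x + t *\<^sub>R e) - g x\<bar> / \<bar>t\<bar> \<le> c)"
  unfolding dir_lip_points_def mem_Collect_eq Limsup_less_infinity_iff ..

lemma lip_points_subset_dir_lip_points:
  assumes "norm e = 1"
  shows "lip_points g \<subseteq> dir_lip_points g e"
proof
  fix x assume "x \<in> lip_points g"
  then obtain c where "\<forall>\<^sub>F h in at 0. \<bar>g (x + h) - g x\<bar> / norm h \<le> c"
    by (auto simp: lip_points_iff)
  moreover have "filterlim (\<lambda>t. t *\<^sub>R e) (at 0) (at 0)"
    unfolding filterlim_at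
  proof
    have "((\<lambda>t. t *\<^sub>R e) \<longlongrightarrow> 0 *\<^sub>R e) (at 0)" by (intro tendsto_intros)
    then show "((\<lambda>t. t *\<^sub>R e) \<longlongrightarrow> 0) (at 0)" by simp
    show "\<forall>\<^sub>F t in at 0. t *\<^sub>R e \<in> UNIV \<and> t *\<^sub>R e \<noteq> 0"
      unfolding eventually_at using assms by (intro exI[of _ 1]) auto
  qed
  ultimately have "\<forall>\<^sub>F t in at 0. \<bar>g (x + t *\<^sub>R e) - g x\<bar> / norm (t *\<^sub>R e) \<le> c"
    unfolding filterlim_iff by blast
  then show "x \<in> dir_lip_points g e"
    using assms by (auto simp: dir_lip_points_iff)
qed

text \<open>Each small ball centred in \<open>E\<close> loses a fixed proportion to a hole, so
  \<open>E\<close> fills at most \<theta> of it. A bounded piece of positive measure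
  \<open>m\<close> would have an open neighbourhood of measure below \<open>m / \<theta>\<close>; a
  Vitali family of disjoint balls in it, covering the piece up to a null set, then gives the
  contradiction \<open>m < m\<close>.\<close>

lemma porous_imp_negligible:
  fixes E :: "'a::euclidean_space set"
  assumes "closed E" and \<kappa>: "0 < \<kappa>" "\<kappa> \<le> 1"
    and porous: "\<And>x r. \<lbrakk>x \<in> E; 0 < r; r \<le> 1\<rbrakk> \<Longrightarrow> \<exists>y. norm (y - x) \<le> r \<and> ball y (\<kappa> * r) \<inter> E = {}"
  shows "negligible E"
proof -
  let ?d = "DIM('a)" and ?V = "unit_ball_vol DIM('a)"
  \<comment> \<open>A hole of radius \<open>\<kappa> * r\<close> is compared with the ball of radius
    \<open>2 * r\<close>, which is large enough to contain it.\<close>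
  define \<theta> where "\<theta> = 1 - (\<kappa> / 2) ^ ?d"
  have "(\<kappa> / 2) ^ ?d \<le> (\<kappa> / 2) ^ 1"
    using \<kappa> DIM_positive[where 'a = 'a] by (intro power_decreasing) auto
  then have "(\<kappa> / 2) ^ ?d < 1" using \<kappa> by simp
  then have \<theta>: "0 < \<theta>" "\<theta> < 1" using \<kappa> by (auto simp: \<theta>_def)
  have shrink: "emeasure lebesgue (E \<inter> ball x s) \<le> ennreal \<theta> * emeasure lebesgue (ball x s)"
    if x: "x \<in> E" and s: "0 < s" "s \<le> 2" for x s
  proof -
    define r where "r = s / 2"
    have r: "0 < r" "r \<le> 1" "s = 2 * r" using s by (auto simp: r_def)
    obtain y where y: "norm (y - x) \<le> r" "ball y (\<kappa> * r) \<inter> E = {}" using porous[OF x r(1,2)] by blast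
    have sub: "ball y (\<kappa> * r) \<subseteq> ball x s"
    proof
      fix z assume "z \<in> ball y (\<kappa> * r)"
      moreover have "\<kappa> * r \<le> 1 * r" using \<kappa> r by (intro mult_right_mono) auto
      ultimately have "dist y z < r" by simp
      then show "z \<in> ball x s"
        using y(1) dist_triangle[of x z y] r by (simp add: dist_norm norm_minus_commute)
    qed
    have "E \<inter> ball x s \<subseteq> ball x s - ball y (\<kappa> * r)" using y by auto
    then have "emeasure lebesgue (E \<inter> ball x s) \<le> emeasure lebesgue (ball x s - ball y (\<kappa> * r))"
      by (intro emeasure_mono) auto
    also have "\<dots> = ennreal (measure lebesgue (ball x s - ball y (\<kappa> * r)))"
      by (intro emeasure_eq_measure2 fmeasurable.Diff) auto
    also have "measure lebesgue (ball x s - ball y (\<kappa> * r)) = measure lebesgue (ball x s) - measure lebesgue (ball y (\<kappa> * r))"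
      by (rule measurable_measure_Diff) (use sub in auto)
    also have "\<dots> = ?V * s ^ ?d - ?V * (\<kappa> * r) ^ ?d"
      using s r \<kappa> by (simp add: content_ball)
    also have "(\<kappa> * r) ^ ?d = (\<kappa> / 2) ^ ?d * s ^ ?d"
      unfolding power_mult_distrib[symmetric] r(3) by simp
    also have "?V * s ^ ?d - ?V * ((\<kappa> / 2) ^ ?d * s ^ ?d) = \<theta> * (?V * s ^ ?d)"
      by (simp add: \<theta>_def algebra_simps)
    also have "?V * s ^ ?d = measure lebesgue (ball x s)" using s by (simp add: content_ball)
    also have "ennreal (\<theta> * measure lebesgue (ball x s)) = ennreal \<theta> * emeasure lebesgue (ball x s)"
      using \<theta> by (simp add: ennreal_mult emeasure_eq_measure2)
    finally show ?thesis .
  qed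
  have "negligible (E \<inter> ball 0 n)" for n :: nat
  proof (rule ccontr)
    define T where "T = E \<inter> ball 0 (real n)"
    assume "\<not> negligible (E \<inter> ball 0 n)"
    then have nT: "\<not> negligible T" by (simp add: T_def)
    have Tm: "T \<in> lmeasurable"
    proof (rule bounded_set_imp_lmeasurable)
      show "bounded T" unfolding T_def by (rule bounded_subset[OF bounded_ball]) auto
      show "T \<in> sets lebesgue" unfolding T_def using \<open>closed E\<close> by (intro sets.Int) auto
    qed
    have "measure lebesgue T > 0"
      using nT Tm negligible_iff_measure zero_less_measure_iff by blast
    define m where "m = measure lebesgue T"
    have "m > 0" unfolding m_def by fact
    have "m / \<theta> - m > 0" using \<theta> \<open>m > 0\<close> by (simp add: field_simps)
    then obtain U where U: "open U" "T \<subseteq> U" "U - T \<in> lmeasurable" "emeasure lebesgue (U - T) < ennreal (m / \<theta> - m)"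
      by (rule sets_lebesgue_outer_open[OF fmeasurableD[OF Tm]])
    have "emeasure lebesgue U \<le> emeasure lebesgue T + emeasure lebesgue (U - T)"
      using emeasure_subadditive[of T lebesgue "U - T"] Tm U by (auto simp: Un_absorb1 fmeasurableD)
    also have "\<dots> < ennreal m + ennreal (m / \<theta> - m)"
      using U(4) Tm by (simp add: m_def emeasure_eq_measure2 ennreal_add_left_cancel_less)
    also have "\<dots> = ennreal (m / \<theta>)"
      using \<open>m > 0\<close> \<open>m / \<theta> - m > 0\<close> by (simp flip: ennreal_plus)
    finally have Ul: "emeasure lebesgue U < ennreal (m / \<theta>)" .
    define J where "J = {(x, s). x \<in> T \<and> 0 < s \<and> s \<le> 2 \<and> ball x s \<subseteq> U}"
    obtain C where C: "countable C" "C \<subseteq> J"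
      "pairwise (\<lambda>i j. disjnt (ball (fst i) (snd i)) (ball (fst j) (snd j))) C"
      "negligible (T - (\<Union>i\<in>C. ball (fst i) (snd i)))"
    proof (rule Vitali_covering_theorem_balls[of T J fst snd])
      fix x d :: "'a" and d' :: real
      assume x: "x \<in> T" and "0 < d'"
      obtain k where k: "k > 0" "ball x k \<subseteq> U" using U x openE by blast
      define s where "s = min (min k 2) (d' / 2)"
      have "ball x s \<subseteq> U" using k by (auto simp: s_def)
      moreover have "0 < s" "s \<le> 2" "s < d'" using k \<open>0 < d'\<close> by (auto simp: s_def)
      ultimately show "\<exists>i. i \<in> J \<and> x \<in> ball (fst i) (snd i) \<and> snd i < d'"
        using x by (intro exI[of _ "(x, s)"]) (auto simp: J_def)
    qed blast
    let ?B = "\<lambda>i. ball (fst i) (snd i)"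
    have disj: "disjoint_family_on ?B C"
      using C(3) by (auto simp: disjoint_family_on_def pairwise_def disjnt_def)
    have disjT: "disjoint_family_on (\<lambda>i. T \<inter> ?B i) C"
      using disj unfolding disjoint_family_on_def by blast
    have "emeasure lebesgue T \<le> emeasure lebesgue ((\<Union>i\<in>C. T \<inter> ?B i) \<union> (T - (\<Union>i\<in>C. ?B i)))"
    proof (rule emeasure_mono)
      show "(\<Union>i\<in>C. T \<inter> ?B i) \<union> (T - (\<Union>i\<in>C. ?B i)) \<in> sets lebesgue"
        using Tm C(1) by (intro sets.Un sets.Diff sets.countable_UN' sets.Int) auto
    qed auto
    also have "\<dots> = emeasure lebesgue (\<Union>i\<in>C. T \<inter> ?B i)"
      by (rule emeasure_Un_null_set)
        (use Tm C in \<open>auto intro!: sets.countable_UN' sets.Int simp: negligible_iff_null_sets\<close>)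
    also have "\<dots> = (\<integral>\<^sup>+i. emeasure lebesgue (T \<inter> ?B i) \<partial>count_space C)"
      by (rule emeasure_UN_countable)
        (use Tm C disjT in \<open>auto intro!: sets.Int\<close>)
    also have "\<dots> \<le> (\<integral>\<^sup>+i. ennreal \<theta> * emeasure lebesgue (?B i) \<partial>count_space C)"
    proof (rule nn_integral_mono)
      fix i assume "i \<in> space (count_space C)"
      then have i: "fst i \<in> T" "0 < snd i" "snd i \<le> 2" using C(2) by (auto simp: J_def)
      have "emeasure lebesgue (T \<inter> ?B i) \<le> emeasure lebesgue (E \<inter> ?B i)"
        using \<open>closed E\<close> by (intro emeasure_mono) (auto simp: T_def)
      also have "\<dots> \<le> ennreal \<theta> * emeasure lebesgue (?B i)"
        using i by (intro shrink) (auto simp: T_def)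
      finally show "emeasure lebesgue (T \<inter> ?B i) \<le> ennreal \<theta> * emeasure lebesgue (?B i)" .
    qed
    also have "\<dots> = ennreal \<theta> * (\<integral>\<^sup>+i. emeasure lebesgue (?B i) \<partial>count_space C)"
      by (rule nn_integral_cmult) auto
    also have "(\<integral>\<^sup>+i. emeasure lebesgue (?B i) \<partial>count_space C) = emeasure lebesgue (\<Union>i\<in>C. ?B i)"
      using C disj by (intro emeasure_UN_countable[symmetric]) auto
    also have "\<dots> \<le> emeasure lebesgue U"
    proof (rule emeasure_mono)
      show "(\<Union>i\<in>C. ?B i) \<subseteq> U" using C(2) unfolding J_def by fastforce
    qed (use U in simp)
    finally have "emeasure lebesgue T \<le> ennreal \<theta> * emeasure lebesgue U"
      by (simp add: mult_left_mono)
    also have "\<dots> < ennreal \<theta> * ennreal (m / \<theta>)"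
      using \<theta> Ul by (intro ennreal_mult_strict_left_mono) auto
    also have "\<dots> = ennreal m" using \<theta> \<open>m > 0\<close> by (simp flip: ennreal_mult)
    finally show False using Tm by (simp add: m_def emeasure_eq_measure2)
  qed
  then have "negligible (\<Union>n::nat. E \<inter> ball 0 n)" by (intro negligible_countable_Union) auto
  moreover have "(\<Union>n::nat. E \<inter> ball 0 n) = E"
    using reals_Archimedean2 by auto
  ultimately show ?thesis by simp
qed

context weierstrass_series
begin

text \<open>For short \<open>h\<close> the linear terms of \<open>A_approx\<close> at
  \<open>h\<close> and \<open>- h\<close> cancel; for long \<open>h\<close> boundedness of
  \<open>f\<close> suffices.\<close>

lemma zygmund: "f \<in> zygmund_class"
proof -
  define C where "C = max (2 * (b * (K' + 2 * F))) (4 * F)"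
  have "\<bar>f (x + h) + f (x - h) - 2 * f x\<bar> / norm h \<le> C" if "h \<noteq> 0" for x h
  proof (cases "norm h \<le> 1")
    case True
    have "\<bar>f (x + h) - f x - A x (norm h) \<bullet> h\<bar> \<le> b * (K' + 2 * F) * norm h"
      using A_approx[of "norm h" h 1 x] True that by simp
    moreover have "\<bar>f (x - h) - f x + A x (norm h) \<bullet> h\<bar> \<le> b * (K' + 2 * F) * norm h"
      using A_approx[of "norm h" "- h" 1 x] True that by simp
    ultimately have "\<bar>f (x + h) + f (x - h) - 2 * f x\<bar> \<le> 2 * (b * (K' + 2 * F)) * norm h"
      by linarith
    then have "\<bar>f (x + h) + f (x - h) - 2 * f x\<bar> / norm h \<le> 2 * (b * (K' + 2 * F))"
      using that by (simp add: divide_le_eq)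
    then show ?thesis unfolding C_def by linarith
  next
    case False
    have "\<bar>f (x + h) + f (x - h) - 2 * f x\<bar> \<le> 4 * F"
      using f_bound[of "x + h"] f_bound[of "x - h"] f_bound[of x] by linarith
    also have "\<dots> \<le> 4 * F * norm h" using False F_nonneg by (simp add: mult_le_cancel_left1)
    finally have "\<bar>f (x + h) + f (x - h) - 2 * f x\<bar> / norm h \<le> 4 * F"
      using that by (simp add: divide_le_eq)
    then show ?thesis unfolding C_def by linarith
  qed
  then have "bdd_above {\<bar>f (x + h) + f (x - h) - 2 * f x\<bar> / norm h | x h. h \<noteq> 0}"
    by (intro bdd_aboveI[of _ C]) auto
  moreover have "bounded (range f)" using f_bound by (auto simp: bounded_iff)
  ultimately show ?thesis using f_continuous by (simp add: zygmund_class_def)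
qed

text \<open>A derivative would force the slopes in direction \<open>u\<close> over all segments near
  \<open>x\<close> of length between \<open>\<kappa> * r\<close> and \<open>r\<close> to lie close
  to \<open>f' u\<close>, and gradient sums follow slopes up to \<open>C\<close>. A large drop
  between the scales \<open>r\<close> and \<open>\<kappa> * r\<close> rules this out.\<close>

lemma nowhere_differentiable: "\<not> f differentiable (at x)"
proof
  assume "f differentiable (at x)"
  then obtain f' where f': "(f has_derivative f') (at x)" by (auto simp: differentiable_def)
  then interpret bounded_linear f' by (rule has_derivative_bounded_linear)
  define C where "C = b * (K' + 2 * F)"
  obtain i :: 'n where True by simp
  define u where "u = axis i (1::real)"
  have u: "norm u = 1" by (simp add: u_def)
  \<comment> \<open>Differentiability allows a drop of at most \<open>2 * C + 2\<close>: an error of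
    1 and a comparison cost \<open>C\<close> for each of the two slopes.\<close>
  obtain \<kappa> where \<kappa>: "0 < \<kappa>" "\<kappa> \<le> 1" and drop:
    "\<And>u x r. \<lbrakk>norm u = 1; 0 < r; r \<le> 1\<rbrakk> \<Longrightarrow> \<exists>y. norm (y - x) \<le> r \<and> u \<bullet> A y (\<kappa> * r) \<le> u \<bullet> A x r - (2 * C + 3)"
    by (rule gradient_sum_drop[where H = "2 * C + 3"]) blast
  \<comment> \<open>The endpoints of the segment are within \<open>2 * r\<close> and
    \<open>r\<close> of \<open>x\<close>, so accuracy \<open>\<kappa> / 3\<close> gives total error
    \<open>\<kappa> * r\<close>, at most the length of the segment.\<close>
  have "\<kappa> / 3 > 0" using \<kappa> by simp
  with f' obtain d where "d > 0" and
    d': "\<forall>y. norm (y - x) < d \<longrightarrow> norm (f y - f x - f' (y - x)) \<le> \<kappa> / 3 * norm (y - x)"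
    unfolding has_derivative_at_alt by blast
  have d: "\<bar>f y - f x - f' (y - x)\<bar> \<le> \<kappa> / 3 * norm (y - x)" if "norm (y - x) < d" for y
    using d' that by simp
  define r where "r = min 1 (d / 4)"
  have r: "0 < r" "r \<le> 1" "3 * r < d" using \<open>d > 0\<close> by (auto simp: r_def)
  obtain y where y: "norm (y - x) \<le> r" and le: "u \<bullet> A y (\<kappa> * r) \<le> u \<bullet> A x r - (2 * C + 3)"
    using drop[OF u r(1,2)] by blast
  have kr: "0 < \<kappa> * r" "\<kappa> * r \<le> 1" "\<kappa> * r \<le> r" using \<kappa> r by (auto simp: mult_le_one)
  have q: "\<bar>(f (z + l *\<^sub>R u) - f z) / l - f' u\<bar> \<le> 1"
    if z: "norm (z - x) \<le> r" and l: "\<kappa> * r \<le> l" "l \<le> r" "0 < l" for z l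
  proof -
    have n: "norm (z + l *\<^sub>R u - x) \<le> 2 * r"
      using norm_triangle_ineq[of "z - x" "l *\<^sub>R u"] z l u by (simp add: algebra_simps)
    have "\<kappa> / 3 * norm (z + l *\<^sub>R u - x) \<le> \<kappa> / 3 * (2 * r)" "\<kappa> / 3 * norm (z - x) \<le> \<kappa> / 3 * r"
      using n z \<kappa> by (auto intro!: mult_left_mono)
    moreover have "\<bar>f (z + l *\<^sub>R u) - f x - f' (z + l *\<^sub>R u - x)\<bar> \<le> \<kappa> / 3 * norm (z + l *\<^sub>R u - x)"
      using n r by (intro d) simp
    moreover have "\<bar>f z - f x - f' (z - x)\<bar> \<le> \<kappa> / 3 * norm (z - x)"
      using z r by (intro d) simp
    moreover have "f' (z + l *\<^sub>R u - x) - f' (z - x) = l * f' u"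
      by (simp add: add diff scaleR)
    ultimately have "\<bar>f (z + l *\<^sub>R u) - f z - l * f' u\<bar> \<le> \<kappa> * r" by linarith
    then have "\<bar>f (z + l *\<^sub>R u) - f z - l * f' u\<bar> \<le> l" using l by linarith
    moreover have "(f (z + l *\<^sub>R u) - f z) / l - f' u = (f (z + l *\<^sub>R u) - f z - l * f' u) / l"
      using l by (simp add: diff_divide_distrib)
    ultimately show ?thesis using l by (simp add: abs_divide divide_le_eq)
  qed
  have "\<bar>(f (y + (\<kappa> * r) *\<^sub>R u) - f y) / (\<kappa> * r) - f' u\<bar> \<le> 1" using kr by (intro q y) auto
  moreover have "\<bar>(f (x + r *\<^sub>R u) - f x) / r - f' u\<bar> \<le> 1" using kr r by (intro q) auto
  moreover have "\<bar>(f (y + (\<kappa> * r) *\<^sub>R u) - f y) / (\<kappa> * r) - u \<bullet> A y (\<kappa> * r)\<bar> \<le> C"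
    unfolding C_def by (rule slope_approx[OF u kr(1,2)])
  moreover have "\<bar>(f (x + r *\<^sub>R u) - f x) / r - u \<bullet> A x r\<bar> \<le> C"
    unfolding C_def by (rule slope_approx[OF u r(1,2)])
  ultimately show False using le by linarith
qed

text \<open>By \<open>zoom\<close> with increment \<open>e\<close>, the rescaled difference quotient
  determines \<open>S N x \<bullet> e\<close> up to a constant; the finitely many early sums are
  bounded trivially. A natural number as bound yields a countable union of closed sets.\<close>

lemma dir_lip_points_bounded_sum:
  assumes e: "norm e = 1" and x: "x \<in> dir_lip_points f e"
  shows "\<exists>M::nat. \<forall>N. \<bar>S N x \<bullet> e\<bar> \<le> M"
proof -
  obtain c where c: "\<forall>\<^sub>F t in at 0. \<bar>f (x + t *\<^sub>R e) - f x\<bar> / \<bar>t\<bar> \<le> c"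
    using x by (auto simp: dir_lip_points_iff)
  have "filterlim (\<lambda>N. 1 / b ^ N) (at 0) sequentially"
    using inverse_powers_tendsto[of 1] b_nonzero by (simp add: filterlim_at)
  then have "\<forall>\<^sub>F N in sequentially. \<bar>f (x + (1 / b ^ N) *\<^sub>R e) - f x\<bar> / \<bar>1 / b ^ N\<bar> \<le> c"
    using c unfolding filterlim_iff by blast
  then obtain N0 where N0: "\<And>N. N \<ge> N0 \<Longrightarrow> \<bar>f (x + (1 / b ^ N) *\<^sub>R e) - f x\<bar> / \<bar>1 / b ^ N\<bar> \<le> c"
    by (auto simp: eventually_sequentially)
  have large: "\<bar>S N x \<bullet> e\<bar> \<le> c + K' + 2 * F" if "N \<ge> N0" for N
  proof -
    have "\<bar>b ^ N * (f (x + e /\<^sub>R b ^ N) - f x)\<bar> \<le> c"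
      using N0[OF that] b_pow_pos[of N] by (simp add: abs_mult divide_inverse mult.commute)
    moreover have "\<bar>b ^ N * (f (x + e /\<^sub>R b ^ N) - f x) - S N x \<bullet> e - (f (b ^ N *\<^sub>R x + e) - f (b ^ N *\<^sub>R x))\<bar> \<le> K'"
      using zoom[of N x e] e by simp
    ultimately show ?thesis using f_bound[of "b ^ N *\<^sub>R x + e"] f_bound[of "b ^ N *\<^sub>R x"] by linarith
  qed
  have small: "\<bar>S N x \<bullet> e\<bar> \<le> K * N0" if "N \<le> N0" for N
  proof -
    have "norm (S N x) \<le> K * N" using S_diff[of 0 N x] by (simp add: S_def)
    also have "\<dots> \<le> K * N0" using that K_nonneg by (intro mult_left_mono) auto
    finally show ?thesis using Cauchy_Schwarz_ineq2[of "S N x" e] e by simp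
  qed
  obtain M :: nat where "\<bar>c + K' + 2 * F\<bar> + \<bar>K * N0\<bar> \<le> M" using real_arch_simple by blast
  then have "\<bar>S N x \<bullet> e\<bar> \<le> M" for N using large[of N] small[of N] by (cases "N \<ge> N0") linarith+
  then show ?thesis by blast
qed

text \<open>The set is porous: near any of its points the sum can be pushed below \<open>- M\<close>
  at a smaller scale, and by stability it stays there on a whole ball of that scale.\<close>

lemma negligible_bounded_sum:
  assumes e: "norm e = 1"
  shows "negligible {x. \<forall>N. \<bar>S N x \<bullet> e\<bar> \<le> M}" (is "negligible ?E")
proof -
  obtain C where C: "C \<ge> 0"
    "\<And>x y r r'. \<lbrakk>0 < r'; r' \<le> r; r \<le> 1; r \<le> 1 * r'; norm (x - y) \<le> 1 * r\<rbrakk>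
       \<Longrightarrow> norm (A x r - A y r') \<le> C"
    by (rule A_stable[of 1, OF order_refl]) blast
  \<comment> \<open>\<open>2 * M\<close> carries the sum from at most \<open>M\<close> to
    \<open>- M\<close>, \<open>C\<close> is lost between the centre of the hole and its other
    points, and 1 makes the inequality strict.\<close>
  obtain \<kappa> where \<kappa>: "0 < \<kappa>" "\<kappa> \<le> 1" and drop:
    "\<And>u x r. \<lbrakk>norm u = 1; 0 < r; r \<le> 1\<rbrakk> \<Longrightarrow> \<exists>y. norm (y - x) \<le> r \<and> u \<bullet> A y (\<kappa> * r) \<le> u \<bullet> A x r - (2 * M + C + 1)"
    by (rule gradient_sum_drop[where H = "2 * M + C + 1"]) blast
  show ?thesis
  proof (rule porous_imp_negligible[OF _ \<kappa>])
    have cont: "continuous_on UNIV (S N)" for N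
    proof (rule continuous_onI)
      fix x :: "real ^ 'n" and \<epsilon> :: real assume "0 < \<epsilon>"
      have p: "K' * b ^ N + 1 > 0" using K'_nonneg b_pow_pos[of N] by (intro add_nonneg_pos) auto
      show "\<exists>d>0. \<forall>x'\<in>UNIV. dist x' x < d \<longrightarrow> dist (S N x') (S N x) \<le> \<epsilon>"
      proof (intro exI conjI ballI impI)
        show "\<epsilon> / (K' * b ^ N + 1) > 0" using \<open>0 < \<epsilon>\<close> p by simp
        fix x' assume "dist x' x < \<epsilon> / (K' * b ^ N + 1)"
        then have "(K' * b ^ N + 1) * dist x' x < \<epsilon>" using p by (simp add: field_simps)
        moreover have "dist (S N x') (S N x) \<le> K' * (b ^ N * dist x' x)"
          using S_lipschitz[of N x' x] by (simp add: dist_norm)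
        ultimately show "dist (S N x') (S N x) \<le> \<epsilon>"
          using zero_le_dist[of x' x] unfolding distrib_right mult.assoc mult_1 by linarith
      qed
    qed
    have "closed {x. \<bar>S N x \<bullet> e\<bar> \<le> M}" for N
      by (intro closed_Collect_le continuous_intros cont)
    then show "closed ?E" by (simp add: closed_Collect_all)
    fix x and r :: real assume x: "x \<in> ?E" and r: "0 < r" "r \<le> 1"
    obtain y where y: "norm (y - x) \<le> r" "e \<bullet> A y (\<kappa> * r) \<le> e \<bullet> A x r - (2 * M + C + 1)"
      using drop[OF e r] by blast
    have kr: "0 < \<kappa> * r" "\<kappa> * r \<le> 1" using \<kappa> r by (auto simp: mult_le_one)
    have "z \<notin> ?E" if z: "z \<in> ball y (\<kappa> * r)" for z
    proof
      assume "z \<in> ?E"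
      then have "\<bar>e \<bullet> A z (\<kappa> * r)\<bar> \<le> M" by (simp add: A_def inner_commute)
      moreover have "\<bar>e \<bullet> A x r\<bar> \<le> M" using x by (simp add: A_def inner_commute)
      moreover have "norm (A y (\<kappa> * r) - A z (\<kappa> * r)) \<le> C"
        using z kr by (intro C(2)) (auto simp: dist_norm)
      then have "\<bar>e \<bullet> A y (\<kappa> * r) - e \<bullet> A z (\<kappa> * r)\<bar> \<le> C"
        using Cauchy_Schwarz_ineq2[of e "A y (\<kappa> * r) - A z (\<kappa> * r)"] e by (simp add: inner_diff_right)
      ultimately show False using y(2) by linarith
    qed
    then show "\<exists>y. norm (y - x) \<le> r \<and> ball y (\<kappa> * r) \<inter> ?E = {}" using y(1) by blast
  qed
qed

lemma null_dir_lip_points: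
  assumes "norm e = 1" shows "dir_lip_points f e \<in> null_sets lebesgue"
proof -
  have "negligible (\<Union>M::nat. {x. \<forall>N. \<bar>S N x \<bullet> e\<bar> \<le> M})"
    by (intro negligible_countable_Union) (auto intro!: negligible_bounded_sum assms)
  then have "negligible (dir_lip_points f e)"
    by (rule negligible_subset) (use dir_lip_points_bounded_sum[OF assms] in blast)
  then show ?thesis by (simp add: negligible_iff_null_sets)
qed

lemma null_lip_points: "lip_points f \<in> null_sets lebesgue"
proof -
  obtain i :: 'n where True by simp
  have "norm (axis i (1::real)) = 1" by simp
  then show ?thesis
    using null_dir_lip_points[of "axis i 1"] lip_points_subset_dir_lip_points[of "axis i 1" f]
    by (simp add: negligible_subset flip: negligible_iff_null_sets)
qed

lemma lip_pointsI:
  assumes "\<And>r. \<lbrakk>0 < r; r \<le> 1\<rbrakk> \<Longrightarrow> norm (A x r) \<le> M"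
  shows "x \<in> lip_points f"
proof -
  have "\<bar>f (x + h) - f x\<bar> / norm h \<le> M + b * (K' + 2 * F)" if "h \<noteq> 0" "norm h \<le> 1" for h
  proof -
    have "\<bar>f (x + h) - f x - A x (norm h) \<bullet> h\<bar> \<le> b * (K' + 2 * F) * norm h"
      using A_approx[of "norm h" h 1 x] that by simp
    moreover have "\<bar>A x (norm h) \<bullet> h\<bar> \<le> M * norm h"
      using assms[of "norm h"] that by (intro order_trans[OF Cauchy_Schwarz_ineq2] mult_right_mono) auto
    ultimately have "\<bar>f (x + h) - f x\<bar> \<le> (M + b * (K' + 2 * F)) * norm h"
      unfolding distrib_right by linarith
    then show ?thesis using that by (simp add: divide_le_eq)
  qed
  then have "\<forall>\<^sub>F h in at 0. \<bar>f (x + h) - f x\<bar> / norm h \<le> M + b * (K' + 2 * F)"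
    unfolding eventually_at by (intro exI[of _ 1]) auto
  then show ?thesis by (auto simp: lip_points_iff)
qed

end

section \<open>Hausdorff dimension of cube trees\<close>

definition grid :: "nat \<Rightarrow> ('n \<Rightarrow> nat) set" where "grid n = {k. \<forall>i. k i < n}"

definition vec_of :: "('n \<Rightarrow> nat) \<Rightarrow> real ^ 'n" where "vec_of k = (\<chi> i. real (k i))"

lemma choices_eq_PiE: "{k :: 'n \<Rightarrow> 'a. \<forall>i. k i \<in> S i} = Pi\<^sub>E UNIV S"
  by (auto simp: PiE_def Pi_def extensional_def)

lemma finite_choices: "(\<And>i. finite (S i)) \<Longrightarrow> finite {k :: 'n::finite \<Rightarrow> 'a. \<forall>i. k i \<in> S i}"
  unfolding choices_eq_PiE by (intro finite_PiE) auto

lemma card_choices: "card {k :: 'n::finite \<Rightarrow> 'a. \<forall>i. k i \<in> S i} = (\<Prod>i\<in>UNIV. card (S i))"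
  unfolding choices_eq_PiE by (intro card_PiE) auto

lemma finite_grid: "finite (grid n :: ('n::finite \<Rightarrow> nat) set)"
  and card_grid: "card (grid n :: ('n::finite \<Rightarrow> nat) set) = n ^ CARD('n)"
  using finite_choices[of "\<lambda>_::'n. {..<n}"] card_choices[of "\<lambda>_::'n. {..<n}"]
  by (simp_all add: grid_def)

lemma grid_combine_inj:
  assumes "k \<in> grid m" "k' \<in> grid m" "(\<lambda>i. m * j i + k i) = (\<lambda>i. m * j' i + k' i)"
  shows "j = j'" and "k = k'"
proof -
  have eq: "m * j i + k i = m * j' i + k' i" for i using assms(3) by (rule fun_cong)
  have lt: "k i < m" "k' i < m" for i using assms by (auto simp: grid_def)
  have "(m * j i + k i) div m = j i" "(m * j' i + k' i) div m = j' i" for i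
    using lt[of i] by simp_all
  then show "j = j'" using eq by (metis ext)
  then show "k = k'" using eq by auto
qed

text \<open>Prepares the replacement of covering sets by open balls: the radius must exceed the
  diameter, also when that is 0, while the sum of powers grows by as little as desired.\<close>

lemma diam_power_enlarge:
  assumes "bounded U" "U \<noteq> {}" "s \<ge> 0" "diameter U < L" "\<eta> > 0"
  obtains d where "diameter U < d" "d < L" "ennreal (d powr s) \<le> diam_power s U + ennreal \<eta>"
proof (cases "s = 0")
  case True
  obtain d where "diameter U < d" "d < L" using dense[OF assms(4)] by blast
  moreover from this have "d > 0" using diameter_ge_0[OF assms(1)] by linarith
  ultimately show ?thesis using True assms that[of d] by (simp add: diam_power_def)
next
  case False
  let ?D = "diameter U"
  have D: "?D \<ge> 0" using assms by (simp add: diameter_ge_0)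
  have "((\<lambda>d. d powr s) \<longlongrightarrow> ?D powr s) (at_right ?D)"
  proof (rule tendsto_powr')
    have "\<forall>\<^sub>F d in at_right ?D. d > ?D" by (rule eventually_at_right_less)
    then have "\<forall>\<^sub>F d in at_right ?D. d \<ge> 0" by eventually_elim (use D in simp)
    then show "?D \<noteq> 0 \<or> 0 < s \<and> (\<forall>\<^sub>F d in at_right ?D. 0 \<le> d)" using False assms by simp
  qed (auto intro: tendsto_intros)
  then have "\<forall>\<^sub>F d in at_right ?D. d powr s < ?D powr s + \<eta>"
    using assms by (intro order_tendstoD(2)) auto
  moreover have "\<forall>\<^sub>F d in at_right ?D. d \<in> {?D<..<L}"
    by (rule eventually_at_right_real[OF assms(4)])
  ultimately have "\<forall>\<^sub>F d in at_right ?D. d powr s < ?D powr s + \<eta> \<and> d \<in> {?D<..<L}"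
    by eventually_elim auto
  then obtain d where d: "d powr s < ?D powr s + \<eta>" "d \<in> {?D<..<L}"
    using eventually_happens trivial_limit_at_right_real by blast
  have "ennreal (d powr s) \<le> ennreal (?D powr s + \<eta>)" using d by (intro ennreal_leI) simp
  also have "\<dots> = diam_power s U + ennreal \<eta>"
    using assms False by (simp add: diam_power_def)
  finally show ?thesis using that d by auto
qed

locale cube_tree =
  fixes x0 :: "real ^ 'n" and l0 :: real and m M :: nat and P :: "nat \<Rightarrow> ('n \<Rightarrow> nat) \<Rightarrow> bool"
  assumes l0: "l0 > 0" and m: "m \<ge> 2" and M: "M > 0"
    and root: "P 0 (\<lambda>_. 0)"
    and branch: "\<And>n j. P n j \<Longrightarrow> card {k \<in> grid m. P (Suc n) (\<lambda>i. m * j i + k i)} \<ge> M"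
begin

definition cell :: "nat \<Rightarrow> ('n \<Rightarrow> nat) \<Rightarrow> (real ^ 'n) set" where
  "cell n j = {x. \<forall>i. x0 $ i + l0 / m ^ n * j i \<le> x $ i \<and> x $ i \<le> x0 $ i + l0 / m ^ n * (j i + 1)}"

text \<open>Exactly \<open>M\<close> of the admissible subcubes: the counting argument needs the
  total number of nodes from below and the number of descendants of one cube from above, with the
  same power of \<open>M\<close>.\<close>

definition children :: "nat \<Rightarrow> ('n \<Rightarrow> nat) \<Rightarrow> ('n \<Rightarrow> nat) set" where
  "children n j = (SOME C. C \<subseteq> {k \<in> grid m. P (Suc n) (\<lambda>i. m * j i + k i)} \<and> card C = M)"

primrec nodes :: "nat \<Rightarrow> ('n \<Rightarrow> nat) set" where
  "nodes 0 = {\<lambda>_. 0}"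
| "nodes (Suc n) = (\<lambda>(j, k) i. m * j i + k i) ` Sigma (nodes n) (children n)"

lemma children:
  assumes "P n j"
  shows "children n j \<subseteq> {k \<in> grid m. P (Suc n) (\<lambda>i. m * j i + k i)}" "card (children n j) = M"
    "finite (children n j)"
proof -
  obtain C where "C \<subseteq> {k \<in> grid m. P (Suc n) (\<lambda>i. m * j i + k i)} \<and> card C = M"
    using obtain_subset_with_card_n[OF branch[OF assms]] by metis
  then have *: "children n j \<subseteq> {k \<in> grid m. P (Suc n) (\<lambda>i. m * j i + k i)} \<and> card (children n j) = M"
    unfolding children_def by (rule someI)
  show "children n j \<subseteq> {k \<in> grid m. P (Suc n) (\<lambda>i. m * j i + k i)}" "card (children n j) = M"
    using * by auto
  show "finite (children n j)" using * M by (intro card_ge_0_finite) simp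
qed

lemma nodes_P: "j \<in> nodes n \<Longrightarrow> P n j"
proof (induction n arbitrary: j)
  case (Suc n)
  then show ?case using children(1) by fastforce
qed (use root in simp)

lemma children_grid: "j \<in> nodes n \<Longrightarrow> k \<in> children n j \<Longrightarrow> k \<in> grid m"
  using children(1)[OF nodes_P] by blast

lemma finite_nodes: "finite (nodes n)"
  by (induction n) (auto intro!: finite_SigmaI children(3) nodes_P)

lemma card_nodes: "card (nodes n) = M ^ n"
proof (induction n)
  case (Suc n)
  have "inj_on (\<lambda>(j, k) i. m * j i + k i) (Sigma (nodes n) (children n))"
  proof (rule inj_onI, clarsimp)
    fix j k j' k'
    assume "j \<in> nodes n" "k \<in> children n j" "j' \<in> nodes n" "k' \<in> children n j'"
      and eq: "(\<lambda>i. m * j i + k i) = (\<lambda>i. m * j' i + k' i)"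
    then have "k \<in> grid m" "k' \<in> grid m" using children_grid by blast+
    from grid_combine_inj[OF this eq] show "j = j' \<and> k = k'" by simp
  qed
  then have "card (nodes (Suc n)) = card (Sigma (nodes n) (children n))"
    by (simp add: card_image)
  also have "\<dots> = (\<Sum>j\<in>nodes n. card (children n j))"
    using finite_nodes children(3)[OF nodes_P] by (intro card_SigmaI) auto
  also have "\<dots> = (\<Sum>j\<in>nodes n. M)" by (intro sum.cong refl children(2) nodes_P)
  finally show ?case using Suc by simp
qed simp

text \<open>Indices are base-\<open>m\<close> expansions in each coordinate, so division by
  \<open>m ^ r\<close> returns the ancestor \<open>r\<close> generations earlier.\<close>

lemma card_descendants:
  "card {j \<in> nodes (n + r). (\<lambda>i. j i div m ^ r) = a} \<le> M ^ r"
proof (induction r)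
  case 0
  have "{j \<in> nodes n. j = a} \<subseteq> {a}" by auto
  then have "card {j \<in> nodes n. j = a} \<le> card {a}" by (intro card_mono) auto
  then show ?case by simp
next
  case (Suc r)
  let ?D = "{j \<in> nodes (n + r). (\<lambda>i. j i div m ^ r) = a}"
  have sub: "{j \<in> nodes (n + Suc r). (\<lambda>i. j i div m ^ Suc r) = a}
    \<subseteq> (\<lambda>(j, k) i. m * j i + k i) ` Sigma ?D (children (n + r))"
  proof
    fix c assume c: "c \<in> {j \<in> nodes (n + Suc r). (\<lambda>i. j i div m ^ Suc r) = a}"
    then obtain j k where jk: "j \<in> nodes (n + r)" "k \<in> children (n + r) j" "c = (\<lambda>i. m * j i + k i)"
      by auto
    have "k \<in> grid m" using children_grid jk by blast
    then have "c i div m = j i" for i using jk(3) m by (simp add: grid_def)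
    then have "c i div m ^ Suc r = j i div m ^ r" for i by (simp add: div_mult2_eq)
    then have "j \<in> ?D" using c jk by auto
    then show "c \<in> (\<lambda>(j, k) i. m * j i + k i) ` Sigma ?D (children (n + r))" using jk by auto
  qed
  have fin: "finite (Sigma ?D (children (n + r)))"
    using finite_nodes children(3)[OF nodes_P] by (intro finite_SigmaI) auto
  have "card {j \<in> nodes (n + Suc r). (\<lambda>i. j i div m ^ Suc r) = a} \<le> card (Sigma ?D (children (n + r)))"
    by (rule order_trans[OF card_mono[OF _ sub] card_image_le]) (use fin in auto)
  also have "\<dots> = (\<Sum>j\<in>?D. card (children (n + r) j))"
    using finite_nodes children(3)[OF nodes_P] by (intro card_SigmaI) auto
  also have "\<dots> = (\<Sum>j\<in>?D. M)" by (intro sum.cong refl children(2) nodes_P) auto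
  also have "\<dots> \<le> M ^ r * M" using Suc by simp
  finally show ?case by (simp add: mult.commute)
qed

definition level_set :: "nat \<Rightarrow> (real ^ 'n) set" where "level_set n = (\<Union>j\<in>nodes n. cell n j)"

lemma cell_eq_cbox:
  "cell n j = cbox (x0 + (l0 / m ^ n) *\<^sub>R vec_of j) (x0 + (l0 / m ^ n) *\<^sub>R (vec_of j + vec 1))"
  by (auto simp: cell_def mem_box_cart vec_of_def add.commute)

lemma corner_in_cell: "x0 + (l0 / m ^ n) *\<^sub>R vec_of j \<in> cell n j"
  using l0 m by (auto simp: cell_def vec_of_def intro!: divide_right_mono mult_left_mono)

lemma compact_level_set: "compact (level_set n)"
  unfolding level_set_def cell_eq_cbox by (intro compact_UN finite_nodes) auto

lemma level_set_Suc: "level_set (Suc n) \<subseteq> level_set n"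
proof
  fix x assume "x \<in> level_set (Suc n)"
  then obtain j k where jk: "j \<in> nodes n" "k \<in> children n j" and x: "x \<in> cell (Suc n) (\<lambda>i. m * j i + k i)"
    by (auto simp: level_set_def)
  have k: "k i < m" for i using children_grid[OF jk] by (simp add: grid_def)
  have "x \<in> cell n j"
    unfolding cell_def
  proof (intro CollectI allI conjI)
    fix i
    have "real (k i) + 1 \<le> m" using k[of i] by linarith
    define w where "w = l0 / m ^ Suc n"
    have "w > 0" using l0 m by (simp add: w_def)
    have wm: "l0 / m ^ n = w * m" using m by (simp add: w_def)
    have lo: "x0 $ i + w * (m * j i + k i) \<le> x $ i" and hi: "x $ i \<le> x0 $ i + w * (m * j i + k i + 1)"
      using x by (auto simp: cell_def w_def)
    have "w * (real m * real (j i)) \<le> w * (m * j i + k i)" using \<open>w > 0\<close> by (intro mult_left_mono) auto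
    then show "x0 $ i + l0 / m ^ n * j i \<le> x $ i" using lo unfolding wm by (simp add: mult.assoc)
    have "w * (m * j i + k i + 1) \<le> w * (real m * (real (j i) + 1))"
      using \<open>w > 0\<close> \<open>real (k i) + 1 \<le> m\<close> by (intro mult_left_mono) (auto simp: algebra_simps)
    then show "x $ i \<le> x0 $ i + l0 / m ^ n * (j i + 1)" using hi unfolding wm by (simp add: mult.assoc add.commute)
  qed
  then show "x \<in> level_set n" using jk by (auto simp: level_set_def)
qed

lemma level_set_antimono: "n \<le> n' \<Longrightarrow> level_set n' \<subseteq> level_set n"
  by (rule lift_Suc_antimono_le[of level_set]) (rule level_set_Suc)

text \<open>A ball whose diameter is at most the side of the cubes of generation \<open>n\<close>
  meets at most two candidate positions in each coordinate, so the corners inside it have at most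
  \<open>2 ^ CARD('n)\<close> ancestors in that generation.\<close>

lemma card_nodes_near:
  assumes "n \<le> N" and d: "2 * d \<le> l0 / m ^ n"
  shows "card {j \<in> nodes N. x0 + (l0 / m ^ N) *\<^sub>R vec_of j \<in> ball z d} \<le> 2 ^ CARD('n) * M ^ (N - n)"
proof -
  define r where "r = N - n"
  have N: "N = n + r" using assms by (simp add: r_def)
  \<comment> \<open>In rescaled coordinates a corner lies within 1/2 of \<open>z\<close>, and its
    ancestor index is less than 1 below the corner. So the index lies in an open interval of length
    2 starting at \<open>z - 3 / 2\<close>, which leaves \<open>p + 1\<close> and
    \<open>p + 2\<close>.\<close>
  define p where "p i = \<lfloor>(z $ i - x0 $ i) * m ^ n / l0 - 3 / 2\<rfloor>" for i
  define S where "S i = {nat (p i + 1), nat (p i + 2)}" for i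
  let ?anc = "{a. \<forall>i. a i \<in> S i}"
  let ?near = "{j \<in> nodes N. x0 + (l0 / m ^ N) *\<^sub>R vec_of j \<in> ball z d}"
  have fin: "finite ?anc" by (rule finite_choices) (simp add: S_def)
  have "card (S i) \<le> 2" for i unfolding S_def by (rule card_insert_le_m1) auto
  then have cardS: "card ?anc \<le> 2 ^ CARD('n)"
    using prod_le_power[of UNIV "\<lambda>i. card (S i)" 2] by (subst card_choices) (auto simp: S_def)
  have "?near \<subseteq> (\<Union>a\<in>?anc. {j \<in> nodes (n + r). (\<lambda>i. j i div m ^ r) = a})"
  proof
    fix j assume j: "j \<in> ?near"
    have "j i div m ^ r \<in> S i" for i
    proof -
      let ?v = "real (j i) / m ^ r" and ?z = "(z $ i - x0 $ i) * m ^ n / l0"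
      have "\<bar>(z - (x0 + (l0 / m ^ N) *\<^sub>R vec_of j)) $ i\<bar> < d"
        using j component_le_norm_cart[of "z - (x0 + (l0 / m ^ N) *\<^sub>R vec_of j)" i]
        by (auto simp: dist_norm)
      then have "\<bar>z $ i - x0 $ i - l0 / m ^ N * j i\<bar> < d" by (simp add: vec_of_def)
      then have "\<bar>z $ i - x0 $ i - l0 / m ^ N * j i\<bar> * (m ^ n / l0) < d * (m ^ n / l0)"
        using l0 m by (intro mult_strict_right_mono) auto
      also have "d * (m ^ n / l0) \<le> 1 / 2" using d l0 m by (simp add: field_simps)
      also have "\<bar>z $ i - x0 $ i - l0 / m ^ N * j i\<bar> * (m ^ n / l0) = \<bar>(z $ i - x0 $ i - l0 / m ^ N * j i) * (m ^ n / l0)\<bar>"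
        using l0 by (simp add: abs_mult)
      also have "(z $ i - x0 $ i - l0 / m ^ N * j i) * (m ^ n / l0) = ?z - ?v"
        using l0 m by (simp add: N power_add field_simps)
      finally have zv: "\<bar>?z - ?v\<bar> < 1 / 2" .
      define q where "q = j i div m ^ r"
      have "q \<le> ?v" "?v < real q + 1"
      proof -
        have "q * m ^ r \<le> j i" unfolding q_def by (rule div_times_less_eq_dividend)
        then have "real q * m ^ r \<le> j i" by (metis of_nat_le_iff of_nat_mult of_nat_power)
        then show "q \<le> ?v" using m by (simp add: field_simps)
        have "j i < (q + 1) * m ^ r" unfolding q_def using m dividend_less_div_times[of "m ^ r" "j i"]
          by (simp add: algebra_simps)
        then have "real (j i) < (real q + 1) * m ^ r"
          by (metis of_nat_less_iff of_nat_mult of_nat_power of_nat_add of_nat_1)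
        then show "?v < real q + 1" using m by (simp add: field_simps)
      qed
      then have "real q > ?z - 3 / 2" "real q < (?z - 3 / 2) + 2" using zv by linarith+
      then have "int q \<ge> p i + 1" "int q \<le> p i + 2" unfolding p_def by linarith+
      then have "q = nat (p i + 1) \<or> q = nat (p i + 2)" by linarith
      then show ?thesis by (simp add: S_def q_def)
    qed
    then show "j \<in> (\<Union>a\<in>?anc. {j \<in> nodes (n + r). (\<lambda>i. j i div m ^ r) = a})"
      using j by (auto simp: N)
  qed
  then have "card ?near \<le> card (\<Union>a\<in>?anc. {j \<in> nodes (n + r). (\<lambda>i. j i div m ^ r) = a})"
    using fin finite_nodes by (intro card_mono) auto
  also have "\<dots> \<le> (\<Sum>a\<in>?anc. card {j \<in> nodes (n + r). (\<lambda>i. j i div m ^ r) = a})"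
    by (rule card_UN_le[OF fin])
  also have "\<dots> \<le> (\<Sum>a\<in>?anc. M ^ r)" by (intro sum_mono card_descendants)
  also have "\<dots> \<le> 2 ^ CARD('n) * M ^ r" using cardS by simp
  finally show ?thesis by (simp add: r_def)
qed

lemma level_exists:
  assumes "0 < t" "t \<le> l0"
  obtains n where "t \<le> l0 / m ^ n" "l0 / m ^ Suc n < t"
proof -
  have m1: "real m > 1" using m by simp
  have "\<exists>n. l0 / m ^ n < t"
  proof -
    obtain n where "l0 / t < real m ^ n" using real_arch_pow[OF m1] by blast
    then show ?thesis using assms m by (intro exI[of _ n]) (simp add: field_simps)
  qed
  then obtain n where n: "l0 / m ^ n < t" and least: "\<And>k. k < n \<Longrightarrow> \<not> l0 / m ^ k < t"
    using exists_least_iff[of "\<lambda>n. l0 / m ^ n < t"] by blast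
  have "n \<noteq> 0" using n assms by (cases n) auto
  then obtain k where "n = Suc k" using not0_implies_Suc by blast
  then show ?thesis using n least[of k] by (intro that[of k]) auto
qed

text \<open>A covering of the limit set by balls yields, by compactness, a covering of the cells of some
  level; counting cells inside each ball then bounds the sum of the \<open>s\<close>-th powers from below.\<close>

lemma hausdorff_measure_limit_set:
  assumes s: "s \<ge> 0" and Ms: "real m powr s \<le> M" and A: "(\<Inter>n. level_set n) \<subseteq> A"
  shows "hausdorff_measure s A \<noteq> 0"
proof
  assume zero: "hausdorff_measure s A = 0"
  \<comment> \<open>Chosen so that the final count bounds 1 by \<open>1 / 2\<close>; half of the
    tolerated \<open>2 * \<eta>\<close> is spent on enlarging the covering sets.\<close>
  define \<eta> where "\<eta> = 1 / (4 * 2 ^ CARD('n) * (2 * real m / l0) powr s)"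
  have "\<eta> > 0" using l0 m by (simp add: \<eta>_def)
  have "Inf {(\<Sum>i. diam_power s (U i)) | U :: nat \<Rightarrow> (real ^ 'n) set.
        A \<subseteq> (\<Union>i. U i) \<and> (\<forall>i. bounded (U i) \<and> diameter (U i) \<le> l0 / 4)} \<le> hausdorff_measure s A"
    unfolding hausdorff_measure_def by (rule SUP_upper) (use l0 in simp)
  also have "\<dots> < ennreal \<eta>" using zero \<open>\<eta> > 0\<close> by simp
  finally obtain U :: "nat \<Rightarrow> (real ^ 'n) set" where
    U: "(\<Sum>i. diam_power s (U i)) < ennreal \<eta>" "A \<subseteq> (\<Union>i. U i)" "\<And>i. bounded (U i)"
      "\<And>i. diameter (U i) \<le> l0 / 4"
    unfolding Inf_less_iff by blast
  define I where "I = {i. U i \<noteq> {}}"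
  have "\<exists>d. diameter (U i) < d \<and> d < l0 / 2 \<and>
      ennreal (d powr s) \<le> diam_power s (U i) + ennreal (\<eta> * (1 / 2) ^ Suc i)" if "i \<in> I" for i
  proof -
    have "diameter (U i) < l0 / 2" using U(4)[of i] l0 by linarith
    moreover have "\<eta> * (1 / 2) ^ Suc i > 0" using \<open>\<eta> > 0\<close> by simp
    ultimately show ?thesis
      using diam_power_enlarge[OF U(3) _ s, of i "l0 / 2" "\<eta> * (1 / 2) ^ Suc i"] that
      unfolding I_def by blast
  qed
  then obtain d where d: "\<And>i. i \<in> I \<Longrightarrow> diameter (U i) < d i" "\<And>i. i \<in> I \<Longrightarrow> d i < l0 / 2"
     "\<And>i. i \<in> I \<Longrightarrow> ennreal (d i powr s) \<le> diam_power s (U i) + ennreal (\<eta> * (1 / 2) ^ Suc i)"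
    by metis
  have d0: "d i > 0" if "i \<in> I" for i using d(1)[OF that] diameter_ge_0[OF U(3)[of i]] by linarith
  have "\<exists>z. z \<in> U i" if "i \<in> I" for i using that by (auto simp: I_def)
  then obtain z where z: "\<And>i. i \<in> I \<Longrightarrow> z i \<in> U i" by metis
  define V where "V i = ball (z i) (d i)" for i
  have UV: "U i \<subseteq> V i" if "i \<in> I" for i
    unfolding V_def using diameter_bounded_bound[OF U(3) z[OF that]] d(1)[OF that] by fastforce
  have cover: "A \<subseteq> (\<Union>i\<in>I. V i)" using U(2) UV by (fastforce simp: I_def)
  define O' where "O' = (\<Union>i\<in>I. V i)"
  have "open O'" by (auto simp: O'_def V_def)
  have "\<exists>n. level_set n \<subseteq> O'"
  proof (rule ccontr)
    assume "\<not> ?thesis"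
    then have ne: "level_set n - O' \<noteq> {}" for n by blast
    have "(\<Inter>n. level_set n - O') \<noteq> {}"
    proof (rule compact_nest)
      show "compact (level_set n - O')" for n using compact_level_set \<open>open O'\<close> by (rule compact_diff)
      show "level_set n' - O' \<subseteq> level_set n - O'" if "n \<le> n'" for n n'
        using level_set_antimono[OF that] by blast
    qed (rule ne)
    then show False using A cover by (auto simp: O'_def)
  qed
  then obtain n where n: "level_set n \<subseteq> O'" ..
  obtain J where J: "J \<subseteq> I" "finite J" "level_set n \<subseteq> (\<Union>i\<in>J. V i)"
    by (rule compactE_image[OF compact_level_set, of I V n]) (use n in \<open>auto simp: O'_def V_def\<close>)
  have "\<exists>k. 2 * d i \<le> l0 / m ^ k \<and> l0 / m ^ Suc k < 2 * d i" if "i \<in> I" for i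
    using level_exists[of "2 * d i"] d0[OF that] d(2)[OF that] by (metis less_eq_real_def mult_2 field_sum_of_halves add_strict_mono mult_pos_pos zero_less_numeral)
  then obtain lv where lv: "\<And>i. i \<in> I \<Longrightarrow> 2 * d i \<le> l0 / m ^ lv i" "\<And>i. i \<in> I \<Longrightarrow> l0 / m ^ Suc (lv i) < 2 * d i"
    by metis
  \<comment> \<open>One generation that is finer than \<open>n\<close> and than all levels
    \<open>lv i\<close>, so that the same nodes can be counted in every ball.\<close>
  define N where "N = n + (\<Sum>i\<in>J. lv i)"
  have lvN: "lv i \<le> N" if "i \<in> J" for i
    unfolding N_def using member_le_sum[of i J lv] J that by simp
  let ?near = "\<lambda>i. {j \<in> nodes N. x0 + (l0 / m ^ N) *\<^sub>R vec_of j \<in> V i}"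
  have "nodes N \<subseteq> (\<Union>i\<in>J. ?near i)"
  proof
    fix j assume j: "j \<in> nodes N"
    then have "x0 + (l0 / m ^ N) *\<^sub>R vec_of j \<in> level_set N"
      using corner_in_cell by (auto simp: level_set_def)
    also have "\<dots> \<subseteq> level_set n" by (rule level_set_antimono) (simp add: N_def)
    finally show "j \<in> (\<Union>i\<in>J. ?near i)" using J j by auto
  qed
  then have "card (nodes N) \<le> card (\<Union>i\<in>J. ?near i)"
    using J finite_nodes by (intro card_mono) auto
  also have "\<dots> \<le> (\<Sum>i\<in>J. card (?near i))" using J by (intro card_UN_le)
  also have "\<dots> \<le> (\<Sum>i\<in>J. 2 ^ CARD('n) * M ^ (N - lv i))"
    unfolding V_def using J by (intro sum_mono card_nodes_near lvN lv(1)) auto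
  finally have "real (M ^ N) \<le> real (\<Sum>i\<in>J. 2 ^ CARD('n) * M ^ (N - lv i))"
    unfolding card_nodes of_nat_le_iff .
  also have "\<dots> = (\<Sum>i\<in>J. 2 ^ CARD('n) * real M ^ (N - lv i))" by simp
  also have "\<dots> \<le> (\<Sum>i\<in>J. 2 ^ CARD('n) * (real M ^ N * ((2 * real m / l0) powr s * d i powr s)))"
  proof (intro sum_mono mult_left_mono)
    fix i assume i: "i \<in> J"
    then have iI: "i \<in> I" using J by blast
    \<comment> \<open>The branching condition \<open>Ms\<close> enters here: the share
      \<open>1 / M ^ lv i\<close> of the nodes in one ball is at most the \<open>s\<close>-th power
      of a side comparable to \<open>d i\<close>.\<close>
    have "(real m powr s) ^ lv i \<le> real M ^ lv i" using Ms by (intro power_mono) auto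
    then have "1 / real M ^ lv i \<le> 1 / (real m powr s) ^ lv i"
      using m M by (intro divide_left_mono) auto
    also have "\<dots> = (1 / real m ^ lv i) powr s"
      using m by (simp add: powr_divide powr_powr powr_power mult.commute flip: powr_realpow)
    also have "\<dots> \<le> (2 * real m / l0 * d i) powr s"
    proof (rule powr_mono2[OF s])
      show "1 / real m ^ lv i \<le> 2 * real m / l0 * d i"
        using lv(2)[OF iI] l0 m by (simp add: field_simps)
    qed simp
    also have "\<dots> = (2 * real m / l0) powr s * d i powr s"
      by (rule powr_mult)
    finally have "real M ^ N * (1 / real M ^ lv i) \<le> real M ^ N * ((2 * real m / l0) powr s * d i powr s)"
      by (rule mult_left_mono) simp
    moreover have "real M ^ (N - lv i) = real M ^ N * (1 / real M ^ lv i)"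
      using M lvN[OF i] by (simp add: power_diff)
    ultimately show "real M ^ (N - lv i) \<le> real M ^ N * ((2 * real m / l0) powr s * d i powr s)" by simp
  qed simp
  also have "\<dots> = real M ^ N * (2 ^ CARD('n) * (2 * real m / l0) powr s * (\<Sum>i\<in>J. d i powr s))"
    unfolding sum_distrib_left by (intro sum.cong) (simp_all add: mult_ac)
  finally have big: "1 \<le> 2 ^ CARD('n) * (2 * real m / l0) powr s * (\<Sum>i\<in>J. d i powr s)"
    using M by (simp add: mult_le_cancel_left1)
  have "ennreal (\<Sum>i\<in>J. d i powr s) = (\<Sum>i\<in>J. ennreal (d i powr s))" by simp
  also have "\<dots> \<le> (\<Sum>i\<in>J. diam_power s (U i) + ennreal (\<eta> * (1 / 2) ^ Suc i))"
    using J by (intro sum_mono d(3)) auto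
  also have "\<dots> = (\<Sum>i\<in>J. diam_power s (U i)) + ennreal (\<Sum>i\<in>J. \<eta> * (1 / 2) ^ Suc i)"
    using \<open>\<eta> > 0\<close> by (simp add: sum.distrib)
  also have "\<dots> \<le> ennreal \<eta> + ennreal \<eta>"
  proof (rule add_mono)
    show "(\<Sum>i\<in>J. diam_power s (U i)) \<le> ennreal \<eta>"
      using sum_le_suminf[OF summableI J(2), of "\<lambda>i. diam_power s (U i)"] U(1) by auto
    have "(\<Sum>i\<in>J. (1 / 2 :: real) ^ Suc i) \<le> 1"
      using sum_le_suminf[OF sums_summable[OF power_half_series] J(2)] sums_unique[OF power_half_series] by simp
    then have "\<eta> * (\<Sum>i\<in>J. (1 / 2) ^ Suc i) \<le> \<eta> * 1" using \<open>\<eta> > 0\<close> by (intro mult_left_mono) auto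
    then show "ennreal (\<Sum>i\<in>J. \<eta> * (1 / 2) ^ Suc i) \<le> ennreal \<eta>"
      by (intro ennreal_leI) (simp only: sum_distrib_left mult_1_right)
  qed
  also have "\<dots> = ennreal (2 * \<eta>)" using \<open>\<eta> > 0\<close> by (simp flip: ennreal_plus)
  finally have "(\<Sum>i\<in>J. d i powr s) \<le> 2 * \<eta>" using \<open>\<eta> > 0\<close> by simp
  then have "2 ^ CARD('n) * (2 * real m / l0) powr s * (\<Sum>i\<in>J. d i powr s)
     \<le> 2 ^ CARD('n) * (2 * real m / l0) powr s * (2 * \<eta>)"
    by (intro mult_left_mono) auto
  also have "\<dots> = 1 / 2" using l0 m by (simp add: \<eta>_def)
  finally show False using big by simp
qed

end

text \<open>Dividing a surrounding cube into \<open>n ^ CARD('n)\<close> subcubes of side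
  \<open>L / n\<close> gives a sum of order \<open>n powr (CARD('n) - s)\<close>, which tends to
  0.\<close>

lemma hausdorff_measure_zero_above_dim:
  fixes A :: "(real ^ 'n) set" and s :: real
  assumes "bounded A" and s: "s > CARD('n)"
  shows "hausdorff_measure s A = 0"
proof -
  obtain R where R: "R > 0" "\<And>x. x \<in> A \<Longrightarrow> norm x \<le> R"
    using assms(1) unfolding bounded_pos by blast
  define L where "L = 2 * R"
  define a :: "real ^ 'n" where "a = vec (- R)"
  let ?d = "CARD('n)"
  \<comment> \<open>The finitely many subcubes are enumerated through \<open>from_nat_into\<close>
    and followed by empty sets, which contribute 0.\<close>
  define U where "U n i = (if i < n ^ ?d then {x. \<forall>t. a $ t + L / n * from_nat_into (grid n) i t \<le> x $ t \<and>
     x $ t \<le> a $ t + L / n * (from_nat_into (grid n) i t + 1)} else {})" for n i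
  have norm_le: "norm (x - y) \<le> ?d * (L / n)" if "x \<in> U n i" "y \<in> U n i" for x y n i
  proof -
    have "\<bar>(x - y) $ t\<bar> \<le> L / n" for t
    proof -
      define p where "p = a $ t + L / n * from_nat_into (grid n) i t"
      have "p \<le> x $ t" "x $ t \<le> p + L / n" "p \<le> y $ t" "y $ t \<le> p + L / n"
        using that by (auto simp: p_def U_def algebra_simps add_divide_distrib split: if_splits)
      then show ?thesis by simp
    qed
    then show ?thesis by (rule norm_le_card_times)
  qed
  have bU: "bounded (U n i)" for n i
  proof (cases "U n i = {}")
    case False
    then obtain y where "y \<in> U n i" by blast
    then show ?thesis using norm_le unfolding bounded_def by (metis dist_norm)
  qed simp
  have dU: "diameter (U n i) \<le> ?d * (L / n)" for n i
    by (rule diameter_le) (use norm_le R in \<open>auto simp: L_def\<close>)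
  have cov: "A \<subseteq> (\<Union>i. U n i)" if "n > 0" for n
  proof
    fix x assume x: "x \<in> A"
    have b: "a $ t \<le> x $ t" "x $ t \<le> a $ t + L" for t
      using component_le_norm_cart[of x t] R(2)[OF x] by (auto simp: a_def L_def)
    \<comment> \<open>The minimum with \<open>n - 1\<close> puts points of the far face, where the
      quotient equals \<open>n\<close>, into the last closed subcube.\<close>
    define k where "k t = min (n - 1) (nat \<lfloor>(x $ t - a $ t) / (L / n)\<rfloor>)" for t
    have "k \<in> grid n" using that by (auto simp: grid_def k_def min_def)
    have "k \<in> from_nat_into (grid n) ` {..<card (grid n :: ('n \<Rightarrow> nat) set)}"
      using bij_betw_from_nat_into_finite[OF finite_grid] \<open>k \<in> grid n\<close> unfolding bij_betw_def by blast
    then obtain i where i: "i < n ^ ?d" "from_nat_into (grid n) i = k"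
      by (auto simp: card_grid)
    have "a $ t + L / n * k t \<le> x $ t \<and> x $ t \<le> a $ t + L / n * (k t + 1)" for t
    proof -
      define v where "v = (x $ t - a $ t) / (L / n)"
      have w: "L / n > 0" using R that by (simp add: L_def)
      have "L / n * v = x $ t - a $ t"
        unfolding v_def times_divide_eq_right[of "L / n"]
        by (rule nonzero_mult_div_cancel_left[OF less_imp_neq[OF w, symmetric]])
      then have xv: "x $ t = a $ t + L / n * v" by simp
      have "real n * (L / n) = L" using that by simp
      then have "v \<le> n"
        unfolding v_def pos_divide_le_eq[OF w] using b[of t] by linarith
      moreover have "0 \<le> v" unfolding v_def using b[of t] w by (intro divide_nonneg_pos) auto
      ultimately have v: "0 \<le> v" "v \<le> n" by auto
      have kt: "k t = min (n - 1) (nat \<lfloor>v\<rfloor>)" by (simp add: k_def v_def)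
      have "real (k t) \<le> v" using v unfolding kt by linarith
      moreover have "v \<le> real (k t) + 1"
      proof (cases "nat \<lfloor>v\<rfloor> \<le> n - 1")
        case True
        then show ?thesis using v unfolding kt by (simp add: min_absorb2)
      next
        case False
        then show ?thesis using v that unfolding kt by (simp add: min_absorb1 of_nat_diff)
      qed
      ultimately show ?thesis
        unfolding xv using w by (intro conjI add_left_mono mult_left_mono) auto
    qed
    then have "x \<in> U n i" using i by (simp add: U_def)
    then show "x \<in> (\<Union>i. U n i)" by blast
  qed
  have sumU: "(\<Sum>i. diam_power s (U n i)) \<le> ennreal ((?d * L) powr s * n powr (?d - s))" if "n > 0" for n
  proof -
    have "(\<Sum>i. diam_power s (U n i)) = (\<Sum>i<n ^ ?d. diam_power s (U n i))"
      by (rule suminf_finite) (auto simp: U_def diam_power_def)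
    also have "\<dots> \<le> (\<Sum>i<n ^ ?d. ennreal ((?d * (L / n)) powr s))"
    proof (rule sum_mono)
      fix i
      have "diameter (U n i) powr s \<le> (?d * (L / n)) powr s"
        using s dU[of n i] diameter_ge_0[OF bU[of n i]] by (intro powr_mono2) auto
      then show "diam_power s (U n i) \<le> ennreal ((?d * (L / n)) powr s)"
        using s by (auto simp: diam_power_def intro: ennreal_leI)
    qed
    also have "\<dots> = ennreal (real (n ^ ?d) * (?d * (L / n)) powr s)"
      by (simp add: ennreal_mult ennreal_of_nat_eq_real_of_nat)
    also have "real (n ^ ?d) * (?d * (L / n)) powr s = (?d * L) powr s * n powr (?d - s)"
    proof -
      have "(?d * (L / n)) powr s = (?d * L) powr s / n powr s"
        using R by (simp add: powr_divide L_def)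
      moreover have "real (n ^ ?d) = n powr ?d" using that by (simp add: powr_realpow)
      ultimately show ?thesis by (simp add: powr_diff)
    qed
    finally show ?thesis .
  qed
  have "(\<lambda>n. (?d * L) powr s * real n powr (?d - s)) \<longlonglongrightarrow> (?d * L) powr s * 0"
    using s by (intro tendsto_mult tendsto_const tendsto_neg_powr filterlim_real_sequentially) simp
  then have lim0: "(\<lambda>n. (?d * L) powr s * real n powr (?d - s)) \<longlonglongrightarrow> 0" by simp
  let ?H = "\<lambda>\<delta>. Inf {(\<Sum>i. diam_power s (U i)) | U :: nat \<Rightarrow> (real ^ 'n) set.
        A \<subseteq> (\<Union>i. U i) \<and> (\<forall>i. bounded (U i) \<and> diameter (U i) \<le> \<delta>)}"
  have "?H \<delta> \<le> 0" if "\<delta> > 0" for \<delta>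
  proof (rule ennreal_le_epsilon)
    fix e :: real assume "0 < e"
    have "(\<lambda>n. (?d * L) * (1 / real n)) \<longlonglongrightarrow> (?d * L) * 0"
      by (intro tendsto_mult tendsto_const lim_1_over_n)
    then have "\<forall>\<^sub>F n in sequentially. (?d * L) * (1 / real n) < \<delta>"
      using that by (intro order_tendstoD(2)) auto
    moreover have "\<forall>\<^sub>F n in sequentially. (?d * L) powr s * real n powr (?d - s) < e"
      using lim0 \<open>0 < e\<close> by (rule order_tendstoD(2))
    moreover have "\<forall>\<^sub>F n::nat in sequentially. n > 0" by (rule eventually_gt_at_top)
    ultimately have "\<forall>\<^sub>F n in sequentially. n > 0 \<and> (?d * L) * (1 / real n) < \<delta> \<and> (?d * L) powr s * real n powr (?d - s) < e"
      by eventually_elim auto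
    then obtain n where n: "n > 0" "(?d * L) * (1 / real n) < \<delta>" "(?d * L) powr s * real n powr (?d - s) < e"
      using eventually_happens'[OF sequentially_bot] by blast
    have "?H \<delta> \<le> (\<Sum>i. diam_power s (U n i))"
    proof (rule Inf_lower, intro CollectI exI conjI allI refl)
      show "diameter (U n i) \<le> \<delta>" for i using dU[of n i] n by simp
    qed (use cov[OF n(1)] bU in auto)
    also have "\<dots> \<le> ennreal e"
      using n by (intro order_trans[OF sumU] ennreal_leI) auto
    finally show "?H \<delta> \<le> 0 + ennreal e" by simp
  qed
  then show ?thesis unfolding hausdorff_measure_def
    by (intro antisym SUP_least) auto
qed

lemma hausdorff_dim_eq_CARD:
  fixes A :: "(real ^ 'n) set"
  assumes "bounded A" and pos: "\<And>s :: real. \<lbrakk>0 \<le> s; s < CARD('n)\<rbrakk> \<Longrightarrow> hausdorff_measure s A \<noteq> 0"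
  shows "hausdorff_dim A = of_nat CARD('n)"
proof (rule antisym)
  show "hausdorff_dim A \<le> of_nat CARD('n)"
  proof (rule ennreal_le_epsilon)
    fix e :: real assume "0 < e"
    have "hausdorff_dim A \<le> ennreal (real CARD('n) + e)"
      unfolding hausdorff_dim_def
      using hausdorff_measure_zero_above_dim[OF assms(1), of "real CARD('n) + e"] \<open>0 < e\<close>
      by (intro Inf_lower CollectI exI[of _ "real CARD('n) + e"]) auto
    also have "\<dots> = of_nat CARD('n) + ennreal e"
      using \<open>0 < e\<close> by (simp add: ennreal_of_nat_eq_real_of_nat)
    finally show "hausdorff_dim A \<le> of_nat CARD('n) + ennreal e" .
  qed
  show "of_nat CARD('n) \<le> hausdorff_dim A"
    unfolding hausdorff_dim_def
  proof (rule Inf_greatest)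
    fix y assume "y \<in> {ennreal s | s. 0 \<le> s \<and> hausdorff_measure s A = 0}"
    then obtain s where s: "y = ennreal s" "0 \<le> s" "hausdorff_measure s A = 0" by blast
    then have "s \<ge> CARD('n)" using pos[of s] by force
    then show "of_nat CARD('n) \<le> y"
      unfolding s(1) ennreal_of_nat_eq_real_of_nat by (rule ennreal_leI)
  qed
qed

section \<open>Dimension of the set of Lipschitz points\<close>

lemma sum_lessThan_add: "(\<Sum>k<p + q. g k) = (\<Sum>k<p. g k) + (\<Sum>k<q. g (p + k))"
  for g :: "nat \<Rightarrow> 'a::comm_monoid_add"
  by (induction q) (simp_all add: add_ac)

text \<open>Exchanging \<open>t\<close> with \<open>k i\<close> is an involution of
  \<open>grid N \<times> {..<N}\<close>. This reduces sums over all subcubes to sums over lines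
  parallel to an axis.\<close>

lemma sum_grid_fibre:
  fixes h :: "('n::finite \<Rightarrow> nat) \<Rightarrow> real"
  shows "(\<Sum>k\<in>grid N. \<Sum>t<N. h (k(i := t))) = N * (\<Sum>k\<in>grid N. h k)"
proof -
  have "(\<Sum>k\<in>grid N. \<Sum>t<N. h (k(i := t))) = (\<Sum>(k, t)\<in>grid N \<times> {..<N}. h (k(i := t)))"
    by (simp add: sum.cartesian_product)
  also have "\<dots> = (\<Sum>(k, t)\<in>grid N \<times> {..<N}. h k)"
    by (rule sum.reindex_bij_witness[where i = "\<lambda>(k, t). (k(i := t), k i)" and j = "\<lambda>(k, t). (k(i := t), k i)"])
      (auto simp: grid_def)
  also have "\<dots> = (\<Sum>k\<in>grid N. \<Sum>t<N. h k)" by (rule sum.cartesian_product[symmetric])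
  finally show ?thesis by (simp add: sum_distrib_left)
qed

lemma grid_combine_mem:
  assumes "j \<in> grid p" "k \<in> grid q"
  shows "(\<lambda>i. q * j i + k i) \<in> grid (p * q)"
  unfolding grid_def
proof (intro CollectI allI)
  fix i
  have "j i < p" "k i < q" using assms by (auto simp: grid_def)
  then have "q * j i + k i < q * j i + q" "q * (j i + 1) \<le> q * p"
    by (simp, intro mult_le_mono2) simp
  then show "q * j i + k i < p * q" by (simp add: algebra_simps)
qed

lemma vec_of_combine:
  assumes "q > 0"
  shows "(x + (l / p) *\<^sub>R vec_of j) + (l / p / real q) *\<^sub>R vec_of k
    = x + (l / (p * q)) *\<^sub>R vec_of (\<lambda>i. q * j i + k i)"
  using assms by (simp add: vec_eq_iff vec_of_def algebra_simps add_divide_distrib)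

lemma vec_of_update: "vec_of (k(i := t)) = vec_of (k(i := 0)) + real t *\<^sub>R axis i 1"
  by (simp add: vec_eq_iff vec_of_def axis_def)

lemma norm_vec_of_le:
  fixes k :: "'n::finite \<Rightarrow> nat"
  assumes "k \<in> grid N" shows "norm (vec_of k :: real ^ 'n) \<le> real CARD('n) * real N"
  using assms by (intro norm_le_card_times) (simp add: vec_of_def grid_def less_imp_le)

lemma cell_point_near_corner:
  fixes x y :: "real ^ 'n" and w :: real
  assumes "\<And>i. x $ i \<le> y $ i \<and> y $ i \<le> x $ i + w"
  shows "norm (x - y) \<le> CARD('n) * w"
proof (rule norm_le_card_times)
  fix i show "\<bar>(x - y) $ i\<bar> \<le> w" using assms[of i] by simp
qed

text \<open>The drop by 2 along \<open>a\<close> lowers the squared norm by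
  \<open>4 * norm a\<close>, while the uncontrolled rest of the change adds at most
  \<open>D\<^sup>2\<close>; the lower bound on \<open>norm a\<close> makes the gain prevail.\<close>

lemma norm_decrease_along_direction:
  fixes a c :: "'a::real_inner"
  assumes "norm u = 1" "a = norm a *\<^sub>R u" "u \<bullet> c \<le> u \<bullet> a - 2" "norm (c - a) \<le> D" "norm a \<ge> D\<^sup>2 + 1"
  shows "norm c \<le> norm a - 1"
proof -
  have "1 \<le> norm a" using assms(5) by (smt (verit) zero_le_power2)
  have "(norm c)\<^sup>2 = (norm a)\<^sup>2 + 2 * (a \<bullet> (c - a)) + (norm (c - a))\<^sup>2"
    using dot_norm[of a "c - a"] by simp
  also have "a \<bullet> (c - a) = norm a * (u \<bullet> c - u \<bullet> a)"
    using arg_cong[OF assms(2), of "\<lambda>z. z \<bullet> (c - a)"] by (simp add: inner_diff_right right_diff_distrib)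
  also have "norm a * (u \<bullet> c - u \<bullet> a) \<le> norm a * (- 2)"
    using assms(3) by (intro mult_left_mono) auto
  also have "(norm (c - a))\<^sup>2 \<le> D\<^sup>2" using assms(4) by (intro power_mono) auto
  finally have "(norm c)\<^sup>2 \<le> (norm a)\<^sup>2 - 4 * norm a + D\<^sup>2" by linarith
  moreover have "(norm a - 1)\<^sup>2 = (norm a)\<^sup>2 - 2 * norm a + 1"
    unfolding power2_diff by simp
  moreover have "p \<le> z" if "p \<le> q - 4 * n + r" "z = q - 2 * n + 1" "n \<ge> r + 1" "1 \<le> n" for p q n r z :: real
    using that by linarith
  ultimately have "(norm c)\<^sup>2 \<le> (norm a - 1)\<^sup>2" using assms(5) \<open>1 \<le> norm a\<close> by blast
  then show ?thesis
  proof (rule power2_le_imp_le)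
    show "0 \<le> norm a - 1" using \<open>1 \<le> norm a\<close> by linarith
  qed
qed

text \<open>One halving raises the mean of \<open>h\<close> by at most \<open>c\<close>, and
  \<open>n\<close> halvings are made.\<close>

lemma dyadic_sum_le:
  fixes h :: "'a::real_vector \<Rightarrow> real \<Rightarrow> real"
  assumes step: "\<And>x l. l > 0 \<Longrightarrow> h x (l / 2) + h (x + (l / 2) *\<^sub>R e) (l / 2) \<le> 2 * (h x l + c)"
    and "l > 0"
  shows "(\<Sum>k<2 ^ n. h (x + (real k * (l / 2 ^ n)) *\<^sub>R e) (l / 2 ^ n)) \<le> 2 ^ n * (h x l + c * n)"
  using \<open>l > 0\<close>
proof (induction n arbitrary: x l)
  case 0
  then show ?case by simp
next
  case (Suc n)
  define l' where "l' = l / 2"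
  have l': "l' > 0" "l / 2 ^ Suc n = l' / 2 ^ n" using Suc.prems by (simp_all add: l'_def)
  define g where "g k = h (x + (real k * (l / 2 ^ Suc n)) *\<^sub>R e) (l / 2 ^ Suc n)" for k :: nat
  have shift: "g (2 ^ n + k) = h (x + l' *\<^sub>R e + (real k * (l' / 2 ^ n)) *\<^sub>R e) (l' / 2 ^ n)" for k
    unfolding g_def l'(2) by (simp add: distrib_right scaleR_add_left add.assoc add_divide_distrib)
  have "(\<Sum>k<2 ^ Suc n. g k) = (\<Sum>k<2 ^ n. g k) + (\<Sum>k<2 ^ n. g (2 ^ n + k))"
    unfolding power_Suc mult_2 by (rule sum_lessThan_add)
  also have "(\<Sum>k<2 ^ n. g k) \<le> 2 ^ n * (h x l' + c * n)"
    unfolding g_def l'(2) by (rule Suc.IH[OF l'(1)])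
  also have "(\<Sum>k<2 ^ n. g (2 ^ n + k)) \<le> 2 ^ n * (h (x + l' *\<^sub>R e) l' + c * n)"
    unfolding shift by (rule Suc.IH[OF l'(1)])
  finally have "(\<Sum>k<2 ^ Suc n. g k) \<le> 2 ^ n * (h x l' + h (x + l' *\<^sub>R e) l' + 2 * (c * n))"
    by (simp add: algebra_simps)
  also have "\<dots> \<le> 2 ^ n * (2 * (h x l + c) + 2 * (c * n))"
    using step[OF Suc.prems] by (intro mult_left_mono add_right_mono) (auto simp: l'_def)
  also have "\<dots> = 2 ^ Suc n * (h x l + c * Suc n)" by (simp add: algebra_simps)
  finally show ?case unfolding g_def .
qed

context weierstrass_series
begin

abbreviation slope :: "real ^ 'n \<Rightarrow> real ^ 'n \<Rightarrow> real \<Rightarrow> real" where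
  "slope e x l \<equiv> (f (x + l *\<^sub>R e) - f x) / l"

abbreviation sub_A :: "real ^ 'n \<Rightarrow> real \<Rightarrow> real \<Rightarrow> ('n \<Rightarrow> nat) \<Rightarrow> real ^ 'n" where
  "sub_A x l N k \<equiv> A (x + (l / N) *\<^sub>R vec_of k) (l / N)"

text \<open>Along a line the slopes over dyadic intervals form a martingale whose increments are bounded
  by the Zygmund constant, hence orthogonality of increments gives linear growth of the variance.\<close>

lemma slope_square_sum:
  assumes Z: "\<And>x h. \<bar>f (x + h) + f (x - h) - 2 * f x\<bar> \<le> Z * norm h" and e: "norm e = 1" and "l > 0"
  shows "(\<Sum>k<2 ^ n. (slope e (x + (real k * (l / 2 ^ n)) *\<^sub>R e) (l / 2 ^ n) - a)\<^sup>2)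
     \<le> 2 ^ n * ((slope e x l - a)\<^sup>2 + Z\<^sup>2 * n)"
proof (rule dyadic_sum_le[of "\<lambda>x l. (slope e x l - a)\<^sup>2", OF _ \<open>l > 0\<close>])
  fix x and l :: real assume "l > 0"
  define h where "h = l / 2"
  define s1 where "s1 = slope e x h"
  define s2 where "s2 = slope e (x + h *\<^sub>R e) h"
  define s where "s = slope e x l"
  have h: "h > 0" "l = 2 * h" using \<open>l > 0\<close> by (simp_all add: h_def)
  have full: "x + h *\<^sub>R e + h *\<^sub>R e = x + l *\<^sub>R e"
    using h by (simp add: add.assoc flip: scaleR_add_left)
  have sh: "s1 * h = f (x + h *\<^sub>R e) - f x" "s2 * h = f (x + l *\<^sub>R e) - f (x + h *\<^sub>R e)"
    "s * l = f (x + l *\<^sub>R e) - f x"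
    unfolding s1_def s2_def s_def full using h \<open>l > 0\<close> by simp_all
  then have "(s1 + s2) * h = (2 * s) * h"
    unfolding h(2) by (simp add: distrib_right)
  then have s12: "s1 + s2 = 2 * s" using h(1) by simp
  have "norm (h *\<^sub>R e) = h" using e h by simp
  then have "\<bar>f (x + l *\<^sub>R e) + f x - 2 * f (x + h *\<^sub>R e)\<bar> \<le> Z * h"
    using Z[of "x + h *\<^sub>R e" "h *\<^sub>R e"] unfolding full add_diff_cancel_right' by metis
  moreover have "f (x + l *\<^sub>R e) + f x - 2 * f (x + h *\<^sub>R e) = (s2 - s1) * h"
    unfolding left_diff_distrib sh by linarith
  ultimately have "\<bar>s2 - s1\<bar> * h \<le> Z * h" using h(1) by (simp add: abs_mult)
  then have "\<bar>s2 - s1\<bar> \<le> Z" using h(1) by simp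
  then have "\<bar>s2 - s1\<bar>\<^sup>2 \<le> Z\<^sup>2" by (rule power_mono) simp
  then have dZ: "(s2 - s1)\<^sup>2 \<le> Z\<^sup>2" unfolding power2_abs .
  have "(p - a)\<^sup>2 + (q - a)\<^sup>2 \<le> 2 * ((r - a)\<^sup>2 + z)"
    if "p + q = 2 * r" "(q - p)\<^sup>2 \<le> z" for p q r z :: real
  proof -
    have r: "r = (p + q) / 2" using that by simp
    have eq: "(p - a)\<^sup>2 + (q - a)\<^sup>2 = 2 * (r - a)\<^sup>2 + (q - p)\<^sup>2 / 2"
      unfolding r by (simp add: power2_eq_square field_simps)
    have "t \<le> 2 * (v + z)" if "t = 2 * v + w / 2" "w \<le> z" "0 \<le> w" for t v w :: real
      using that by simp
    from this[OF eq that(2)] show ?thesis by simp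
  qed
  then show "(slope e x (l / 2) - a)\<^sup>2 + (slope e (x + (l / 2) *\<^sub>R e) (l / 2) - a)\<^sup>2
      \<le> 2 * ((slope e x l - a)\<^sup>2 + Z\<^sup>2)"
    using s12 dZ unfolding s1_def s2_def s_def h_def by blast
qed

text \<open>Each component of a gradient sum is, up to a constant, the slope along that axis, and
  the grid splits into lines parallel to the axis, on each of which \<open>slope_square_sum\<close>
  applies. Starting the line at another face point than \<open>x\<close> costs only a
  constant.\<close>

lemma gradient_sum_variance:
  obtains Q :: real where "Q > 0"
    "\<And>x l n. \<lbrakk>0 < l; l \<le> 1\<rbrakk> \<Longrightarrow>
      (\<Sum>k\<in>grid (2 ^ n). (norm (sub_A x l (2 ^ n) k - A x l))\<^sup>2)
        \<le> 2 ^ (n * CARD('n)) * (Q * (n + 1))"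
proof -
  let ?d = "CARD('n)"
  obtain Z where Z: "\<And>x h. \<bar>f (x + h) + f (x - h) - 2 * f x\<bar> \<le> Z * norm h"
  proof -
    obtain Z where "\<And>y. y \<in> {\<bar>f (x + h) + f (x - h) - 2 * f x\<bar> / norm h | x h. h \<noteq> 0} \<Longrightarrow> y \<le> Z"
      using zygmund unfolding zygmund_class_def bdd_above_def by blast
    then have Z: "\<bar>f (x + h) + f (x - h) - 2 * f x\<bar> / norm h \<le> Z" if "h \<noteq> 0" for x h
      using that by blast
    have "\<bar>f (x + h) + f (x - h) - 2 * f x\<bar> \<le> Z * norm h" for x h
      using Z[of h x] by (cases "h = 0") (auto simp: divide_le_eq)
    then show ?thesis by (rule that)
  qed
  define C0 where "C0 = b * (K' + 2 * F)"
  have "C0 \<ge> 0" using b_pos K'_nonneg F_nonneg by (simp add: C0_def)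
  have d1: "1 \<le> real ?d" by (simp add: Suc_le_eq)
  obtain C1 where "C1 \<ge> 0" and C1: "\<And>x y r r'. \<lbrakk>0 < r'; r' \<le> r; r \<le> 1; r \<le> real ?d * r'; norm (x - y) \<le> real ?d * r\<rbrakk>
       \<Longrightarrow> norm (A x r - A y r') \<le> C1"
    by (rule A_stable[OF d1]) blast
  \<comment> \<open>Doubling comes from
    \<open>(u + v)\<^sup>2 \<le> 2 * u\<^sup>2 + 2 * v\<^sup>2\<close>: \<open>C0 + C1\<close> is
    the initial deviation of the slope, \<open>Z\<close> its increment per generation, the last
    \<open>C0\<close> the cost of returning from slopes to gradient sums.\<close>
  define Q1 where "Q1 = 2 * (C0 + C1)\<^sup>2 + 2 * Z\<^sup>2 + 2 * C0\<^sup>2"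
  define Q where "Q = ?d * Q1 + 1"
  have "Q1 \<ge> 0" by (simp add: Q1_def)
  have "Q > 0" using \<open>Q1 \<ge> 0\<close> by (simp add: Q_def add_nonneg_pos)
  moreover have "(\<Sum>k\<in>grid (2 ^ n). (norm (sub_A x l (2 ^ n) k - A x l))\<^sup>2)
        \<le> 2 ^ (n * ?d) * (Q * (n + 1))" if l: "0 < l" "l \<le> 1" for x l n
  proof -
    let ?w = "l / 2 ^ n" and ?N = "2 ^ n :: nat"
    have w: "0 < ?w" "?w \<le> 1" using l by (auto simp: divide_le_eq intro: order_trans[OF l(2)])
    let ?p = "\<lambda>k. x + ?w *\<^sub>R vec_of k"
    have coord: "(\<Sum>k\<in>grid ?N. ((A (?p k) ?w - A x l) $ i)\<^sup>2) \<le> 2 ^ (n * ?d) * (Q1 * (n + 1))" for i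
    proof -
      define e where "e = (axis i 1 :: real ^ 'n)"
      define a where "a = A x l $ i"
      have e: "norm e = 1" by (simp add: e_def)
      have comp: "e \<bullet> v = v $ i" for v :: "real ^ 'n" by (simp add: e_def inner_axis')
      define D where "D k = slope e (?p k) ?w" for k
      have line: "(\<Sum>t<?N. (D (k(i := t)) - a)\<^sup>2) \<le> ?N * ((C0 + C1)\<^sup>2 + Z\<^sup>2 * n)" if k: "k \<in> grid ?N" for k
      proof -
        let ?x = "?p (k(i := 0))"
        have pt: "?p (k(i := t)) = ?x + (real t * ?w) *\<^sub>R e" for t
          unfolding vec_of_update[of k i t] e_def scaleR_add_right scaleR_scaleR
          by (simp only: add.assoc mult.commute)
        have "(\<Sum>t<?N. (D (k(i := t)) - a)\<^sup>2) = (\<Sum>t<2 ^ n. (slope e (?x + (real t * ?w) *\<^sub>R e) ?w - a)\<^sup>2)"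
        proof (rule sum.cong[OF refl])
          show "(D (k(i := t)) - a)\<^sup>2 = (slope e (?x + (real t * ?w) *\<^sub>R e) ?w - a)\<^sup>2" for t
            unfolding D_def pt[of t] ..
        qed
        also have "\<dots> \<le> 2 ^ n * ((slope e ?x l - a)\<^sup>2 + Z\<^sup>2 * n)"
          by (rule slope_square_sum[OF Z e l(1)])
        also have "\<dots> \<le> 2 ^ n * ((C0 + C1)\<^sup>2 + Z\<^sup>2 * n)"
        proof (intro mult_left_mono add_right_mono)
          have "k(i := 0) \<in> grid ?N" using k by (simp add: grid_def)
          then have "norm (vec_of (k(i := 0)) :: real ^ 'n) \<le> ?d * real ?N" by (rule norm_vec_of_le)
          then have "norm (?w *\<^sub>R (vec_of (k(i := 0)) :: real ^ 'n)) \<le> ?w * (?d * real ?N)"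
            using w by (simp only: norm_scaleR) (intro mult_mono, auto)
          then have "norm (x - ?x) \<le> ?d * l" by (simp add: mult.commute)
          then have "norm (A x l - A ?x l) \<le> C1" using l d1 by (intro C1) (auto simp: mult_le_cancel_right1)
          then have "\<bar>a - e \<bullet> A ?x l\<bar> \<le> C1"
            unfolding comp a_def using component_le_norm_cart[of "A x l - A ?x l" i] by simp
          moreover have "\<bar>slope e ?x l - e \<bullet> A ?x l\<bar> \<le> C0"
            unfolding C0_def by (rule slope_approx[OF e l])
          ultimately have "\<bar>slope e ?x l - a\<bar> \<le> C0 + C1" by linarith
          then have "\<bar>slope e ?x l - a\<bar>\<^sup>2 \<le> (C0 + C1)\<^sup>2" by (rule power_mono) simp
          then show "(slope e ?x l - a)\<^sup>2 \<le> (C0 + C1)\<^sup>2" by simp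
        qed simp
        finally show ?thesis by simp
      qed
      have "real ?N * (\<Sum>k\<in>grid ?N. (D k - a)\<^sup>2) = (\<Sum>k\<in>grid ?N. \<Sum>t<?N. (D (k(i := t)) - a)\<^sup>2)"
        by (rule sum_grid_fibre[symmetric])
      also have "\<dots> \<le> (\<Sum>k\<in>(grid ?N :: ('n \<Rightarrow> nat) set). ?N * ((C0 + C1)\<^sup>2 + Z\<^sup>2 * n))"
        by (intro sum_mono line)
      also have "\<dots> = real ?N * (2 ^ (n * ?d) * ((C0 + C1)\<^sup>2 + Z\<^sup>2 * n))"
        by (simp add: card_grid power_mult)
      finally have sumD: "(\<Sum>k\<in>grid ?N. (D k - a)\<^sup>2) \<le> 2 ^ (n * ?d) * ((C0 + C1)\<^sup>2 + Z\<^sup>2 * n)"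
        by simp
      have "((A (?p k) ?w - A x l) $ i)\<^sup>2 \<le> 2 * (D k - a)\<^sup>2 + 2 * C0\<^sup>2" for k
      proof -
        define u where "u = A (?p k) ?w $ i - D k"
        define v where "v = D k - a"
        have "\<bar>D k - e \<bullet> A (?p k) ?w\<bar> \<le> C0"
          unfolding C0_def D_def by (rule slope_approx[OF e w])
        then have "\<bar>u\<bar> \<le> C0" unfolding comp u_def by linarith
        then have "\<bar>u\<bar>\<^sup>2 \<le> C0\<^sup>2" by (rule power_mono) simp
        then have u: "u\<^sup>2 \<le> C0\<^sup>2" by simp
        have "(u + v)\<^sup>2 \<le> 2 * u\<^sup>2 + 2 * v\<^sup>2"
          using zero_le_power2[of "u - v"] unfolding power2_sum power2_diff by linarith
        then have "(u + v)\<^sup>2 \<le> 2 * v\<^sup>2 + 2 * C0\<^sup>2" using u by linarith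
        moreover have "u + v = (A (?p k) ?w - A x l) $ i" by (simp add: u_def v_def a_def)
        ultimately show ?thesis unfolding v_def by simp
      qed
      then have "(\<Sum>k\<in>grid ?N. ((A (?p k) ?w - A x l) $ i)\<^sup>2) \<le> (\<Sum>k\<in>grid ?N. 2 * (D k - a)\<^sup>2 + 2 * C0\<^sup>2)"
        by (intro sum_mono)
      also have "\<dots> = 2 * (\<Sum>k\<in>grid ?N. (D k - a)\<^sup>2) + 2 ^ (n * ?d) * (2 * C0\<^sup>2)"
        by (simp add: sum.distrib card_grid power_mult flip: sum_distrib_left)
      also have "\<dots> \<le> 2 * (2 ^ (n * ?d) * ((C0 + C1)\<^sup>2 + Z\<^sup>2 * n)) + 2 ^ (n * ?d) * (2 * C0\<^sup>2)"
        using sumD by simp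
      also have "\<dots> = 2 ^ (n * ?d) * (2 * (C0 + C1)\<^sup>2 + 2 * Z\<^sup>2 * n + 2 * C0\<^sup>2)"
        by (simp add: algebra_simps)
      also have "\<dots> \<le> 2 ^ (n * ?d) * (Q1 * (n + 1))"
        by (intro mult_left_mono) (auto simp: Q1_def algebra_simps)
      finally show ?thesis .
    qed
    have "(\<Sum>k\<in>grid ?N. (norm (A (?p k) ?w - A x l))\<^sup>2)
      = (\<Sum>k\<in>grid ?N. \<Sum>i\<in>UNIV. ((A (?p k) ?w - A x l) $ i)\<^sup>2)"
      by (simp add: norm_vec_def L2_set_def sum_nonneg)
    also have "\<dots> = (\<Sum>i\<in>UNIV. \<Sum>k\<in>grid ?N. ((A (?p k) ?w - A x l) $ i)\<^sup>2)" by (rule sum.swap)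
    also have "\<dots> \<le> (\<Sum>i\<in>(UNIV :: 'n set). 2 ^ (n * ?d) * (Q1 * (n + 1)))" by (intro sum_mono coord)
    also have "\<dots> = 2 ^ (n * ?d) * ((?d * Q1) * (n + 1))" by simp
    also have "\<dots> \<le> 2 ^ (n * ?d) * (Q * (n + 1))"
      by (intro mult_left_mono mult_right_mono) (auto simp: Q_def)
    finally show ?thesis by simp
  qed
  ultimately show thesis by (rule that)
qed

text \<open>Chebyshev's inequality: the mean square deviation grows linearly in \<open>n\<close>,
  the squared threshold quadratically.\<close>

lemma most_cells_small_change:
  fixes \<epsilon> :: real
  assumes "\<epsilon> > 0"
  obtains n0 where "\<And>n x l. \<lbrakk>n \<ge> n0; 0 < l; l \<le> 1\<rbrakk> \<Longrightarrow>
     2 ^ (n * CARD('n)) / 2 \<le> real (card {k \<in> grid (2 ^ n).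
        norm (sub_A x l (2 ^ n) k - A x l) \<le> \<epsilon> * n})"
proof -
  obtain Q :: real where "Q > 0" and Q: "\<And>x l n. \<lbrakk>0 < l; l \<le> 1\<rbrakk> \<Longrightarrow>
      (\<Sum>k\<in>grid (2 ^ n). (norm (sub_A x l (2 ^ n) k - A x l))\<^sup>2)
        \<le> 2 ^ (n * CARD('n)) * (Q * (n + 1))"
    by (rule gradient_sum_variance) blast
  \<comment> \<open>For such \<open>n\<close> one has \<open>Q * (n + 1) \<le> 2 * Q * n\<close>,
    which is at most half of \<open>(\<epsilon> * n)\<^sup>2\<close>.\<close>
  obtain n0 :: nat where n0: "4 * Q / \<epsilon>\<^sup>2 + 1 \<le> n0" using real_arch_simple by blast
  show thesis
  proof
    fix n x l assume n: "n \<ge> n0" and l: "0 < l" "l \<le> (1::real)"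
    have "4 * Q / \<epsilon>\<^sup>2 > 0" using \<open>Q > 0\<close> assms by simp
    then have n1: "real n \<ge> 1" "4 * Q / \<epsilon>\<^sup>2 \<le> n" using n0 n by linarith+
    let ?v = "\<lambda>k. norm (sub_A x l (2 ^ n) k - A x l)"
    let ?good = "{k \<in> grid (2 ^ n). ?v k \<le> \<epsilon> * n}" and ?bad = "{k \<in> grid (2 ^ n). \<not> ?v k \<le> \<epsilon> * n}"
    have "real (card ?bad) * (\<epsilon> * n)\<^sup>2 = (\<Sum>k\<in>?bad. (\<epsilon> * n)\<^sup>2)" by simp
    also have "\<dots> \<le> (\<Sum>k\<in>?bad. (?v k)\<^sup>2)"
      using assms by (intro sum_mono power_mono) auto
    also have "\<dots> \<le> (\<Sum>k\<in>grid (2 ^ n). (?v k)\<^sup>2)"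
      by (intro sum_mono2 finite_grid) auto
    also have "\<dots> \<le> 2 ^ (n * CARD('n)) * (Q * (n + 1))" by (rule Q[OF l])
    also have "\<dots> \<le> 2 ^ (n * CARD('n)) * ((\<epsilon> * n)\<^sup>2 / 2)"
    proof (rule mult_left_mono)
      have "4 * Q \<le> n * \<epsilon>\<^sup>2" using n1(2) assms by (simp add: divide_le_eq)
      then have "4 * Q * n \<le> (n * \<epsilon>\<^sup>2) * n" by (rule mult_right_mono) simp
      moreover have "Q * (n + 1) \<le> Q * (2 * n)" using n1 \<open>Q > 0\<close> by (intro mult_left_mono) auto
      ultimately show "Q * (n + 1) \<le> (\<epsilon> * n)\<^sup>2 / 2"
        by (simp add: power2_eq_square algebra_simps)
    qed simp
    finally have "real (card ?bad) * (\<epsilon> * n)\<^sup>2 \<le> (2 ^ (n * CARD('n)) / 2) * (\<epsilon> * n)\<^sup>2" by simp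
    then have bad: "real (card ?bad) \<le> 2 ^ (n * CARD('n)) / 2"
      using assms n1 by (subst (asm) mult_le_cancel_right_pos) auto
    have "grid (2 ^ n) = ?good \<union> ?bad" by auto
    moreover have "card (?good \<union> ?bad) = card ?good + card ?bad"
      by (rule card_Un_disjoint) (auto intro: finite_subset[OF _ finite_grid])
    ultimately have "card (grid (2 ^ n) :: ('n \<Rightarrow> nat) set) = card ?good + card ?bad" by simp
    then have "real (card ?good) + real (card ?bad) = real (card (grid (2 ^ n) :: ('n \<Rightarrow> nat) set))"
      by (simp only: of_nat_add)
    also have "\<dots> = 2 ^ (n * CARD('n))" by (simp add: card_grid power_mult)
    finally have "real (card ?good) + real (card ?bad) = 2 ^ (n * CARD('n))" .
    then show "2 ^ (n * CARD('n)) / 2 \<le> real (card ?good)" using bad by linarith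
  qed
qed

text \<open>\<open>gradient_sum_drop\<close> is applied in the direction of \<open>A x l\<close>
  itself, and the resulting point is moved to the corner of the dyadic subcube containing it. If
  \<open>A x l\<close> is long, its norm drops by 1; if not, bounded change leaves it below
  \<open>\<rho>0\<close>.\<close>

lemma correction_step:
  obtains L :: nat and \<rho>0 where "L \<ge> 1" "\<rho>0 \<ge> 0"
    "\<And>x l. \<lbrakk>0 < l; l \<le> 1\<rbrakk> \<Longrightarrow> \<exists>k\<in>grid (2 ^ L).
       norm (sub_A x l (2 ^ L) k) \<le> max \<rho>0 (norm (A x l) - 1)"
proof -
  let ?d = "CARD('n)"
  \<comment> \<open>Covers the ratio of the scales \<open>l\<close> and \<open>l / 4\<close> as well
    as the distance from a corner of a cube to its points.\<close>
  define c where "c = 4 + real ?d"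
  have "c \<ge> 1" by (simp add: c_def)
  obtain C1 where C1: "\<And>x y r r'. \<lbrakk>0 < r'; r' \<le> r; r \<le> 1; r \<le> c * r'; norm (x - y) \<le> c * r\<rbrakk>
       \<Longrightarrow> norm (A x r - A y r') \<le> C1"
    by (rule A_stable[OF \<open>c \<ge> 1\<close>]) blast
  \<comment> \<open>\<open>C1\<close> is lost twice, from the corner \<open>x\<close> to the centre
    and from \<open>y\<close> to a dyadic corner; the remaining 2 is what
    \<open>norm_decrease_along_direction\<close> requires.\<close>
  obtain \<kappa> where \<kappa>: "0 < \<kappa>" "\<kappa> \<le> 1" and drop:
    "\<And>u x r. \<lbrakk>norm u = 1; 0 < r; r \<le> 1\<rbrakk> \<Longrightarrow> \<exists>y. norm (y - x) \<le> r \<and> u \<bullet> A y (\<kappa> * r) \<le> u \<bullet> A x r - (2 * C1 + 2)"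
    by (rule gradient_sum_drop[where H = "2 * C1 + 2"]) blast
  \<comment> \<open>The first dyadic scale not exceeding \<open>\<kappa> / 4\<close>; minimality
    keeps it within a factor 2, so that \<open>A_stable\<close> applies with
    \<open>c\<close>.\<close>
  obtain L :: nat where L: "1 / 2 ^ L \<le> \<kappa> / 4" "\<kappa> / 4 < 2 / 2 ^ L" "L \<ge> 1"
  proof -
    have "\<exists>n. 1 / 2 ^ n \<le> \<kappa> / 4"
      using real_arch_pow_inv[of "\<kappa> / 4" "1 / 2"] \<kappa> by (auto simp: power_one_over intro: less_imp_le)
    then obtain n where n: "1 / 2 ^ n \<le> \<kappa> / 4" and least: "\<And>k. k < n \<Longrightarrow> \<not> 1 / 2 ^ k \<le> \<kappa> / 4"
      using exists_least_iff[of "\<lambda>n. 1 / 2 ^ n \<le> \<kappa> / 4"] by blast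
    have "n \<noteq> 0" using n \<kappa> by (cases n) auto
    then obtain k where k: "n = Suc k" using not0_implies_Suc by blast
    show ?thesis using n least[of k] k by (intro that[of n]) auto
  qed
  define c2 where "c2 = 2 ^ L + real ?d"
  have "(1::real) \<le> 2 ^ L" by simp
  then have "c2 \<ge> 1" unfolding c2_def by linarith
  obtain C2 where "C2 \<ge> 0" and C2: "\<And>x y r r'. \<lbrakk>0 < r'; r' \<le> r; r \<le> 1; r \<le> c2 * r'; norm (x - y) \<le> c2 * r\<rbrakk>
       \<Longrightarrow> norm (A x r - A y r') \<le> C2"
    by (rule A_stable[OF \<open>c2 \<ge> 1\<close>]) blast
  define \<rho>0 where "\<rho>0 = C2\<^sup>2 + 1 + C2"
  show thesis
  proof (rule that[OF L(3), of \<rho>0])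
    show "\<rho>0 \<ge> 0" using \<open>C2 \<ge> 0\<close> by (simp add: \<rho>0_def)
    fix x :: "real ^ 'n" and l :: real assume l: "0 < l" "l \<le> 1"
    define a where "a = A x l"
    obtain i0 :: 'n where True by simp
    \<comment> \<open>For \<open>a = 0\<close> any unit vector satisfies
      \<open>a = norm a *\<^sub>R u\<close>.\<close>
    define u where "u = (if a = 0 then axis i0 1 else a /\<^sub>R norm a)"
    have u: "norm u = 1" "a = norm a *\<^sub>R u" by (auto simp: u_def)
    \<comment> \<open>Starting at the centre with radius \<open>l / 4\<close> keeps \<open>y\<close>
      inside the cube.\<close>
    define xc where "xc = x + (\<chi> i. l / 2)"
    have "0 < l / 4" "l / 4 \<le> 1" using l by auto
    then obtain y where y: "norm (y - xc) \<le> l / 4"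
      "u \<bullet> A y (\<kappa> * (l / 4)) \<le> u \<bullet> A xc (l / 4) - (2 * C1 + 2)"
      using drop[OF u(1), of "l / 4" xc] by blast
    have "norm (x - xc) \<le> ?d * l"
      by (rule cell_point_near_corner) (use l in \<open>simp add: xc_def\<close>)
    also have "\<dots> \<le> c * l" using l by (simp add: c_def)
    finally have "norm (a - A xc (l / 4)) \<le> C1"
      unfolding a_def using l by (intro C1) (auto simp: c_def)
    then have 1: "u \<bullet> A xc (l / 4) \<le> u \<bullet> a + C1"
      using Cauchy_Schwarz_ineq2[of u "a - A xc (l / 4)"] u(1) by (simp add: inner_diff_right)
    define w where "w = l / 2 ^ L"
    have w: "0 < w" "w \<le> \<kappa> * (l / 4)" "\<kappa> * (l / 4) \<le> 2 * w"
      using l L(1,2) mult_left_mono[OF L(1), of l] mult_left_mono[OF less_imp_le[OF L(2)], of l]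
      by (auto simp: w_def mult_ac)
    have wl: "w * 2 ^ L = l" by (simp add: w_def)
    have yi: "x $ i \<le> y $ i" "y $ i < x $ i + l" for i
      using component_le_norm_cart[of "y - xc" i] y(1) l by (auto simp: xc_def abs_le_iff)
    define k where "k i = nat \<lfloor>(y $ i - x $ i) / w\<rfloor>" for i
    have ki: "real (k i) \<le> (y $ i - x $ i) / w" "(y $ i - x $ i) / w < real (k i) + 1" for i
    proof -
      have "(y $ i - x $ i) / w \<ge> 0" using yi[of i] w by simp
      then show "real (k i) \<le> (y $ i - x $ i) / w" "(y $ i - x $ i) / w < real (k i) + 1"
        unfolding k_def by linarith+
    qed
    have "k i < 2 ^ L" for i
    proof -
      have "(y $ i - x $ i) / w < 2 ^ L"
        unfolding pos_divide_less_eq[OF w(1)] using yi(2)[of i] wl by (simp add: mult.commute)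
      then have "real (k i) < 2 ^ L" using ki(1)[of i] by linarith
      then have "real (k i) < real (2 ^ L)" by (simp only: of_nat_power of_nat_numeral)
      then show ?thesis by (simp only: of_nat_less_iff)
    qed
    then have kg: "k \<in> grid (2 ^ L)" by (simp add: grid_def)
    define q where "q = x + w *\<^sub>R vec_of k"
    have "norm (q - y) \<le> ?d * w"
    proof (rule cell_point_near_corner)
      fix i
      have "real (k i) * w \<le> y $ i - x $ i" using ki(1)[of i] w by (simp add: pos_le_divide_eq)
      moreover have "y $ i - x $ i \<le> (real (k i) + 1) * w"
        using ki(2)[of i] w by (simp add: pos_divide_less_eq less_imp_le)
      ultimately show "q $ i \<le> y $ i \<and> y $ i \<le> q $ i + w"
        by (simp add: q_def vec_of_def algebra_simps)
    qed
    moreover have "?d * w \<le> c * (\<kappa> * (l / 4))" using w by (intro mult_mono) (auto simp: c_def)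
    ultimately have "norm (y - q) \<le> c * (\<kappa> * (l / 4))" by (simp add: norm_minus_commute)
    moreover have "2 * w \<le> c * w" using w by (intro mult_right_mono) (simp_all add: c_def)
    then have "\<kappa> * (l / 4) \<le> c * w" using w by linarith
    moreover have "\<kappa> * (l / 4) \<le> 1" using \<kappa> l by (intro mult_le_one) auto
    ultimately have "norm (A y (\<kappa> * (l / 4)) - A q w) \<le> C1" using w by (intro C1) auto
    then have "u \<bullet> A q w \<le> u \<bullet> A y (\<kappa> * (l / 4)) + C1"
      using Cauchy_Schwarz_ineq2[of u "A y (\<kappa> * (l / 4)) - A q w"] u(1) by (simp add: inner_diff_right)
    then have dir: "u \<bullet> A q w \<le> u \<bullet> a - 2" using y(2) 1 by linarith
    have "norm (x - q) = w * norm (vec_of k :: real ^ 'n)" using w by (simp add: q_def)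
    also have "\<dots> \<le> w * (?d * real (2 ^ L))" using w kg by (intro mult_left_mono norm_vec_of_le) auto
    also have "\<dots> = ?d * l" using wl by (simp add: mult_ac)
    also have "\<dots> \<le> c2 * l" using l by (simp add: c2_def)
    finally have "norm (a - A q w) \<le> C2"
      unfolding a_def
    proof (rule C2[rotated 4])
      show "l \<le> c2 * w" using w wl by (simp add: c2_def algebra_simps)
      show "w \<le> l" using w(2) l \<kappa> mult_right_mono[of \<kappa> 1 "l / 4"] by linarith
    qed (use w l in auto)
    then have near: "norm (A q w - a) \<le> C2" by (simp add: norm_minus_commute)
    have "norm (A q w) \<le> max \<rho>0 (norm a - 1)"
    proof (cases "norm a \<ge> C2\<^sup>2 + 1")
      case True
      then show ?thesis using norm_decrease_along_direction[OF u dir near] by simp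
    next
      case False
      have "norm (A q w) \<le> norm a + norm (A q w - a)"
        using norm_triangle_ineq[of a "A q w - a"] by simp
      then show ?thesis using near False by (simp add: \<rho>0_def)
    qed
    then show "\<exists>k\<in>grid (2 ^ L). norm (sub_A x l (2 ^ L) k) \<le> max \<rho>0 (norm (A x l) - 1)"
      using kg unfolding q_def w_def a_def by blast
  qed
qed

text \<open>Every subcube with small change yields one corrected descendant, distinct for distinct
  subcubes. The \<open>L * t\<close> generations of correction add no branching, but being a small
  fraction of \<open>n\<close> they lower the exponent only slightly. \<open>q\<close> is chosen
  independently of \<rho>, so the bound can be iterated from cube to cube.\<close>

lemma many_bounded_cells:
  fixes s :: real
  assumes s: "0 \<le> s" "s < CARD('n)"
  obtains q :: nat and \<rho>0 :: real where "q \<ge> 1"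
    "\<And>\<rho> x l. \<lbrakk>\<rho> \<ge> \<rho>0; 0 < l; l \<le> 1; norm (A x l) \<le> \<rho>\<rbrakk> \<Longrightarrow>
      real (2 ^ q) powr s \<le> card {k \<in> grid (2 ^ q). norm (sub_A x l (2 ^ q) k) \<le> \<rho>}"
proof -
  let ?d = "CARD('n)"
  obtain L \<rho>0 where "L \<ge> 1" "\<rho>0 \<ge> 0" and corr:
    "\<And>x l. \<lbrakk>0 < l; l \<le> 1\<rbrakk> \<Longrightarrow> \<exists>k\<in>grid (2 ^ L).
       norm (sub_A x l (2 ^ L) k) \<le> max \<rho>0 (norm (A x l) - 1)"
    by (rule correction_step) blast
  have iter: "\<exists>k\<in>grid (2 ^ (L * t)). norm (sub_A x l (2 ^ (L * t)) k) \<le> \<rho>"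
    if "\<rho> \<ge> \<rho>0" "0 < l" "l \<le> 1" "norm (A x l) \<le> \<rho> + t" for \<rho> x l and t :: nat
    using that
  proof (induction t arbitrary: x l)
    case 0
    have "vec_of (\<lambda>_. 0) = (0 :: real ^ 'n)" by (simp add: vec_of_def vec_eq_iff)
    then show ?case using 0 by (intro bexI[of _ "\<lambda>_. 0"]) (auto simp: grid_def)
  next
    case (Suc t)
    obtain k1 where k1: "k1 \<in> grid (2 ^ L)"
      "norm (sub_A x l (2 ^ L) k1) \<le> max \<rho>0 (norm (A x l) - 1)"
      using corr[OF Suc.prems(2,3)] by blast
    have "max \<rho>0 (norm (A x l) - 1) \<le> \<rho> + t" using Suc.prems by simp
    then have le: "norm (sub_A x l (2 ^ L) k1) \<le> \<rho> + t" using k1(2) by linarith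
    have l': "0 < l / 2 ^ L" "l / 2 ^ L \<le> 1"
      using Suc.prems by (auto simp: divide_le_eq intro: order_trans[OF Suc.prems(3)])
    obtain k2 where k2: "k2 \<in> grid (2 ^ (L * t))"
      "norm (A (x + (l / 2 ^ L) *\<^sub>R vec_of k1 + (l / 2 ^ L / 2 ^ (L * t)) *\<^sub>R vec_of k2) (l / 2 ^ L / 2 ^ (L * t))) \<le> \<rho>"
      using Suc.IH[OF Suc.prems(1) l' le] by blast
    let ?k = "\<lambda>i. 2 ^ (L * t) * k1 i + k2 i"
    have "?k \<in> grid (2 ^ (L * Suc t))"
      using grid_combine_mem[OF k1(1) k2(1)] by (simp add: power_add)
    moreover have "x + (l / 2 ^ L) *\<^sub>R vec_of k1 + (l / 2 ^ L / 2 ^ (L * t)) *\<^sub>R vec_of k2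
      = x + (l / 2 ^ (L * Suc t)) *\<^sub>R vec_of ?k"
      using vec_of_combine[of "2 ^ (L * t)" x l "2 ^ L" k1 k2] by (simp add: power_add)
    moreover have "l / 2 ^ L / 2 ^ (L * t) = l / 2 ^ (L * Suc t)" by (simp add: power_add)
    ultimately show ?case using k2(2) by metis
  qed
  \<comment> \<open>Lets the correction generations use up at most half of the margin between
    \<open>s\<close> and the dimension; the summand 1 keeps the denominator positive when
    \<open>s * L\<close> is 0.\<close>
  define \<epsilon> where "\<epsilon> = (?d - s) / (2 * (s * L + 1))"
  have "s * L + 1 > 0" using s by (simp add: add_nonneg_pos)
  then have "\<epsilon> > 0" using s by (simp add: \<epsilon>_def)
  have \<epsilon>L: "s * L * \<epsilon> \<le> (?d - s) / 2"
  proof -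
    have "s * L * \<epsilon> \<le> (s * L + 1) * \<epsilon>" using \<open>\<epsilon> > 0\<close> by simp
    also have "\<dots> = (?d - s) / 2"
    proof -
      have "D * (y / (2 * D)) = y / 2" if "D > 0" for D y :: real using that by simp
      then show ?thesis unfolding \<epsilon>_def using \<open>s * L + 1 > 0\<close> by blast
    qed
    finally show ?thesis .
  qed
  obtain n0 where n0: "\<And>n x l. \<lbrakk>n \<ge> n0; 0 < l; l \<le> 1\<rbrakk> \<Longrightarrow>
     2 ^ (n * ?d) / 2 \<le> real (card {k \<in> grid (2 ^ n).
        norm (sub_A x l (2 ^ n) k - A x l) \<le> \<epsilon> * n})"
    by (rule most_cells_small_change[OF \<open>\<epsilon> > 0\<close>]) blast
  \<comment> \<open>The other half of the margin pays for rounding \<open>\<epsilon> * n\<close> up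
    to \<open>t\<close>, which costs \<open>s * L\<close>, and for the factor \<open>1 / 2\<close>
    in the number of good subcubes, which costs 1 in the exponent.\<close>
  obtain n1 :: nat where n1: "2 * (1 + s * L) / (?d - s) \<le> n1" using real_arch_simple by blast
  define n where "n = max 1 (max n0 n1)"
  define t where "t = nat \<lceil>\<epsilon> * n\<rceil>"
  define q where "q = n + L * t"
  have n: "n \<ge> n0" "n \<ge> 1" "n1 \<le> n" by (auto simp: n_def)
  have "\<epsilon> * n \<ge> 0" using \<open>\<epsilon> > 0\<close> by simp
  then have t: "\<epsilon> * n \<le> t" "t \<le> \<epsilon> * n + 1" unfolding t_def by linarith+
  have sq: "s * q \<le> real (n * ?d) - 1"
  proof -
    have "s * q = s * n + s * L * t" by (simp add: q_def algebra_simps)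
    also have "\<dots> \<le> s * n + s * L * (\<epsilon> * n + 1)" using s t by (intro add_left_mono mult_left_mono) auto
    also have "\<dots> = s * n + s * L * \<epsilon> * n + s * L" by (simp add: algebra_simps)
    also have "\<dots> \<le> s * n + (?d - s) / 2 * n + s * L"
      using \<epsilon>L by (intro add_mono mult_right_mono) auto
    also have "\<dots> \<le> real (n * ?d) - 1"
    proof -
      have "2 * (1 + s * L) / (?d - s) \<le> n" using n1 n by linarith
      then have "2 * (1 + s * L) \<le> n * (?d - s)" using s by (simp add: divide_le_eq)
      then show ?thesis by (simp add: field_simps)
    qed
    finally show ?thesis .
  qed
  show thesis
  proof (rule that[of q \<rho>0])
    show "q \<ge> 1" using n by (simp add: q_def)
    fix \<rho> and x :: "real ^ 'n" and l :: real
    assume \<rho>: "\<rho> \<ge> \<rho>0" and l: "0 < l" "l \<le> 1" and Al: "norm (A x l) \<le> \<rho>"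
    let ?l = "l / 2 ^ n"
    let ?good = "{k \<in> grid (2 ^ n). norm (A (x + ?l *\<^sub>R vec_of k) ?l - A x l) \<le> \<epsilon> * n}"
    let ?final = "{k \<in> grid (2 ^ q). norm (sub_A x l (2 ^ q) k) \<le> \<rho>}"
    have l': "0 < ?l" "?l \<le> 1" using l by (auto simp: divide_le_eq intro: order_trans[OF l(2)])
    define ok where "ok j k \<longleftrightarrow> k \<in> grid (2 ^ (L * t)) \<and>
      norm (A (x + ?l *\<^sub>R vec_of j + (?l / 2 ^ (L * t)) *\<^sub>R vec_of k) (?l / 2 ^ (L * t))) \<le> \<rho>" for j k
    have "\<exists>k. ok j k" if "j \<in> ?good" for j
    proof -
      have "norm (A (x + ?l *\<^sub>R vec_of j) ?l) \<le> norm (A x l) + norm (A (x + ?l *\<^sub>R vec_of j) ?l - A x l)"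
        using norm_triangle_ineq[of "A x l" "A (x + ?l *\<^sub>R vec_of j) ?l - A x l"] by simp
      also have "\<dots> \<le> \<rho> + t" using that Al t by (intro add_mono) auto
      finally show ?thesis unfolding ok_def using iter[OF \<rho> l'] by blast
    qed
    then obtain k where ok: "\<And>j. j \<in> ?good \<Longrightarrow> ok j (k j)" using bchoice[of ?good ok] by blast
    note k = ok[unfolded ok_def, THEN conjunct1] ok[unfolded ok_def, THEN conjunct2]
    define g where "g j = (\<lambda>i. 2 ^ (L * t) * j i + k j i)" for j
    have "inj_on g ?good"
    proof (rule inj_onI)
      fix j j' assume "j \<in> ?good" "j' \<in> ?good" "g j = g j'"
      then show "j = j'" using grid_combine_inj(1)[OF k(1) k(1)] unfolding g_def by blast
    qed
    moreover have "g ` ?good \<subseteq> ?final"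
    proof
      fix z assume "z \<in> g ` ?good"
      then obtain j where j: "j \<in> ?good" "z = g j" by blast
      have gq: "g j \<in> grid (2 ^ q)"
        unfolding g_def q_def power_add using j k(1) by (intro grid_combine_mem) auto
      have pt: "x + ?l *\<^sub>R vec_of j + (?l / 2 ^ (L * t)) *\<^sub>R vec_of (k j) = x + (l / 2 ^ q) *\<^sub>R vec_of (g j)"
        using vec_of_combine[of "2 ^ (L * t)" x l "2 ^ n" j "k j"] by (simp add: q_def power_add g_def)
      have sc: "?l / 2 ^ (L * t) = l / 2 ^ q" by (simp add: q_def power_add)
      show "z \<in> ?final"
        unfolding j(2) using gq k(2)[OF j(1), unfolded pt, unfolded sc] by blast
    qed
    ultimately have "card ?good \<le> card ?final"
      by (rule card_inj_on_le) (auto intro: finite_subset[OF _ finite_grid])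
    have "real (2 ^ q) powr s = 2 powr (s * q)"
      by (simp add: powr_powr mult.commute flip: powr_realpow)
    also have "\<dots> \<le> 2 powr (real (n * ?d) - 1)" using sq by simp
    also have "\<dots> = 2 ^ (n * ?d) / 2" by (simp add: powr_diff powr_realpow del: of_nat_mult)
    also have "\<dots> \<le> real (card ?good)" by (rule n0[OF n(1) l])
    also have "\<dots> \<le> real (card ?final)" using \<open>card ?good \<le> card ?final\<close> by simp
    finally show "real (2 ^ q) powr s \<le> card ?final" .
  qed
qed

text \<open>The tree keeps the subcubes whose corner has gradient sum at most \<rho>, so
  \<open>many_bounded_cells\<close> provides the branching. Each point of the limit set is close to
  a kept corner at every scale, and stability bounds its own gradient sums.\<close>

lemma hausdorff_measure_lip_points:
  fixes s :: real
  assumes s: "0 \<le> s" "s < CARD('n)" and U: "open U" "U \<noteq> {}" "U \<subseteq> E"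
  shows "hausdorff_measure s (lip_points f \<inter> E) \<noteq> 0"
proof -
  let ?d = "CARD('n)"
  obtain x0 where "x0 \<in> U" using U by blast
  then obtain \<epsilon> where \<epsilon>: "\<epsilon> > 0" "cball x0 \<epsilon> \<subseteq> U" using U(1) open_contains_cball by blast
  \<comment> \<open>A cube of this side with corner \<open>x0\<close> fits into the closed ball of
    radius \<epsilon>.\<close>
  define l0 where "l0 = min 1 (\<epsilon> / ?d)"
  have side: "0 < l0" "l0 \<le> 1" "?d * l0 \<le> \<epsilon>"
    using \<epsilon> by (auto simp: l0_def min_def field_simps)
  obtain q \<rho>0 where "q \<ge> 1" and many:
    "\<And>\<rho> x l. \<lbrakk>\<rho> \<ge> \<rho>0; 0 < l; l \<le> 1; norm (A x l) \<le> \<rho>\<rbrakk> \<Longrightarrow>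
      real (2 ^ q) powr s \<le> card {k \<in> grid (2 ^ q). norm (sub_A x l (2 ^ q) k) \<le> \<rho>}"
    by (rule many_bounded_cells[OF s]) blast
  define m where "m = (2 ^ q :: nat)"
  have "m \<ge> 2" using \<open>q \<ge> 1\<close> power_increasing[of 1 q "2::nat"] by (simp add: m_def)
  define M where "M = nat \<lceil>real m powr s\<rceil>"
  have "real m powr s > 0" using \<open>m \<ge> 2\<close> by simp
  then have Mpos: "M > 0" "real m powr s \<le> M" unfolding M_def by linarith+
  define \<rho> where "\<rho> = max \<rho>0 (norm (A x0 l0))"
  define P where "P n j \<longleftrightarrow> norm (sub_A x0 l0 (m ^ n) j) \<le> \<rho>" for n j
  have ln: "0 < l0 / m ^ n" "l0 / m ^ n \<le> 1" for n
  proof -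
    have "1 \<le> real m ^ n" using \<open>m \<ge> 2\<close> by (intro one_le_power) simp
    moreover from this have "0 < real m ^ n" by linarith
    ultimately show "0 < l0 / m ^ n" "l0 / m ^ n \<le> 1"
      using side by (auto simp: pos_divide_le_eq intro: divide_pos_pos)
  qed
  interpret cube_tree x0 l0 m M P
  proof
    have "vec_of (\<lambda>_. 0) = (0 :: real ^ 'n)" by (simp add: vec_of_def vec_eq_iff)
    then show "P 0 (\<lambda>_. 0)" by (simp add: P_def \<rho>_def)
    fix n and j :: "'n \<Rightarrow> nat" assume "P n j"
    then have "real m powr s \<le> card {k \<in> grid m.
      norm (A (x0 + (l0 / m ^ n) *\<^sub>R vec_of j + (l0 / m ^ n / m) *\<^sub>R vec_of k) (l0 / m ^ n / m)) \<le> \<rho>}"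
      using many[of \<rho> "l0 / m ^ n" "x0 + (l0 / m ^ n) *\<^sub>R vec_of j"] ln[of n]
      by (simp add: P_def m_def \<rho>_def)
    also have "{k \<in> grid m. norm (A (x0 + (l0 / m ^ n) *\<^sub>R vec_of j + (l0 / m ^ n / m) *\<^sub>R vec_of k) (l0 / m ^ n / m)) \<le> \<rho>}
       = {k \<in> grid m. P (Suc n) (\<lambda>i. m * j i + k i)}"
    proof -
      have eq1: "x0 + (l0 / m ^ n) *\<^sub>R vec_of j + (l0 / m ^ Suc n) *\<^sub>R vec_of k
         = x0 + (l0 / m ^ Suc n) *\<^sub>R vec_of (\<lambda>i. m * j i + k i)" for k
        using vec_of_combine[of m x0 l0 "real m ^ n" j k] \<open>m \<ge> 2\<close> by (simp add: mult.commute)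
      have eq2: "l0 / m ^ n / m = l0 / m ^ Suc n" by (simp add: mult.commute)
      show ?thesis unfolding P_def eq2 eq1 ..
    qed
    finally show "M \<le> card {k \<in> grid m. P (Suc n) (\<lambda>i. m * j i + k i)}"
      unfolding M_def by linarith
  qed (use side \<open>m \<ge> 2\<close> Mpos in auto)
  \<comment> \<open>The summands cover the ratio of consecutive generations, the distance from a
    corner to points of its cell, and the passage from scale \<open>l0\<close> to the scales between
    \<open>l0\<close> and 1.\<close>
  define c where "c = m + ?d + 1 / l0"
  have "1 / l0 > 0" "real m \<ge> 2" using side \<open>m \<ge> 2\<close> by auto
  then have c: "c \<ge> m" "c \<ge> ?d" "c \<ge> 1 / l0" "c \<ge> 1"
    unfolding c_def by linarith+
  obtain C where "C \<ge> 0" and C: "\<And>x y r r'. \<lbrakk>0 < r'; r' \<le> r; r \<le> 1; r \<le> c * r'; norm (x - y) \<le> c * r\<rbrakk>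
       \<Longrightarrow> norm (A x r - A y r') \<le> C"
    by (rule A_stable[OF c(4)]) blast
  have "(\<Inter>n. level_set n) \<subseteq> lip_points f \<inter> E"
  proof
    fix x assume x: "x \<in> (\<Inter>n. level_set n)"
    have small: "norm (A x r) \<le> \<rho> + C" if r: "0 < r" "r \<le> l0" for r
    proof -
      obtain n where n: "r \<le> l0 / m ^ n" "l0 / m ^ Suc n < r" by (rule level_exists[OF r])
      obtain j where j: "j \<in> nodes n" "x \<in> cell n j" using x by (auto simp: level_set_def)
      let ?z = "x0 + (l0 / m ^ n) *\<^sub>R vec_of j"
      have "norm (?z - x) \<le> ?d * (l0 / m ^ n)"
        by (rule cell_point_near_corner) (use j(2) in \<open>auto simp: cell_def vec_of_def algebra_simps add_divide_distrib\<close>)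
      also have "\<dots> \<le> c * (l0 / m ^ n)" using ln[of n] c by (intro mult_right_mono) auto
      finally have zx: "norm (?z - x) \<le> c * (l0 / m ^ n)" .
      have "l0 / m ^ n = m * (l0 / m ^ Suc n)" using \<open>m \<ge> 2\<close> by simp
      also have "\<dots> \<le> c * r" using n(2) c ln[of "Suc n"] by (intro mult_mono) auto
      finally have "norm (A ?z (l0 / m ^ n) - A x r) \<le> C"
        using zx r(1) n(1) ln[of n] by (intro C) auto
      moreover have "norm (A ?z (l0 / m ^ n)) \<le> \<rho>" using nodes_P[OF j(1)] by (simp add: P_def)
      moreover have "norm (A x r) \<le> norm (A ?z (l0 / m ^ n)) + norm (A ?z (l0 / m ^ n) - A x r)"
        using norm_triangle_ineq4[of "A ?z (l0 / m ^ n)" "A ?z (l0 / m ^ n) - A x r"] by simp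
      ultimately show ?thesis by linarith
    qed
    have "norm (A x r) \<le> \<rho> + C + C" if r: "0 < r" "r \<le> 1" for r
    proof (cases "r \<le> l0")
      case True
      then show ?thesis using small[of r] r \<open>C \<ge> 0\<close> by simp
    next
      case False
      have "1 \<le> c * l0" using c(3) side by (simp add: divide_le_eq)
      then have "norm (A x r - A x l0) \<le> C" using False r side c by (intro C) auto
      then show ?thesis
        using small[of l0] side norm_triangle_ineq[of "A x r - A x l0" "A x l0"] by simp
    qed
    then have "x \<in> lip_points f" by (rule lip_pointsI)
    moreover have "x \<in> E"
    proof -
      have "x \<in> cell 0 (\<lambda>_. 0)" using x by (auto simp: level_set_def dest: spec[of _ 0])
      then have "norm (x0 - x) \<le> ?d * l0"
        by (intro cell_point_near_corner) (auto simp: cell_def)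
      then have "x \<in> cball x0 \<epsilon>" using side by (simp add: dist_norm)
      then show ?thesis using \<epsilon> U by blast
    qed
    ultimately show "x \<in> lip_points f \<inter> E" by blast
  qed
  then show ?thesis by (rule hausdorff_measure_limit_set[OF s(1) Mpos(2)])
qed

lemma hausdorff_dim_lip_points:
  assumes "is_cube E"
  shows "hausdorff_dim (lip_points f \<inter> E) = of_nat CARD('n)"
proof -
  obtain a :: "real ^ 'n" and T :: "real ^ 'n \<Rightarrow> real ^ 'n" and r :: real
    where T: "orthogonal_transformation T" and "r > 0"
    and sub: "(\<lambda>y. a + T y) ` box 0 (vec r) \<subseteq> E" "E \<subseteq> (\<lambda>y. a + T y) ` cbox 0 (vec r)"
    using assms unfolding is_cube_def by blast
  have lin: "linear T" and surj: "surj T"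
    using T orthogonal_transformation_linear orthogonal_transformation_surj by blast+
  let ?U = "(\<lambda>y. a + T y) ` box 0 (vec r)"
  have img: "(\<lambda>y. a + T y) ` X = (+) a ` T ` X" for X by (simp add: image_image)
  have "open ?U"
    unfolding img by (intro open_translation open_surjective_linear_image lin surj open_box)
  moreover have "?U \<noteq> {}"
  proof -
    have "(vec (r / 2) :: real ^ 'n) \<in> box 0 (vec r)" using \<open>r > 0\<close> by (simp add: mem_box_cart)
    then show ?thesis by blast
  qed
  moreover have "bounded E"
  proof (rule bounded_subset[OF _ sub(2)])
    show "bounded ((\<lambda>y. a + T y) ` cbox 0 (vec r))"
      unfolding img by (intro bounded_translation bounded_linear_image bounded_cbox linear_conv_bounded_linear[THEN iffD1] lin)
  qed
  ultimately show ?thesis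
    using hausdorff_measure_lip_points sub(1)
    by (intro hausdorff_dim_eq_CARD) (auto intro: bounded_subset)
qed

end

theorem theorem3:
  fixes \<phi> :: "real ^ 'n \<Rightarrow> real" and \<alpha> b :: real
  assumes "0 < \<alpha>" "\<alpha> < 1"
    and "\<phi> \<in> C2_class \<alpha>"
    and "one_periodic \<phi>"
    and "condition_H \<phi>"
    and "b > 1"
  shows "(weierstrass_fun b \<phi> \<in> zygmund_class \<and>
       (\<forall>x. \<not> weierstrass_fun b \<phi> differentiable (at x)))
    \<and> ((\<forall>e. norm e = 1 \<longrightarrow> dir_lip_points (weierstrass_fun b \<phi>) e \<in> null_sets lebesgue) \<and>
       lip_points (weierstrass_fun b \<phi>) \<in> null_sets lebesgue)
    \<and> (\<forall>Q. is_cube Q \<longrightarrow>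
       hausdorff_dim (lip_points (weierstrass_fun b \<phi>) \<inter> Q) = of_nat CARD('n))"
proof -
  obtain G :: "real ^ 'n \<Rightarrow> real ^ 'n" and K where
    "\<And>x. \<bar>\<phi> x\<bar> \<le> K" "\<And>x. norm (G x) \<le> K" "\<And>x y. norm (G x - G y) \<le> K * norm (x - y)"
    "\<And>x h. \<bar>\<phi> (x + h) - \<phi> x - G x \<bullet> h\<bar> \<le> K * (norm h)\<^sup>2"
    using C2_periodic_bounds[OF assms(1,3,4)] by metis
  then interpret weierstrass_series \<phi> G K b
    using assms by unfold_locales
  show ?thesis
    using zygmund nowhere_differentiable null_dir_lip_points null_lip_points hausdorff_dim_lip_points
    unfolding f_def by blast
qed

end
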